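(* Let $r\ge1$, $\lambda\vdash r$ with conjugate partition $\lambda^T$, and let $\mathcal{T}$ be any standard Young tableau of shape $\lambda$. Let $A=(\alpha_{\lambda^T_i-i+j})_{1\le i,j\le\lambda_1}$ and $B=(\beta_{\lambda_i-i+j})_{1\le i,j\le\lambda^T_1}$. Then $$\det(A)=\det(B)=\mathrm{str}_{1,\ldots,r}\big(\mathcal{E}^{\lambda}_{\mathcal{T}}X_1\cdots X_r\big)=\sum_{I}\frac{\mathrm{Imm}_{\chi^\lambda}(X_I)}{\alpha(I)},$$ where the sum runs over all non-decreasing multisets $I$ of $[m+n]$ with $|I|=r$.
   Context: $\mathbb{C}^{m|n}$ has homogeneous basis $e_1,\ldots,e_{m+n}$, parity $\bar i=0$ for $i\le m$, $\bar i=1$ for $i>m$; $e_{ij}$ are matrix units of parity $\bar i+\bar j$. $\mathcal{A}=A(\mathrm{Mat}_{m|n})$ is the free supercommutative $\mathbb{C}$-algebra on generators $x_{ij}$ of parity $\bar i+\bar j$. For $k\ge1$, $X_a=\sum_{i,j}x_{ij}\otimes1^{\otimes(a-1)}\otimes e_{ij}\otimes1^{\otimes(k-a)}\in\mathcal{A}\otimes\mathrm{End}(\mathbb{C}^{m|n})^{\otimes k}$ (graded tensor products, sign rule $(a\otimes b)(c\otimes d)=(-1)^{|b||c|}ac\otimes bd$). $\mathfrak{S}_k$ acts on $(\mathbb{C}^{m|n})^{\otimes k}$ by $\sigma\cdot(e_{i_1}\otimes\cdots\otimes e_{i_k})=(-1)^{\bar I_\sigma}e_{i_{\sigma^{-1}(1)}}\otimes\cdots\otimes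 e_{i_{\sigma^{-1}(k)}}$, $\bar I_\sigma=\sum_{p<q,\sigma(p)>\sigma(q)}\bar i_p\bar i_q$, extended to $\mathbb{C}[\mathfrak{S}_k]$ (even elements $1\otimes(\cdot)$). For even $T=\sum_{I,J}T^I_J\otimes e_{i_1j_1}\otimes\cdots\otimes e_{i_kj_k}$, $\langle I\mid T\mid J\rangle=(-1)^{\gamma(I,J)}T^I_J$, $\gamma(I,J)=\sum_a\bar i_a(\bar j_a+1)+\sum_{a<b}\bar j_b(\bar i_a+\bar j_a)$, and $\mathrm{str}_{1,\ldots,k}(T)=\sum_{I}(-1)^{\bar I}\langle I\mid T\mid I\rangle$ (sum over all $k$-tuples, $\bar I=\sum_p\bar i_p$). Super-immanant: $\mathrm{Imm}_\chi(X_I)=(-1)^{\bar I}\langle I\mid\chi X_1\cdots X_k\mid I\rangle$, with a character $\chi$ identified with $\sum_\sigma\chi(\sigma)\sigma$; $\chi^\lambda$ is the irreducible character for $\lambda$. $\mathcal{E}^{\lambda}_{\mathcal{T}}$ is the primitive Young seminormal idempotent of $\mathbb{C}[\mathfrak{S}_r]$ attached to $\mathcal{T}$ (characterized by $y_k\mathcal{E}^\lambda_{\mathcal{T}}=c_k(\mathcal{T})\mathcal{E}^\lambda_{\mathcal{T}}$ for the Jucys–Murphy elements $y_k=\sum_{i<k}(i\,k)$, $c_k(\mathcal{T})$ the content of the box containing $k$). For a non-decreasing multiset $I$, $\alpha(I)=\prod_i\alpha_i!$, $\alpha_i$ the multiplicity of $i$. Define $\alpha_0=\beta_0=1$, $\alpha_k=\beta_k=0$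 for $k<0$, and for $k>0$: $\alpha_k=\mathrm{str}_{1,\ldots,k}(\mathcal{E}^{(1^k)}X_1\cdots X_k)$ and $\beta_k=\mathrm{str}_{1,\ldots,k}(\mathcal{E}^{(k)}X_1\cdots X_k)$, where $\mathcal{E}^{(1^k)}=\frac1{k!}\sum_{\sigma}\mathrm{sgn}(\sigma)\sigma$ and $\mathcal{E}^{(k)}=\frac1{k!}\sum_\sigma\sigma$. These are even elements of $\mathcal{A}$, so the determinants are taken in the commutative ring $\mathcal{A}_0$. *)

theory Defs
  imports Complex_Main "HOL-Library.Multiset" "HOL-Combinatorics.Permutations"
    "HOL-Combinatorics.Transposition"
begin

section \<open>The free supercommutative algebra A(Mat_{m|n})\<close>

text \<open>Indices run over 1..m+n; index i has parity 1 iff m < i.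
  Monomials are multisets of generators (i,j); the element x_ij has parity bar i + bar j.
  An element of A is its coefficient function on monomials; a monomial stands for the
  product of its even generators times its odd generators in increasing lexicographic order.\<close>

type_synonym mon = "(nat \<times> nat) multiset"
type_synonym sa = "mon \<Rightarrow> complex"

definition bp :: "nat \<Rightarrow> nat \<Rightarrow> nat" where
  "bp m i = (if m < i then 1 else 0)"

definition gen_odd :: "nat \<Rightarrow> nat \<times> nat \<Rightarrow> bool" where
  "gen_odd m g = odd (bp m (fst g) + bp m (snd g))"

definition glt :: "nat \<times> nat \<Rightarrow> nat \<times> nat \<Rightarrow> bool" where
  "glt h g = (fst h < fst g \<or> (fst h = fst g \<and> snd h < snd g))"

definition mon_sign :: "nat \<Rightarrow> mon \<Rightarrow> mon \<Rightarrow> complex" where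
  "mon_sign m a b =
     (if \<exists>g. gen_odd m g \<and> 2 \<le> count a g + count b g then 0
      else (-1) ^ card {(g, h). g \<in># a \<and> h \<in># b \<and> gen_odd m g \<and> gen_odd m h \<and> glt h g})"

definition sa_mult :: "nat \<Rightarrow> sa \<Rightarrow> sa \<Rightarrow> sa" where
  "sa_mult m f g = (\<lambda>c. \<Sum>a\<in>{a. a \<subseteq># c}. mon_sign m a (c - a) * f a * g (c - a))"

definition sa_zero :: sa where "sa_zero = (\<lambda>_. 0)"
definition sa_one :: sa where "sa_one = (\<lambda>c. if c = {#} then 1 else 0)"
definition sa_gen :: "nat \<Rightarrow> nat \<Rightarrow> sa" where
  "sa_gen i j = (\<lambda>c. if c = {#(i, j)#} then 1 else 0)"
definition sa_scal :: "complex \<Rightarrow> sa \<Rightarrow> sa" where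
  "sa_scal z f = (\<lambda>c. z * f c)"
definition sa_sum :: "('b \<Rightarrow> sa) \<Rightarrow> 'b set \<Rightarrow> sa" where
  "sa_sum F S = (\<lambda>c. \<Sum>x\<in>S. F x c)"

text \<open>Parity twist: sa_twist m e f = f_0 + (-1)^e f_1 (f_0, f_1 the even/odd parts).\<close>
definition sa_twist :: "nat \<Rightarrow> nat \<Rightarrow> sa \<Rightarrow> sa" where
  "sa_twist m e f = (\<lambda>c. (-1) ^ (e * size (filter_mset (gen_odd m) c)) * f c)"

section \<open>A \<otimes> End(C^{m|n})^{\<otimes>k}\<close>

text \<open>An element T = sum T^I_J \<otimes> e_{i1 j1} \<otimes> ... \<otimes> e_{ik jk} is stored as the function
  (I, J) \<mapsto> T^I_J, for I, J k-tuples (lists) over 1..m+n.\<close>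

type_synonym tens = "nat list \<Rightarrow> nat list \<Rightarrow> sa"

definition idx :: "nat \<Rightarrow> nat \<Rightarrow> nat \<Rightarrow> nat list set" where
  "idx m n k = {I. length I = k \<and> set I \<subseteq> {1..m+n}}"

definition bsum :: "nat \<Rightarrow> nat list \<Rightarrow> nat" where
  "bsum m I = (\<Sum>p<length I. bp m (I ! p))"

text \<open>Sign of (e_{IJ})(e_{KL}) in the graded tensor product of k copies of End:
  (-1)^{sum_{p>q} |E_p||F_q|}.\<close>
definition esign :: "nat \<Rightarrow> nat \<Rightarrow> nat list \<Rightarrow> nat list \<Rightarrow> nat list \<Rightarrow> nat list \<Rightarrow> complex" where
  "esign m k I J K L = (-1) ^ (\<Sum>p<k. \<Sum>q<p.
      (bp m (I ! p) + bp m (J ! p)) * (bp m (K ! q) + bp m (L ! q)))"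

text \<open>Product: (a \<otimes> E)(b \<otimes> F) = (-1)^{|E||b|} ab \<otimes> EF.\<close>
definition tmult :: "nat \<Rightarrow> nat \<Rightarrow> nat \<Rightarrow> tens \<Rightarrow> tens \<Rightarrow> tens" where
  "tmult m n k S T = (\<lambda>I L. sa_sum (\<lambda>J. sa_scal (esign m k I J J L)
       (sa_mult m (S I J) (sa_twist m (bsum m I + bsum m J) (T J L)))) (idx m n k))"

definition tone :: tens where
  "tone = (\<lambda>I J. if I = J then sa_one else sa_zero)"

text \<open>X_{a+1} (0-based position a).\<close>
definition Xop :: "nat \<Rightarrow> tens" where
  "Xop a = (\<lambda>I J. if length I = length J \<and> (\<forall>b<length I. b \<noteq> a \<longrightarrow> I ! b = J ! b)
                   then sa_gen (I ! a) (J ! a) else sa_zero)"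

definition Xprod :: "nat \<Rightarrow> nat \<Rightarrow> nat \<Rightarrow> tens" where
  "Xprod m n k = foldl (\<lambda>T a. tmult m n k T (Xop a)) tone [0..<k]"

type_synonym galg = "(nat \<Rightarrow> nat) \<Rightarrow> complex"

definition perms :: "nat \<Rightarrow> (nat \<Rightarrow> nat) set" where
  "perms k = {\<sigma>. \<sigma> permutes {1..k}}"

text \<open>sigma . (e_{j1} \<otimes> ... \<otimes> e_{jk}) = (-1)^{J_sigma} e_{j_{sigma^-1(1)}} \<otimes> ...\<close>
definition pact :: "(nat \<Rightarrow> nat) \<Rightarrow> nat list \<Rightarrow> nat list" where
  "pact \<sigma> J = map (\<lambda>p. J ! (inv \<sigma> (Suc p) - 1)) [0..<length J]"

definition pinv_sign :: "nat \<Rightarrow> (nat \<Rightarrow> nat) \<Rightarrow> nat list \<Rightarrow> nat" where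
  "pinv_sign m \<sigma> J = (\<Sum>p\<in>{1..length J}. \<Sum>q\<in>{1..length J}.
       if p < q \<and> \<sigma> q < \<sigma> p then bp m (J ! (p - 1)) * bp m (J ! (q - 1)) else 0)"

text \<open>Koszul sign of the action of e_{IJ} on e_J:
  (f_1 \<otimes>..\<otimes> f_k)(v_1 \<otimes>..\<otimes> v_k) = (-1)^{sum_{a>b}|f_a||v_b|} f_1 v_1 \<otimes>..\<otimes> f_k v_k.\<close>
definition act_sign :: "nat \<Rightarrow> nat list \<Rightarrow> nat list \<Rightarrow> complex" where
  "act_sign m I J = (-1) ^ (\<Sum>a<length J. \<Sum>b<a. (bp m (I ! a) + bp m (J ! a)) * bp m (J ! b))"

text \<open>Coefficients (in the basis e_{IJ}) of the element 1 \<otimes> sigma whose action on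
  (C^{m|n})^{\<otimes>k} is the given one.\<close>
definition perm_op :: "nat \<Rightarrow> (nat \<Rightarrow> nat) \<Rightarrow> tens" where
  "perm_op m \<sigma> = (\<lambda>I J. sa_scal
      (if I = pact \<sigma> J then act_sign m I J * (-1) ^ pinv_sign m \<sigma> J else 0) sa_one)"

definition galg_op :: "nat \<Rightarrow> nat \<Rightarrow> galg \<Rightarrow> tens" where
  "galg_op m k f = (\<lambda>I J. sa_sum (\<lambda>\<sigma>. sa_scal (f \<sigma>) (perm_op m \<sigma> I J)) (perms k))"

definition gdelta :: "(nat \<Rightarrow> nat) \<Rightarrow> galg" where
  "gdelta \<sigma> = (\<lambda>\<tau>. if \<tau> = \<sigma> then 1 else 0)"

definition gmult :: "nat \<Rightarrow> galg \<Rightarrow> galg \<Rightarrow> galg" where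
  "gmult k f g = (\<lambda>\<tau>. if \<tau> \<in> perms k then (\<Sum>\<sigma>\<in>perms k. f \<sigma> * g (inv \<sigma> \<circ> \<tau>)) else 0)"

definition jm :: "nat \<Rightarrow> galg" where
  "jm j = (\<lambda>\<tau>. \<Sum>i\<in>{1..<j}. if \<tau> = transpose i j then 1 else 0)"

definition is_partition :: "nat \<Rightarrow> nat list \<Rightarrow> bool" where
  "is_partition r lam = (sorted (rev lam) \<and> (\<forall>x\<in>set lam. 0 < x) \<and> sum_list lam = r)"

definition part :: "nat list \<Rightarrow> nat \<Rightarrow> nat" where
  "part lam i = (if 1 \<le> i \<and> i \<le> length lam then lam ! (i - 1) else 0)"

definition conjp :: "nat list \<Rightarrow> nat \<Rightarrow> nat" where
  "conjp lam i = card {j. j < length lam \<and> i \<le> lam ! j}"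

definition diagram :: "nat list \<Rightarrow> (nat \<times> nat) set" where
  "diagram lam = {(i, j). 1 \<le> i \<and> i \<le> length lam \<and> 1 \<le> j \<and> j \<le> lam ! (i - 1)}"

text \<open>A standard Young tableau: T k = (row, column) of the box containing k.\<close>
definition is_syt :: "nat \<Rightarrow> nat list \<Rightarrow> (nat \<Rightarrow> nat \<times> nat) \<Rightarrow> bool" where
  "is_syt r lam T = (bij_betw T {1..r} (diagram lam) \<and>
     (\<forall>a\<in>{1..r}. \<forall>b\<in>{1..r}. fst (T a) \<le> fst (T b) \<and> snd (T a) \<le> snd (T b) \<longrightarrow> a \<le> b))"

definition content :: "(nat \<Rightarrow> nat \<times> nat) \<Rightarrow> nat \<Rightarrow> int" where
  "content T k = int (snd (T k)) - int (fst (T k))"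

definition seminormal :: "nat \<Rightarrow> (nat \<Rightarrow> nat \<times> nat) \<Rightarrow> galg" where
  "seminormal r T = (THE e. gmult r e e = e \<and> e \<noteq> (\<lambda>_. 0) \<and>
      (\<forall>k\<in>{1..r}. gmult r (jm k) e = (\<lambda>\<tau>. of_int (content T k) * e \<tau>) \<and>
                   gmult r e (jm k) = (\<lambda>\<tau>. of_int (content T k) * e \<tau>)))"

text \<open>Irreducible character chi^lambda: trace of sigma acting by left multiplication on the
  irreducible left ideal C[S_r] E^lambda_T (trace of x \<mapsto> sigma x E_T on C[S_r]).\<close>
definition irr_char :: "nat \<Rightarrow> nat list \<Rightarrow> galg" where
  "irr_char r lam = (\<lambda>\<sigma>. let E = seminormal r (SOME T. is_syt r lam T) in
      \<Sum>\<tau>\<in>perms r. gmult r (gmult r (gdelta \<sigma>) (gdelta \<tau>)) E \<tau>)"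

definition antisym_idem :: "nat \<Rightarrow> galg" where
  "antisym_idem k = (\<lambda>\<sigma>. if \<sigma> \<in> perms k then of_int (sign \<sigma>) / fact k else 0)"

definition sym_idem :: "nat \<Rightarrow> galg" where
  "sym_idem k = (\<lambda>\<sigma>. if \<sigma> \<in> perms k then 1 / fact k else 0)"

definition gam :: "nat \<Rightarrow> nat list \<Rightarrow> nat list \<Rightarrow> nat" where
  "gam m I J = (\<Sum>a<length I. bp m (I ! a) * (bp m (J ! a) + 1)) +
     (\<Sum>a<length I. \<Sum>b<length I. if a < b then bp m (J ! b) * (bp m (I ! a) + bp m (J ! a)) else 0)"

definition bra :: "nat \<Rightarrow> nat list \<Rightarrow> tens \<Rightarrow> nat list \<Rightarrow> sa" where
  "bra m I T J = sa_scal ((-1) ^ gam m I J) (T I J)"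

definition str :: "nat \<Rightarrow> nat \<Rightarrow> nat \<Rightarrow> tens \<Rightarrow> sa" where
  "str m n k T = sa_sum (\<lambda>I. sa_scal ((-1) ^ bsum m I) (bra m I T I)) (idx m n k)"

definition Imm :: "nat \<Rightarrow> nat \<Rightarrow> nat \<Rightarrow> galg \<Rightarrow> nat list \<Rightarrow> sa" where
  "Imm m n k chi I = sa_scal ((-1) ^ bsum m I)
      (bra m I (tmult m n k (galg_op m k chi) (Xprod m n k)) I)"

definition alph :: "nat \<Rightarrow> nat \<Rightarrow> int \<Rightarrow> sa" where
  "alph m n k = (if k < 0 then sa_zero else if k = 0 then sa_one else
      str m n (nat k) (tmult m n (nat k) (galg_op m (nat k) (antisym_idem (nat k))) (Xprod m n (nat k))))"

definition bet :: "nat \<Rightarrow> nat \<Rightarrow> int \<Rightarrow> sa" where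
  "bet m n k = (if k < 0 then sa_zero else if k = 0 then sa_one else
      str m n (nat k) (tmult m n (nat k) (galg_op m (nat k) (sym_idem (nat k))) (Xprod m n (nat k))))"

definition sa_det :: "nat \<Rightarrow> nat \<Rightarrow> (nat \<Rightarrow> nat \<Rightarrow> sa) \<Rightarrow> sa" where
  "sa_det m N M = sa_sum (\<lambda>p. sa_scal (of_int (sign p))
      (foldr (\<lambda>i acc. sa_mult m (M i (p i)) acc) [1..<N+1] sa_one)) {p. p permutes {1..N}}"

definition multfact :: "nat list \<Rightarrow> nat" where
  "multfact I = (\<Prod>i\<in>set I. fact (count_list I i))"

end

theory Submission
  imports Defs "HOL-Library.FuncSet" "HOL-Library.Poly_Mapping"
    "HOL-Combinatorics.Multiset_Permutations"
begin

text \<open>For a fixed monomial \<open>c\<close>, the coefficient at \<open>c\<close> of \<open>str (\<sigma> X\<^sub>1 \<dots> X\<^sub>r)\<close> is a class function of \<open>\<sigma>\<close>,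
  and as \<open>r\<close> varies these functions are multiplicative along Young subgroups.  For any class
  function \<open>f\<close>, extended linearly to the group algebra, we show \<open>f (E\<^sub>T) = \<langle>\<psi>\<^sub>\<lambda>, f\<rangle>\<close>, where \<open>\<psi>\<^sub>\<lambda>\<close> is
  the alternating sum of Young permutation characters of shapes \<open>\<lambda>\<^sub>i - i + p(i)\<close>; multiplicativity
  then turns the right-hand side into the Jacobi--Trudi determinant.

  The identity is an induction on \<open>r\<close>.  If \<open>U\<close> is obtained from \<open>T\<close> by removing \<open>r\<close>, then \<open>E\<^sub>T\<close> is
  \<open>E\<^sub>U\<close> times a Lagrange interpolation polynomial in \<open>y\<^sub>r\<close>, and \<open>2 y\<^sub>r\<close> is a difference of the central
  elements \<open>\<Sum>\<^sub>i\<^sub>\<noteq>\<^sub>j (i j)\<close> of consecutive symmetric groups, for which \<open>\<psi>\<^sub>\<lambda>\<close> is an eigenvector.  Together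
  with the branching rule \<open>\<Sum>\<^sub>i \<psi>\<^sub>\<mu>\<^sub>+\<^sub>e\<^sub>i = Ind \<psi>\<^sub>\<mu>\<close> this evaluates \<open>f (P(y\<^sub>r) E\<^sub>U)\<close> for every polynomial \<open>P\<close>.
  Taking for \<open>f\<close> the coefficient of the identity shows that \<open>\<Prod>\<^sub>i (y\<^sub>r - a\<^sub>i) E\<^sub>U\<close>, with \<open>a\<^sub>i\<close> running over
  the row ends, has norm 0, so \<open>E\<^sub>T\<close> has the required eigenvalues.  Restricting \<open>\<psi>\<^sub>\<lambda>\<close> to smaller symmetric
  groups gives \<open>\<psi>\<^sub>\<lambda> (E\<^sub>T) = 1\<close>; hence \<open>x \<mapsto> E\<^sub>T x E\<^sub>T\<close> is an orthogonal projection of trace 1, which yields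
  the uniqueness of the seminormal idempotent and identifies \<open>\<psi>\<^sub>\<lambda>\<close> with \<open>\<chi>\<^sup>\<lambda>\<close>.

  The determinant in the \<open>\<alpha>\<^sub>k\<close> is the same statement for the transposed tableau and the class function
  twisted by the sign character.\<close>

section \<open>Alternating sums over permutations\<close>

text \<open>No representation theory of the symmetric groups is presupposed: the characters are
  counts of words fixed by a permutation. Words of content \<open>b\<close> span a weight space of a
  tensor power of an \<open>N\<close>-dimensional space, and the Casimir eigenvalue of
  \<open>alt_char\<close> comes from the trace of \<open>\<sigma>\<close> composed with two opposite
  root vectors. Cyclicity of that trace takes the place of highest weight theory. The obstacle is
  that the seminormal idempotent is a definite description, and the irreducible character is defined
  through it; existence of a good element therefore says nothing until it is known to be unique up
  to a scalar. Uniqueness is obtained from positivity, which is why the group algebra has real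
  coefficients: there the coefficient of the identity in \<open>x * star x\<close> is a sum of
  squares. Complex elements are split into real and imaginary parts, which is harmless because
  contents are integers. One empty row beyond the length of \<open>lam\<close> is carried along, so
  that a box can open a new row without changing \<open>N\<close>.\<close>

lemma sum_involution_eq_0:
  fixes f :: "'a \<Rightarrow> 'b::{idom,ring_char_0}"
  assumes "\<And>x. x \<in> S \<Longrightarrow> \<tau> x \<in> S" "\<And>x. x \<in> S \<Longrightarrow> \<tau> (\<tau> x) = x" "\<And>x. x \<in> S \<Longrightarrow> f (\<tau> x) = - f x"
  shows "sum f S = 0"
proof -
  have "sum f S = (\<Sum>x\<in>S. - f x)"
    by (rule sum.reindex_bij_witness[of S \<tau> \<tau>]) (use assms in auto)
  then have "2 * sum f S = 0" by (simp add: sum_negf)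
  then show ?thesis by simp
qed

definition shift_pair :: "nat \<Rightarrow> nat \<Rightarrow> int \<Rightarrow> (nat \<Rightarrow> int) \<Rightarrow> nat \<Rightarrow> int" where
  "shift_pair i j k b = b(i := b i + k, j := b j - k)"

abbreviation Perm :: "nat \<Rightarrow> (nat \<Rightarrow> nat) set" where
  "Perm N \<equiv> {p. p permutes {..<N}}"

lemma finite_Perm [simp]: "finite (Perm N)"
  by (simp add: finite_permutations)

lemma finite_Perm_Collect [simp]: "finite {p. p permutes {..<N::nat} \<and> P p}"
  by (rule finite_subset[OF _ finite_Perm[of N]]) auto

text \<open>With \<open>a i\<close> a part minus its row index, the entry at \<open>i\<close> is the
  subscript in row \<open>i\<close> and column \<open>p i\<close> of the Jacobi--Trudi matrix, rows
  and columns numbered from 0.\<close>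

definition shifted :: "(nat \<Rightarrow> int) \<Rightarrow> (nat \<Rightarrow> nat) \<Rightarrow> nat \<Rightarrow> int" where
  "shifted a p = (\<lambda>i. a i + int (p i))"

lemma Perm_swap: "p \<in> Perm N \<Longrightarrow> i < N \<Longrightarrow> j < N \<Longrightarrow> p \<circ> transpose i j \<in> Perm N"
  using permutes_compose[OF permutes_swap_id[of i "{..<N}" j]] by simp

lemma sign_swap: "p \<in> Perm N \<Longrightarrow> i \<noteq> j \<Longrightarrow> sign (p \<circ> transpose i j) = - sign p"
  by (subst sign_compose) (auto simp: sign_swap_id permutation_swap_id permutes_imp_permutation[of "{..<N}"])

lemma swap_swap: "p \<circ> transpose i j \<circ> transpose i j = p"
  by (simp add: comp_assoc)

lemma Perm_inj: "p \<in> Perm N \<Longrightarrow> p i = p j \<longleftrightarrow> i = j"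
  using permutes_inj[of p] by (auto dest: injD)

lemma Perm_less: "p \<in> Perm N \<Longrightarrow> p i < N \<longleftrightarrow> i < N"
  using permutes_in_image[of p "{..<N}" i] by auto

lemma Perm_inv: "p \<in> Perm N \<Longrightarrow> p (inv p x) = x" "p \<in> Perm N \<Longrightarrow> inv p (p x) = x"
  using permutes_inverses by auto

lemma Perm_inv_less: "p \<in> Perm N \<Longrightarrow> inv p x < N \<longleftrightarrow> x < N"
  using Perm_less[of p N "inv p x"] by (simp add: Perm_inv)

lemma shifted_swap:
  "i \<noteq> j \<Longrightarrow> shifted a (p \<circ> transpose i j) = shift_pair i j (int (p j) - int (p i)) (shifted a p)"
  by (auto simp: shifted_def shift_pair_def transpose_def fun_eq_iff)

text \<open>The defect of commuting the Casimir operator past the alternating sum: the telescoped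
  exchange terms \<open>G\<close> reduce to \<open>H\<close>, and the intermediate terms cancel in pairs.\<close>
locale exchange =
  fixes N :: nat and H :: "(nat \<Rightarrow> int) \<Rightarrow> int" and G :: "nat \<Rightarrow> nat \<Rightarrow> (nat \<Rightarrow> int) \<Rightarrow> int"
  assumes G_sym: "i < N \<Longrightarrow> j < N \<Longrightarrow> i \<noteq> j \<Longrightarrow> G i j b = G j i b"
    and G_step: "i < N \<Longrightarrow> j < N \<Longrightarrow> i \<noteq> j \<Longrightarrow>
      G i j b + b j * H b = G i j (shift_pair i j 1 b) + (b i + 1) * H (shift_pair i j 1 b)"
begin

lemma G_telescope:
  assumes "i < N" "j < N" "i \<noteq> j"
  shows "G i j b - G i j (shift_pair i j (int d) b) =
    (\<Sum>k<d. (b i + int k + 1) * H (shift_pair i j (int k + 1) b) - (b j - int k) * H (shift_pair i j (int k) b))"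
proof (induction d)
  case 0
  then show ?case by (simp add: shift_pair_def)
next
  case (Suc d)
  have eq: "shift_pair i j 1 (shift_pair i j (int d) b) = shift_pair i j (int d + 1) b"
    using assms by (auto simp: shift_pair_def fun_eq_iff)
  have "shift_pair i j (int d) b j = b j - int d" "shift_pair i j (int d) b i = b i + int d"
    using assms by (auto simp: shift_pair_def)
  then show ?case
    using G_step[OF assms, of "shift_pair i j (int d) b"] Suc by (simp add: eq add_ac)
qed

text \<open>Each intermediate vector receives one term from the step into it and one from the step
  out of it; only the two ends keep a single term.\<close>

lemma G_telescope':
  assumes "i < N" "j < N" "i \<noteq> j" "0 < d"
  shows "G i j b - G i j (shift_pair i j (int d) b) =
    (b i + int d) * H (shift_pair i j (int d) b) - b j * H b
    + (\<Sum>k\<in>{0<..<d}. ((b i + int k) - (b j - int k)) * H (shift_pair i j (int k) b))"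
proof -
  have 1: "(\<Sum>k<d. (b i + int k + 1) * H (shift_pair i j (int k + 1) b)) =
      (\<Sum>k\<in>{0<..d}. (b i + int k) * H (shift_pair i j (int k) b))"
    by (rule sum.reindex_bij_witness[of _ "\<lambda>k. k - 1" Suc]) (auto simp: add_ac)
  have 2: "{0<..d} = insert d {0<..<d}" "{..<d} = insert 0 {0<..<d}" using assms by auto
  have 3: "shift_pair i j 0 b = b" by (simp add: shift_pair_def)
  have 4: "(\<Sum>k\<in>{0<..<d}. ((b i + int k) - (b j - int k)) * H (shift_pair i j (int k) b)) =
      (\<Sum>k\<in>{0<..<d}. (b i + int k) * H (shift_pair i j (int k) b)) - (\<Sum>k\<in>{0<..<d}. (b j - int k) * H (shift_pair i j (int k) b))"
    unfolding sum_subtractf[symmetric] by (rule sum.cong) (simp_all only: left_diff_distrib)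
  show ?thesis
    unfolding G_telescope[OF assms(1-3)] sum_subtractf 1 4 unfolding 2 by (simp add: 3)
qed

text \<open>The vectors of \<open>p\<close> and of \<open>p \<circ> transpose i j\<close> are joined
  by \<open>p j - p i\<close> unit shifts; \<open>k\<close> marks a vector strictly between
  them.\<close>

definition Q :: "((nat \<Rightarrow> nat) \<times> nat \<times> nat \<times> nat) set" where
  "Q = (SIGMA p:Perm N. SIGMA i:{..<N}. SIGMA j:{j. j < N \<and> p i < p j}. {0<..<p j - p i})"

text \<open>Row \<open>l\<close> with \<open>p l = p j - k\<close> takes over the role of
  \<open>j\<close>: exchanging the values at \<open>j\<close> and \<open>l\<close> and then shifting
  from \<open>l\<close> instead of \<open>j\<close> leads to the same vector. The coefficient sees
  row \<open>i\<close> only, and the sign flips.\<close>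

lemma intermediate_terms_fst:
  "(\<Sum>(p,i,j,k)\<in>Q. sign p * ((shifted a p i + int k) * H (shift_pair i j (int k) (shifted a p)))) = 0"
proof (rule sum_involution_eq_0[where \<tau> = "\<lambda>(p,i,j,k). (p \<circ> transpose j (inv p (p j - k)), i, inv p (p j - k), k)"], goal_cases)
  case (1 x)
  obtain p i j k where x: "x = (p,i,j,k)" by (cases x)
  with 1 have *: "p \<in> Perm N" "i < N" "j < N" "p i < p j" "0 < k" "k < p j - p i" by (auto simp: Q_def)
  define l where "l = inv p (p j - k)"
  have pl: "p l = p j - k" using * by (simp add: l_def Perm_inv)
  have "p j < N" using * by (simp add: Perm_less)
  then have l: "l < N" using * unfolding l_def by (subst Perm_inv_less) auto
  have ne: "l \<noteq> i" "l \<noteq> j" "i \<noteq> j" using pl * by auto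
  show ?case using * l ne pl Perm_swap[OF *(1) \<open>j < N\<close> l] by (auto simp: x Q_def l_def[symmetric])
next
  case (2 x)
  obtain p i j k where x: "x = (p,i,j,k)" by (cases x)
  with 2 have *: "p \<in> Perm N" "i < N" "j < N" "p i < p j" "0 < k" "k < p j - p i" by (auto simp: Q_def)
  define l where "l = inv p (p j - k)"
  have pl: "p l = p j - k" using * by (simp add: l_def Perm_inv)
  have "p j < N" using * by (simp add: Perm_less)
  then have l: "l < N" using * unfolding l_def by (subst Perm_inv_less) auto
  have "p \<circ> transpose j l \<in> Perm N" using * l by (intro Perm_swap) auto
  then have "inv (p \<circ> transpose j l) ((p \<circ> transpose j l) l - k) = j"
    using Perm_inv(2)[of "p \<circ> transpose j l" N j] pl by simp
  then show ?case by (simp add: x l_def[symmetric] comp_assoc transpose_commute)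
next
  case (3 x)
  obtain p i j k where x: "x = (p,i,j,k)" by (cases x)
  with 3 have *: "p \<in> Perm N" "i < N" "j < N" "p i < p j" "0 < k" "k < p j - p i" by (auto simp: Q_def)
  define l where "l = inv p (p j - k)"
  have pl: "p l = p j - k" using * by (simp add: l_def Perm_inv)
  have ne: "l \<noteq> i" "l \<noteq> j" "i \<noteq> j" using pl * by auto
  have u: "shift_pair i l (int k) (shifted a (p \<circ> transpose j l)) = shift_pair i j (int k) (shifted a p)"
    using ne pl * by (auto simp: shift_pair_def shifted_def fun_eq_iff transpose_def)
  have s: "shifted a (p \<circ> transpose j l) i = shifted a p i" using ne by (simp add: shifted_def)
  show ?case using ne sign_swap[OF *(1), of j l] by (simp add: x l_def[symmetric] u s)
qed

text \<open>Mirror image: the coefficient now sees row \<open>j\<close> only, so \<open>i\<close> is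
  exchanged with the row of value \<open>p i + k\<close>.\<close>

lemma intermediate_terms_snd:
  "(\<Sum>(p,i,j,k)\<in>Q. sign p * ((shifted a p j - int k) * H (shift_pair i j (int k) (shifted a p)))) = 0"
proof (rule sum_involution_eq_0[where \<tau> = "\<lambda>(p,i,j,k). (p \<circ> transpose i (inv p (p i + k)), inv p (p i + k), j, k)"], goal_cases)
  case (1 x)
  obtain p i j k where x: "x = (p,i,j,k)" by (cases x)
  with 1 have *: "p \<in> Perm N" "i < N" "j < N" "p i < p j" "0 < k" "k < p j - p i" by (auto simp: Q_def)
  define l where "l = inv p (p i + k)"
  have pl: "p l = p i + k" using * by (simp add: l_def Perm_inv)
  have "p j < N" using * by (simp add: Perm_less)
  then have l: "l < N" using * unfolding l_def by (subst Perm_inv_less) auto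
  have ne: "l \<noteq> i" "l \<noteq> j" "i \<noteq> j" using pl * by auto
  show ?case using * l ne pl Perm_swap[OF *(1) \<open>i < N\<close> l] by (auto simp: x Q_def l_def[symmetric])
next
  case (2 x)
  obtain p i j k where x: "x = (p,i,j,k)" by (cases x)
  with 2 have *: "p \<in> Perm N" "i < N" "j < N" "p i < p j" "0 < k" "k < p j - p i" by (auto simp: Q_def)
  define l where "l = inv p (p i + k)"
  have pl: "p l = p i + k" using * by (simp add: l_def Perm_inv)
  have "p j < N" using * by (simp add: Perm_less)
  then have l: "l < N" using * unfolding l_def by (subst Perm_inv_less) auto
  have "p \<circ> transpose i l \<in> Perm N" using * l by (intro Perm_swap) auto
  then have "inv (p \<circ> transpose i l) ((p \<circ> transpose i l) l + k) = i"
    using Perm_inv(2)[of "p \<circ> transpose i l" N i] pl by simp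
  then show ?case by (simp add: x l_def[symmetric] comp_assoc transpose_commute)
next
  case (3 x)
  obtain p i j k where x: "x = (p,i,j,k)" by (cases x)
  with 3 have *: "p \<in> Perm N" "i < N" "j < N" "p i < p j" "0 < k" "k < p j - p i" by (auto simp: Q_def)
  define l where "l = inv p (p i + k)"
  have pl: "p l = p i + k" using * by (simp add: l_def Perm_inv)
  have ne: "l \<noteq> i" "l \<noteq> j" "i \<noteq> j" using pl * by auto
  have u: "shift_pair l j (int k) (shifted a (p \<circ> transpose i l)) = shift_pair i j (int k) (shifted a p)"
    using ne pl * by (auto simp: shift_pair_def shifted_def fun_eq_iff transpose_def)
  have s: "shifted a (p \<circ> transpose i l) j = shifted a p j" using ne by (simp add: shifted_def)
  show ?case using ne sign_swap[OF *(1), of i l] by (simp add: x l_def[symmetric] u s)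
qed

text \<open>\<open>p\<close> and \<open>p \<circ> transpose i j\<close> carry opposite signs, so
  their \<open>G\<close> values enter as a difference, which telescopes along the segment between
  the two vectors.\<close>

lemma alternating_pair:
  assumes ij: "i < N" "j < N" "i \<noteq> j"
  shows "(\<Sum>p\<in>Perm N. sign p * G i j (shifted a p)) =
    (\<Sum>p\<in>{p\<in>Perm N. p i < p j}. sign p *
       (\<Sum>k\<in>{0<..<p j - p i}. ((shifted a p i + int k) - (shifted a p j - int k)) * H (shift_pair i j (int k) (shifted a p))))
    - (\<Sum>p\<in>{p\<in>Perm N. p i < p j}. sign p * (shifted a p j * H (shifted a p)))
    - (\<Sum>p\<in>{p\<in>Perm N. p j < p i}. sign p * (shifted a p i * H (shifted a p)))"
proof -
  let ?L = "{p\<in>Perm N. p i < p j}" and ?R = "{p\<in>Perm N. p j < p i}"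
  let ?t = "\<lambda>p. p \<circ> transpose i j"
  have un: "Perm N = ?L \<union> ?R" using Perm_inj[of _ N i j] ij by (auto simp: neq_iff)
  have reidx: "(\<Sum>p\<in>?R. sign p * f p) = - (\<Sum>p\<in>?L. sign p * f (?t p))" for f :: "(nat \<Rightarrow> nat) \<Rightarrow> int"
    unfolding sum_negf[symmetric]
    by (rule sum.reindex_bij_witness[of _ ?t ?t])
      (use ij sign_swap Perm_swap in \<open>auto simp: comp_assoc\<close>)
  have "(\<Sum>p\<in>Perm N. sign p * G i j (shifted a p)) =
     (\<Sum>p\<in>?L. sign p * G i j (shifted a p)) + (\<Sum>p\<in>?R. sign p * G i j (shifted a p))"
    by (subst un, rule sum.union_disjoint) auto
  also have "\<dots> = (\<Sum>p\<in>?L. sign p * (G i j (shifted a p) - G i j (shifted a (?t p))))"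
    using reidx[of "\<lambda>p. G i j (shifted a p)"] by (simp add: sum_subtractf right_diff_distrib)
  also have "\<dots> = (\<Sum>p\<in>?L. sign p *
       (\<Sum>k\<in>{0<..<p j - p i}. ((shifted a p i + int k) - (shifted a p j - int k)) * H (shift_pair i j (int k) (shifted a p)))
       - sign p * (shifted a p j * H (shifted a p)) + sign p * (shifted a (?t p) i * H (shifted a (?t p))))"
  proof (rule sum.cong[OF refl])
    fix p assume p: "p \<in> ?L"
    have d: "int (p j) - int (p i) = int (p j - p i)" using p by simp
    have e1: "shifted a (?t p) i = shifted a p i + int (p j - p i)"
      using p by (simp add: shifted_def)
    have e2: "shifted a (?t p) = shift_pair i j (int (p j - p i)) (shifted a p)"
      by (simp only: shifted_swap[OF ij(3)] d)
    have pos: "0 < p j - p i" using p by simp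
    have "G i j (shifted a p) - G i j (shifted a (?t p)) =
       (\<Sum>k\<in>{0<..<p j - p i}. ((shifted a p i + int k) - (shifted a p j - int k)) * H (shift_pair i j (int k) (shifted a p)))
       - shifted a p j * H (shifted a p) + shifted a (?t p) i * H (shifted a (?t p))"
      unfolding e1 unfolding e2 using G_telescope'[OF ij pos, of "shifted a p"] by linarith
    then show "sign p * (G i j (shifted a p) - G i j (shifted a (?t p))) = sign p *
       (\<Sum>k\<in>{0<..<p j - p i}. ((shifted a p i + int k) - (shifted a p j - int k)) * H (shift_pair i j (int k) (shifted a p)))
       - sign p * (shifted a p j * H (shifted a p)) + sign p * (shifted a (?t p) i * H (shifted a (?t p)))"
      by (simp only: right_diff_distrib distrib_left)
  qed
  also have "\<dots> = (\<Sum>p\<in>?L. sign p *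
       (\<Sum>k\<in>{0<..<p j - p i}. ((shifted a p i + int k) - (shifted a p j - int k)) * H (shift_pair i j (int k) (shifted a p))))
       - (\<Sum>p\<in>?L. sign p * (shifted a p j * H (shifted a p)))
       + (\<Sum>p\<in>?L. sign p * (shifted a (?t p) i * H (shifted a (?t p))))"
    by (simp only: sum.distrib sum_subtractf)
  also have "(\<Sum>p\<in>?L. sign p * (shifted a (?t p) i * H (shifted a (?t p)))) =
      - (\<Sum>p\<in>?R. sign p * (shifted a p i * H (shifted a p)))"
    using reidx[of "\<lambda>p. shifted a p i * H (shifted a p)"] by simp
  finally show ?thesis by simp
qed

text \<open>Turns a sum over pairs with \<open>p i < p j\<close> into the weight
  \<open>p j\<close>.\<close>

lemma card_smaller:
  assumes "p \<in> Perm N" "j < N"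
  shows "card {i. i < N \<and> p i < p j} = p j"
proof -
  have "bij_betw p {i. i < N \<and> p i < p j} {..<p j}"
    unfolding bij_betw_def
  proof (intro conjI subset_antisym subsetI)
    show "inj_on p {i. i < N \<and> p i < p j}" using assms by (auto simp: inj_on_def Perm_inj)
    fix x assume "x \<in> {..<p j}"
    moreover have "p j < N" using assms by (simp add: Perm_less)
    ultimately have "inv p x < N" "p (inv p x) = x" using assms by (auto simp: Perm_inv_less Perm_inv)
    then show "x \<in> p ` {i. i < N \<and> p i < p j}" using \<open>x \<in> {..<p j}\<close> by (intro image_eqI[of _ _ "inv p x"]) auto
  qed auto
  then show ?thesis by (simp add: bij_betw_same_card)
qed

theorem alternating_exchange:
  "(\<Sum>p\<in>Perm N. sign p * (\<Sum>(i,j)\<in>{(i,j). i < N \<and> j < N \<and> i \<noteq> j}. G i j (shifted a p))) =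
   - 2 * (\<Sum>p\<in>Perm N. sign p * ((\<Sum>j<N. int (p j) * shifted a p j) * H (shifted a p)))"
proof -
  let ?D = "{(i,j). i < N \<and> j < N \<and> i \<noteq> j}"
  have finD: "finite ?D" by (rule finite_subset[of _ "{..<N} \<times> {..<N}"]) auto
  let ?m = "\<lambda>p i j k. ((shifted a p i + int k) - (shifted a p j - int k)) * H (shift_pair i j (int k) (shifted a p))"
  have mid: "(\<Sum>(i,j)\<in>?D. \<Sum>p\<in>{p\<in>Perm N. p i < p j}. sign p * (\<Sum>k\<in>{0<..<p j - p i}. ?m p i j k)) = 0"
  proof -
    have "(\<Sum>(i,j)\<in>?D. \<Sum>p\<in>{p\<in>Perm N. p i < p j}. sign p * (\<Sum>k\<in>{0<..<p j - p i}. ?m p i j k))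
       = (\<Sum>((i,j),p,k)\<in>(SIGMA ij:?D. SIGMA p:{p\<in>Perm N. p (fst ij) < p (snd ij)}. {0<..<p (snd ij) - p (fst ij)}).
           sign p * ?m p i j k)"
      by (subst sum.Sigma[symmetric], rule finD, force intro!: finite_SigmaI)+
        (auto simp: sum_distrib_left sum.Sigma[symmetric] intro!: sum.cong)
    also have "\<dots> = (\<Sum>(p,i,j,k)\<in>Q. sign p * ?m p i j k)"
      by (rule sum.reindex_bij_witness[of _ "\<lambda>(p,i,j,k). ((i,j),p,k)" "\<lambda>((i,j),p,k). (p,i,j,k)"])
        (auto simp: Q_def)
    also have "\<dots> = (\<Sum>(p,i,j,k)\<in>Q. sign p * ((shifted a p i + int k) * H (shift_pair i j (int k) (shifted a p))))
        - (\<Sum>(p,i,j,k)\<in>Q. sign p * ((shifted a p j - int k) * H (shift_pair i j (int k) (shifted a p))))"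
      unfolding sum_subtractf[symmetric] by (rule sum.cong) (auto simp: algebra_simps)
    also have "\<dots> = 0" unfolding intermediate_terms_fst intermediate_terms_snd by simp
    finally show ?thesis .
  qed
  let ?A = "\<Sum>(i,j)\<in>?D. \<Sum>p\<in>{p\<in>Perm N. p i < p j}. sign p * (shifted a p j * H (shifted a p))"
  \<comment> \<open>Exchanging the names of \<open>i\<close> and \<open>j\<close> identifies the two
    boundary sums; this is the origin of the factor 2.\<close>
  have A2: "(\<Sum>(i,j)\<in>?D. \<Sum>p\<in>{p\<in>Perm N. p j < p i}. sign p * (shifted a p i * H (shifted a p))) = ?A"
    by (rule sum.reindex_bij_witness[of _ prod.swap prod.swap]) auto
  have "?A = (\<Sum>((i,j),p)\<in>(SIGMA ij:?D. {p\<in>Perm N. p (fst ij) < p (snd ij)}). sign p * (shifted a p j * H (shifted a p)))"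
    by (subst sum.Sigma[symmetric], rule finD, force) (auto intro!: sum.cong)
  also have "\<dots> = (\<Sum>(p,j,i)\<in>(SIGMA p:Perm N. SIGMA j:{..<N}. {i. i < N \<and> p i < p j}). sign p * (shifted a p j * H (shifted a p)))"
    by (rule sum.reindex_bij_witness[of _ "\<lambda>(p,j,i). ((i,j),p)" "\<lambda>((i,j),p). (p,j,i)"]) auto
  also have "\<dots> = (\<Sum>p\<in>Perm N. \<Sum>j<N. \<Sum>i\<in>{i. i < N \<and> p i < p j}. sign p * (shifted a p j * H (shifted a p)))"
    by (subst sum.Sigma[symmetric], simp, force)+ (auto intro!: sum.cong simp: sum.Sigma[symmetric])
  also have "\<dots> = (\<Sum>p\<in>Perm N. sign p * ((\<Sum>j<N. int (p j) * shifted a p j) * H (shifted a p)))"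
    by (rule sum.cong) (auto simp: sum_distrib_left sum_distrib_right card_smaller intro!: sum.cong)
  finally have A: "?A = (\<Sum>p\<in>Perm N. sign p * ((\<Sum>j<N. int (p j) * shifted a p j) * H (shifted a p)))" .
  have "(\<Sum>p\<in>Perm N. sign p * (\<Sum>(i,j)\<in>?D. G i j (shifted a p))) = (\<Sum>(i,j)\<in>?D. \<Sum>p\<in>Perm N. sign p * G i j (shifted a p))"
    unfolding sum_distrib_left by (subst sum.swap) (auto intro!: sum.cong simp: case_prod_unfold)
  also have "\<dots> = (\<Sum>(i,j)\<in>?D.
     (\<Sum>p\<in>{p\<in>Perm N. p i < p j}. sign p * (\<Sum>k\<in>{0<..<p j - p i}. ?m p i j k))
    - (\<Sum>p\<in>{p\<in>Perm N. p i < p j}. sign p * (shifted a p j * H (shifted a p)))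
    - (\<Sum>p\<in>{p\<in>Perm N. p j < p i}. sign p * (shifted a p i * H (shifted a p))))"
    by (rule sum.cong) (auto simp: alternating_pair)
  also have "\<dots> = (\<Sum>(i,j)\<in>?D. \<Sum>p\<in>{p\<in>Perm N. p i < p j}. sign p * (\<Sum>k\<in>{0<..<p j - p i}. ?m p i j k))
    - ?A - (\<Sum>(i,j)\<in>?D. \<Sum>p\<in>{p\<in>Perm N. p j < p i}. sign p * (shifted a p i * H (shifted a p)))"
    by (simp only: case_prod_unfold sum_subtractf)
  also have "\<dots> = - 2 * ?A" unfolding mid A2 by simp
  finally show ?thesis unfolding A .
qed

end

section \<open>Words fixed by a permutation and the Casimir eigenvalue\<close>

text \<open>Contents are integer vectors: an entry \<open>\<lambda>\<^sub>i - i + p(i)\<close> that is negative leaves no words.\<close>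
definition words :: "nat \<Rightarrow> nat set \<Rightarrow> (nat \<Rightarrow> int) \<Rightarrow> (nat \<Rightarrow> nat) set" where
  "words r A b = {w \<in> {1..r} \<rightarrow>\<^sub>E A. \<forall>i\<in>A. int (card {x \<in> {1..r}. w x = i}) = b i}"

definition fixed_words :: "nat \<Rightarrow> nat set \<Rightarrow> (nat \<Rightarrow> int) \<Rightarrow> (nat \<Rightarrow> nat) \<Rightarrow> (nat \<Rightarrow> nat) set" where
  "fixed_words r A b \<sigma> = {w \<in> words r A b. w \<circ> \<sigma> = w}"

definition num_fixed :: "nat \<Rightarrow> nat \<Rightarrow> (nat \<Rightarrow> int) \<Rightarrow> (nat \<Rightarrow> nat) \<Rightarrow> int" where
  "num_fixed r N b \<sigma> = int (card (fixed_words r {..<N} b \<sigma>))"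

text \<open>The coefficient of \<open>x\<^sup>a\<close>, up to a shift of exponents, in the product of the Vandermonde determinant
  with the power sums of the cycle type of \<open>\<sigma>\<close>.\<close>
definition alt_char :: "nat \<Rightarrow> nat \<Rightarrow> (nat \<Rightarrow> int) \<Rightarrow> (nat \<Rightarrow> nat) \<Rightarrow> int" where
  "alt_char r N a \<sigma> = (\<Sum>p\<in>Perm N. sign p * num_fixed r N (shifted a p) \<sigma>)"

lemma finite_words [simp]: "finite A \<Longrightarrow> finite (words r A b)"
  unfolding words_def by (rule finite_subset[OF _ finite_PiE[of "{1..r}" "\<lambda>_. A"]]) auto

lemma finite_fixed_words [simp]: "finite A \<Longrightarrow> finite (fixed_words r A b \<sigma>)"
  by (simp add: fixed_words_def)

lemma words_cong: "(\<And>i. i \<in> A \<Longrightarrow> b i = b' i) \<Longrightarrow> words r A b = words r A b'"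
  unfolding words_def by auto

lemma words_neg: "i \<in> A \<Longrightarrow> b i < 0 \<Longrightarrow> words r A b = {}"
  unfolding words_def by force

lemma perms_iff: "\<sigma> \<in> perms r \<longleftrightarrow> \<sigma> permutes {1..r}"
  by (simp add: perms_def)

lemma finite_perms [simp]: "finite (perms r)"
  by (simp add: perms_def finite_permutations)

lemma perms_comp: "\<sigma> \<in> perms r \<Longrightarrow> \<tau> \<in> perms r \<Longrightarrow> \<sigma> \<circ> \<tau> \<in> perms r"
  by (simp add: perms_iff permutes_compose)

lemma perms_inv: "\<sigma> \<in> perms r \<Longrightarrow> inv \<sigma> \<in> perms r"
  by (simp add: perms_iff permutes_inv)

lemma perms_inv_o: "\<sigma> \<in> perms r \<Longrightarrow> \<sigma> \<circ> inv \<sigma> = id" "\<sigma> \<in> perms r \<Longrightarrow> inv \<sigma> \<circ> \<sigma> = id"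
  by (simp_all add: perms_iff permutes_inv_o)

lemma perms_inv_app: "\<sigma> \<in> perms r \<Longrightarrow> \<sigma> (inv \<sigma> x) = x" "\<sigma> \<in> perms r \<Longrightarrow> inv \<sigma> (\<sigma> x) = x"
  by (auto simp add: perms_iff permutes_inverses)

lemma perms_transpose: "x \<in> {1..r} \<Longrightarrow> y \<in> {1..r} \<Longrightarrow> transpose x y \<in> perms r"
  by (simp add: perms_iff permutes_swap_id)

lemma card_Collect_permutes:
  assumes "\<sigma> permutes S"
  shows "card {x \<in> S. P (\<sigma> x)} = card {x \<in> S. P x}"
proof (rule bij_betw_same_card)
  show "bij_betw \<sigma> {x \<in> S. P (\<sigma> x)} {x \<in> S. P x}"
    by (rule bij_betw_byWitness[where f' = "inv \<sigma>"])
      (use assms permutes_inverses[OF assms] permutes_in_image[OF assms] permutes_in_image[OF permutes_inv[OF assms]] in auto)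
qed

lemma words_comp:
  assumes "w \<in> words r A b" "\<sigma> \<in> perms r"
  shows "w \<circ> \<sigma> \<in> words r A b"
proof -
  have s: "\<sigma> permutes {1..r}" using assms by (simp add: perms_iff)
  have "w \<circ> \<sigma> \<in> {1..r} \<rightarrow>\<^sub>E A"
    using assms permutes_in_image[OF s] permutes_not_in[OF s]
    by (auto simp: words_def PiE_iff extensional_def)
  moreover have "card {x \<in> {1..r}. (w \<circ> \<sigma>) x = i} = card {x \<in> {1..r}. w x = i}" for i
    using card_Collect_permutes[OF s, of "\<lambda>y. w y = i"] by simp
  ultimately show ?thesis using assms(1) by (auto simp: words_def)
qed

lemma words_upd:
  assumes "w \<in> words r A b" "y \<in> {1..r}" "i \<in> A"
  shows "w(y := i) \<in> words r A (\<lambda>l. b l + of_bool (l = i) - of_bool (l = w y))"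
proof -
  have c: "int (card {x \<in> {1..r}. u x = l}) = (\<Sum>x\<in>{1..r} - {y}. of_bool (u x = l)) + of_bool (u y = l)" for u :: "nat \<Rightarrow> nat" and l
  proof -
    have "int (card {x \<in> {1..r}. u x = l}) = (\<Sum>x\<in>{1..r}. of_bool (u x = l))"
      by (subst sum_of_bool_eq) (auto intro!: arg_cong[of _ _ card])
    moreover have "(\<Sum>x\<in>{1..r}. of_bool (u x = l)) = of_bool (u y = l) + (\<Sum>x\<in>{1..r} - {y}. of_bool (u x = l) :: int)"
      by (rule sum.remove) (use assms in auto)
    ultimately show ?thesis by linarith
  qed
  have "int (card {x \<in> {1..r}. (w(y := i)) x = l}) = int (card {x \<in> {1..r}. w x = l}) + of_bool (l = i) - of_bool (l = w y)" for l
    unfolding c by (auto intro!: sum.cong)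
  moreover have "w(y := i) \<in> {1..r} \<rightarrow>\<^sub>E A"
    using assms by (auto simp: words_def PiE_iff extensional_def)
  ultimately show ?thesis using assms(1) by (auto simp: words_def)
qed

lemma words_count: "w \<in> words r A b \<Longrightarrow> i \<in> A \<Longrightarrow> int (card {x \<in> {1..r}. w x = i}) = b i"
  by (auto simp: words_def)

lemma words_in: "w \<in> words r A b \<Longrightarrow> x \<in> {1..r} \<Longrightarrow> w x \<in> A"
  by (auto simp: words_def)

text \<open>Let E_ij replace one letter \<open>j\<close> by \<open>i\<close>, summed over all
  places. The triples are the coincidences between E_ij applied to \<open>w\<close> and to
  \<open>w \<circ> \<sigma>\<close>; as E_ji is the transpose of E_ij, their number is the trace of
  E_ji E_ij \<open>\<sigma>\<close> on the weight space of content \<open>b\<close>.\<close>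

definition Fset :: "nat \<Rightarrow> nat \<Rightarrow> (nat \<Rightarrow> nat) \<Rightarrow> nat \<Rightarrow> nat \<Rightarrow> (nat \<Rightarrow> int) \<Rightarrow> ((nat \<Rightarrow> nat) \<times> nat \<times> nat) set" where
  "Fset r N \<sigma> i j b = {(w,x,y). w \<in> words r {..<N} b \<and> x \<in> {1..r} \<and> y \<in> {1..r} \<and>
     w y = j \<and> w (\<sigma> x) = j \<and> w(y := i) = (w \<circ> \<sigma>)(x := i)}"

text \<open>The words fixed by \<open>\<sigma> \<circ> transpose x y\<close>, sorted by the letters
  at the two exchanged places.\<close>

definition Gset :: "nat \<Rightarrow> nat \<Rightarrow> (nat \<Rightarrow> nat) \<Rightarrow> nat \<Rightarrow> nat \<Rightarrow> (nat \<Rightarrow> int) \<Rightarrow> ((nat \<Rightarrow> nat) \<times> nat \<times> nat) set" where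
  "Gset r N \<sigma> i j b = {(w,x,y). w \<in> words r {..<N} b \<and> x \<in> {1..r} \<and> y \<in> {1..r} \<and>
     w x = i \<and> w y = j \<and> w \<circ> \<sigma> = w \<circ> transpose x y}"

lemma finite_Fset: "finite (Fset r N \<sigma> i j b)"
  by (rule finite_subset[of _ "words r {..<N} b \<times> {1..r} \<times> {1..r}"]) (auto simp: Fset_def)

lemma finite_Gset: "finite (Gset r N \<sigma> i j b)"
  by (rule finite_subset[of _ "words r {..<N} b \<times> {1..r} \<times> {1..r}"]) (auto simp: Gset_def)

text \<open>A triple with \<open>x = y\<close> is a fixed word with one of its \<open>b j\<close>
  places of the letter \<open>j\<close>; for \<open>x \<noteq> y\<close> the defining condition says
  that \<open>\<sigma>\<close> moves \<open>w\<close> exactly as the transposition does.\<close>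

lemma card_Fset:
  assumes "i \<noteq> j" "j < N"
  shows "int (card (Fset r N \<sigma> i j b)) = int (card (Gset r N \<sigma> i j b)) + b j * num_fixed r N b \<sigma>"
proof -
  let ?E = "(\<lambda>(w,y). (w,y,y)) ` (SIGMA w:fixed_words r {..<N} b \<sigma>. {y \<in> {1..r}. w y = j})"
  have "Fset r N \<sigma> i j b = Gset r N \<sigma> i j b \<union> ?E"
  proof (intro subset_antisym subsetI)
    fix t assume "t \<in> Fset r N \<sigma> i j b"
    then obtain w x y where t: "t = (w,x,y)" "w \<in> words r {..<N} b" "x \<in> {1..r}" "y \<in> {1..r}"
      "w y = j" "w (\<sigma> x) = j" and eq: "w(y := i) = (w \<circ> \<sigma>)(x := i)" by (auto simp: Fset_def)
    have eqz: "(w(y := i)) z = ((w \<circ> \<sigma>)(x := i)) z" for z by (simp only: eq)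
    show "t \<in> Gset r N \<sigma> i j b \<union> ?E"
    proof (cases "x = y")
      case True
      have "w (\<sigma> z) = w z" for z using eqz[of z] t True by (cases "z = y") auto
      then have "w \<circ> \<sigma> = w" by auto
      then show ?thesis using t True by (auto simp: fixed_words_def)
    next
      case False
      have "w (\<sigma> z) = w (transpose x y z)" for z
        using eqz[of z] eqz[of x] t False by (auto simp: transpose_def split: if_splits)
      moreover have "w x = i" using eqz[of x] False by simp
      ultimately show ?thesis using t by (auto simp: Gset_def)
    qed
  next
    fix t assume "t \<in> Gset r N \<sigma> i j b \<union> ?E"
    then show "t \<in> Fset r N \<sigma> i j b"
    proof
      assume "t \<in> Gset r N \<sigma> i j b"
      then obtain w x y where t: "t = (w,x,y)" "w \<in> words r {..<N} b" "x \<in> {1..r}" "y \<in> {1..r}"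
        "w y = j" "w x = i" and eq: "w \<circ> \<sigma> = w \<circ> transpose x y" by (auto simp: Gset_def)
      have eqz: "w (\<sigma> z) = w (transpose x y z)" for z using eq by (metis comp_apply)
      then show ?thesis using t assms(1) by (auto simp: Fset_def fun_eq_iff transpose_def)
    next
      assume "t \<in> ?E"
      then obtain w y where t: "t = (w,y,y)" "w \<in> words r {..<N} b" "y \<in> {1..r}" "w y = j" and eq: "w \<circ> \<sigma> = w"
        by (auto simp: fixed_words_def)
      then have "w (\<sigma> y) = j" by (metis comp_apply)
      then show ?thesis using t by (auto simp: Fset_def eq)
    qed
  qed
  moreover have "Gset r N \<sigma> i j b \<inter> ?E = {}" using assms by (auto simp: Gset_def)
  moreover have "finite ?E" by (intro finite_imageI finite_SigmaI) auto
  ultimately have "card (Fset r N \<sigma> i j b) = card (Gset r N \<sigma> i j b) + card ?E"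
    by (simp add: card_Un_disjoint finite_Gset)
  moreover have "int (card ?E) = b j * num_fixed r N b \<sigma>"
  proof -
    have "card ?E = card (SIGMA w:fixed_words r {..<N} b \<sigma>. {y \<in> {1..r}. w y = j})"
      by (rule card_image) (auto simp: inj_on_def)
    also have "int \<dots> = (\<Sum>w\<in>fixed_words r {..<N} b \<sigma>. int (card {y \<in> {1..r}. w y = j}))"
      by (simp add: card_SigmaI)
    also have "\<dots> = (\<Sum>w\<in>fixed_words r {..<N} b \<sigma>. b j)"
      by (rule sum.cong) (use assms words_count in \<open>auto simp: fixed_words_def\<close>)
    finally show ?thesis by (simp add: num_fixed_def)
  qed
  ultimately show ?thesis by simp
qed

text \<open>Moving one letter from the position \<open>y\<close> to its \<open>\<sigma>\<close>-preimage is the cyclicity of the trace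
  for the product of two root vectors.\<close>
lemma card_Fset_le:
  assumes "i \<noteq> j" "i < N" "j < N" "\<sigma> \<in> perms r"
  shows "card (Fset r N \<sigma> i j b) \<le> card (Fset r N \<sigma> j i (shift_pair i j 1 b))"
proof (rule card_inj_on_le[where f = "\<lambda>(w,x,y). (w(y := i), inv \<sigma> y, x)"])
  have s: "\<sigma> permutes {1..r}" using assms by (simp add: perms_iff)
  note inv = permutes_inverses[OF s]
  have w_rec: "w = (w(y := i))(y := j)" if "(w,x,y) \<in> Fset r N \<sigma> i j b" for w x y
  proof -
    have "w y = j" using that by (simp add: Fset_def)
    then show ?thesis by auto
  qed
  show "inj_on (\<lambda>(w,x,y). (w(y := i), inv \<sigma> y, x)) (Fset r N \<sigma> i j b)"
  proof (rule inj_onI)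
    fix t t' assume t: "t \<in> Fset r N \<sigma> i j b" "t' \<in> Fset r N \<sigma> i j b"
      and tt: "(case t of (w,x,y) \<Rightarrow> (w(y := i), inv \<sigma> y, x)) = (case t' of (w,x,y) \<Rightarrow> (w(y := i), inv \<sigma> y, x))"
    obtain w x y w' x' y' where d: "t = (w,x,y)" "t' = (w',x',y')" by (cases t, cases t')
    have a: "(w,x,y) \<in> Fset r N \<sigma> i j b" "(w',x',y') \<in> Fset r N \<sigma> i j b" using t d by auto
    have e: "w(y := i) = w'(y' := i)" "inv \<sigma> y = inv \<sigma> y'" "x = x'" using tt d by auto
    have "y = y'" using e(2) inv by metis
    have "w = w(y := i, y := j)" by (rule w_rec[OF a(1)])
    also have "\<dots> = w'(y' := i, y' := j)" by (subst e(1), simp only: \<open>y = y'\<close>)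
    also have "\<dots> = w'" by (rule w_rec[OF a(2), symmetric])
    finally show "t = t'" using \<open>y = y'\<close> e(3) by (simp add: d)
  qed
  show "(\<lambda>(w,x,y). (w(y := i), inv \<sigma> y, x)) ` Fset r N \<sigma> i j b \<subseteq> Fset r N \<sigma> j i (shift_pair i j 1 b)"
  proof clarify
    fix w x y assume "(w,x,y) \<in> Fset r N \<sigma> i j b"
    then have t: "w \<in> words r {..<N} b" "x \<in> {1..r}" "y \<in> {1..r}"
      "w y = j" "w (\<sigma> x) = j" and eq: "w(y := i) = (w \<circ> \<sigma>)(x := i)" by (auto simp: Fset_def)
    have "w(y := i) \<in> words r {..<N} (\<lambda>l. b l + of_bool (l = i) - of_bool (l = w y))"
      by (rule words_upd) (use t assms in auto)
    also have "\<dots> = words r {..<N} (shift_pair i j 1 b)"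
      by (rule words_cong) (use t assms in \<open>auto simp: shift_pair_def\<close>)
    finally have 1: "w(y := i) \<in> words r {..<N} (shift_pair i j 1 b)" .
    have 2: "inv \<sigma> y \<in> {1..r}" using permutes_in_image[OF permutes_inv[OF s]] t by blast
    have 3: "(w(y := i)) x = i" by (simp add: eq)
    have 4: "(w(y := i))(x := j) = (w(y := i) \<circ> \<sigma>)(inv \<sigma> y := j)"
    proof
      fix z
      have "(w(y := i))(x := j) = (w \<circ> \<sigma>)(x := j)" by (simp add: eq)
      also have "\<dots> = w \<circ> \<sigma>" using t by auto
      finally have "((w(y := i))(x := j)) z = (w \<circ> \<sigma>) z" by simp
      also have "\<dots> = ((w(y := i) \<circ> \<sigma>)(inv \<sigma> y := j)) z"
        using inv t by (cases "z = inv \<sigma> y") (auto)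
      finally show "((w(y := i))(x := j)) z = ((w(y := i) \<circ> \<sigma>)(inv \<sigma> y := j)) z" .
    qed
    show "(w(y := i), inv \<sigma> y, x) \<in> Fset r N \<sigma> j i (shift_pair i j 1 b)"
      unfolding Fset_def using 1 2 3 4 t inv by auto
  qed
qed (rule finite_Fset)

text \<open>The commutator of two opposite root vectors under the trace: E_ji E_ij at content
  \<open>b\<close> has the same trace as E_ij E_ji one shift further, and \<open>card_Fset\<close>
  splits both sides.\<close>

lemma exchange_words:
  assumes "\<sigma> \<in> perms r"
  shows "exchange N (\<lambda>b. num_fixed r N b \<sigma>) (\<lambda>i j b. int (card (Gset r N \<sigma> i j b)))"
proof
  fix i j :: nat and b :: "nat \<Rightarrow> int"
  assume ij: "i < N" "j < N" "i \<noteq> j"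
  have sym: "card (Gset r N \<sigma> i j b) = card (Gset r N \<sigma> j i b)" for b
    by (rule bij_betw_same_card[of "\<lambda>(w,x,y). (w,y,x)"],
        rule bij_betw_byWitness[where f' = "\<lambda>(w,x,y). (w,y,x)"])
      (auto simp: Gset_def transpose_commute)
  then show "int (card (Gset r N \<sigma> i j b)) = int (card (Gset r N \<sigma> j i b))" by simp
  \<comment> \<open>Shifting back undoes the shift, so the one-sided estimate
    \<open>card_Fset_le\<close> applied in both directions gives equality.\<close>
  have "shift_pair j i 1 (shift_pair i j 1 b) = b" using ij by (auto simp: shift_pair_def)
  then have "card (Fset r N \<sigma> i j b) = card (Fset r N \<sigma> j i (shift_pair i j 1 b))"
    using card_Fset_le[of i j N \<sigma> r b] card_Fset_le[of j i N \<sigma> r "shift_pair i j 1 b"] ij assms by simp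
  then show "int (card (Gset r N \<sigma> i j b)) + b j * num_fixed r N b \<sigma> =
    int (card (Gset r N \<sigma> i j (shift_pair i j 1 b))) + (b i + 1) * num_fixed r N (shift_pair i j 1 b) \<sigma>"
    using card_Fset[of i j N r \<sigma> b] card_Fset[of j i N r \<sigma> "shift_pair i j 1 b"] ij sym[of "shift_pair i j 1 b"]
    by (simp add: shift_pair_def)
qed

definition offdiag :: "nat set \<Rightarrow> (nat \<times> nat) set" where
  "offdiag S = {(x,y). x \<in> S \<and> y \<in> S \<and> x \<noteq> y}"

lemma finite_offdiag [simp]: "finite S \<Longrightarrow> finite (offdiag S)"
  by (rule finite_subset[of _ "S \<times> S"]) (auto simp: offdiag_def)

lemma card_offdiag: "finite S \<Longrightarrow> int (card (offdiag S)) = int (card S) * (int (card S) - 1)"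
proof -
  assume S: "finite S"
  have "S \<times> S = offdiag S \<union> (\<lambda>x. (x,x)) ` S" "offdiag S \<inter> (\<lambda>x. (x,x)) ` S = {}"
    by (auto simp: offdiag_def)
  then have "card (S \<times> S) = card (offdiag S) + card ((\<lambda>x. (x,x)) ` S)"
    using S by (simp add: card_Un_disjoint)
  also have "card ((\<lambda>x. (x,x)) ` S) = card S" by (rule card_image) (auto simp: inj_on_def)
  finally have "int (card (S \<times> S)) = int (card (offdiag S)) + int (card S)" by simp
  then show ?thesis by (simp add: card_cartesian_product algebra_simps)
qed

text \<open>Sort by the letters at \<open>x\<close> and \<open>y\<close>. If they agree, the
  transposition is invisible to the word, and each fixed word has \<open>b i * (b i - 1)\<close>
  ordered pairs of distinct places of the letter \<open>i\<close>.\<close>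

lemma num_fixed_casimir:
  assumes "\<sigma> \<in> perms r"
  shows "(\<Sum>(x,y)\<in>offdiag {1..r}. num_fixed r N b (\<sigma> \<circ> transpose x y)) =
    (\<Sum>i<N. b i * (b i - 1)) * num_fixed r N b \<sigma> + (\<Sum>(i,j)\<in>{(i,j). i < N \<and> j < N \<and> i \<noteq> j}. int (card (Gset r N \<sigma> i j b)))"
proof -
  let ?D = "{(i,j). i < N \<and> j < N \<and> i \<noteq> j}"
  define Z where "Z = {(w,x,y). w \<in> words r {..<N} b \<and> x \<in> {1..r} \<and> y \<in> {1..r} \<and> x \<noteq> y \<and> w \<circ> \<sigma> = w \<circ> transpose x y}"
  have finZ: "finite Z" by (rule finite_subset[of _ "words r {..<N} b \<times> {1..r} \<times> {1..r}"]) (auto simp: Z_def)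
  have fx: "w \<circ> (\<sigma> \<circ> transpose x y) = w \<longleftrightarrow> w \<circ> \<sigma> = w \<circ> transpose x y" for w :: "nat \<Rightarrow> nat" and x y
    by (metis comp_assoc transpose_comp_involutory comp_id)
  have "(\<Sum>(x,y)\<in>offdiag {1..r}. num_fixed r N b (\<sigma> \<circ> transpose x y)) =
      int (card (SIGMA xy:offdiag {1..r}. fixed_words r {..<N} b (\<sigma> \<circ> transpose (fst xy) (snd xy))))"
    by (subst card_SigmaI) (auto simp: num_fixed_def case_prod_unfold)
  also have "card (SIGMA xy:offdiag {1..r}. fixed_words r {..<N} b (\<sigma> \<circ> transpose (fst xy) (snd xy))) = card Z"
    by (rule bij_betw_same_card[of "\<lambda>((x,y),w). (w,x,y)"],
        rule bij_betw_byWitness[where f' = "\<lambda>(w,x,y). ((x,y),w)"])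
      (auto simp: Z_def fixed_words_def offdiag_def fx)
  also have "card Z = (\<Sum>ij\<in>{..<N} \<times> {..<N}. card {t \<in> Z. (case t of (w,x,y) \<Rightarrow> (w x, w y)) = ij})"
    unfolding card_eq_sum
  proof (rule sum.group[symmetric, OF finZ])
    show "(\<lambda>(w,x,y). (w x, w y)) ` Z \<subseteq> {..<N} \<times> {..<N}"
      using words_in[of _ r "{..<N}" b] by (auto simp: Z_def simp del: atLeastAtMost_iff)
  qed simp
  also have "{..<N} \<times> {..<N} = ?D \<union> (\<lambda>i. (i,i)) ` {..<N}" by auto
  also have "(\<Sum>ij\<in>\<dots>. card {t \<in> Z. (case t of (w,x,y) \<Rightarrow> (w x, w y)) = ij}) =
      (\<Sum>ij\<in>?D. card {t \<in> Z. (case t of (w,x,y) \<Rightarrow> (w x, w y)) = ij}) +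
      (\<Sum>ij\<in>(\<lambda>i. (i,i)) ` {..<N}. card {t \<in> Z. (case t of (w,x,y) \<Rightarrow> (w x, w y)) = ij})"
    by (rule sum.union_disjoint) (auto intro: finite_subset[of _ "{..<N} \<times> {..<N}"])
  also have "(\<Sum>ij\<in>?D. card {t \<in> Z. (case t of (w,x,y) \<Rightarrow> (w x, w y)) = ij}) = (\<Sum>(i,j)\<in>?D. card (Gset r N \<sigma> i j b))"
  proof (rule sum.cong[OF refl], clarify)
    fix i j assume "i < N" "j < N" "i \<noteq> j"
    then have "{t \<in> Z. (case t of (w,x,y) \<Rightarrow> (w x, w y)) = (i,j)} = Gset r N \<sigma> i j b"
      by (auto simp: Z_def Gset_def)
    then show "card {t \<in> Z. (case t of (w,x,y) \<Rightarrow> (w x, w y)) = (i,j)} = card (Gset r N \<sigma> i j b)" by simp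
  qed
  also have "(\<Sum>ij\<in>(\<lambda>i. (i,i)) ` {..<N}. card {t \<in> Z. (case t of (w,x,y) \<Rightarrow> (w x, w y)) = ij}) =
     (\<Sum>i<N. card {t \<in> Z. (case t of (w,x,y) \<Rightarrow> (w x, w y)) = (i,i)})"
    by (subst sum.reindex) (auto simp: inj_on_def)
  finally have "(\<Sum>(x,y)\<in>offdiag {1..r}. num_fixed r N b (\<sigma> \<circ> transpose x y)) =
     (\<Sum>(i,j)\<in>?D. int (card (Gset r N \<sigma> i j b))) + (\<Sum>i<N. int (card {t \<in> Z. (case t of (w,x,y) \<Rightarrow> (w x, w y)) = (i,i)}))"
    by (simp only: of_nat_add of_nat_sum case_prod_unfold)
  moreover have "int (card {t \<in> Z. (case t of (w,x,y) \<Rightarrow> (w x, w y)) = (i,i)}) = b i * (b i - 1) * num_fixed r N b \<sigma>" if "i < N" for i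
  proof -
    have fz: "w \<circ> transpose x y = w" if "w x = w y" for w :: "nat \<Rightarrow> nat" and x y
      using that by (auto simp: fun_eq_iff transpose_def)
    have "{t \<in> Z. (case t of (w,x,y) \<Rightarrow> (w x, w y)) = (i,i)} = (SIGMA w:fixed_words r {..<N} b \<sigma>. offdiag {x \<in> {1..r}. w x = i})"
      by (auto simp: Z_def fixed_words_def offdiag_def fz)
    then have "int (card {t \<in> Z. (case t of (w,x,y) \<Rightarrow> (w x, w y)) = (i,i)}) =
        (\<Sum>w\<in>fixed_words r {..<N} b \<sigma>. int (card (offdiag {x \<in> {1..r}. w x = i})))"
      by (simp add: card_SigmaI)
    also have "\<dots> = (\<Sum>w\<in>fixed_words r {..<N} b \<sigma>. b i * (b i - 1))"
    proof (rule sum.cong[OF refl])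
      fix w assume "w \<in> fixed_words r {..<N} b \<sigma>"
      then have "int (card {x \<in> {1..r}. w x = i}) = b i" using words_count \<open>i < N\<close> by (auto simp: fixed_words_def)
      then show "int (card (offdiag {x \<in> {1..r}. w x = i})) = b i * (b i - 1)"
        by (subst card_offdiag) auto
    qed
    finally show ?thesis by (simp add: num_fixed_def)
  qed
  ultimately show ?thesis by (simp add: sum_distrib_right)
qed

text \<open>For \<open>a j\<close> a part minus its index this is twice the sum of the contents of
  the diagram; the second sum normalises the empty diagram to 0.\<close>

definition casimir_eigenvalue :: "nat \<Rightarrow> (nat \<Rightarrow> int) \<Rightarrow> int" where
  "casimir_eigenvalue N a = (\<Sum>j<N. a j * (a j - 1)) - (\<Sum>j<N. int j * (int j + 1))"

lemma alt_char_casimir: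
  assumes "\<sigma> \<in> perms r"
  shows "(\<Sum>(x,y)\<in>offdiag {1..r}. alt_char r N a (\<sigma> \<circ> transpose x y)) = casimir_eigenvalue N a * alt_char r N a \<sigma>"
proof -
  interpret exchange N "\<lambda>b. num_fixed r N b \<sigma>" "\<lambda>i j b. int (card (Gset r N \<sigma> i j b))"
    by (rule exchange_words[OF assms])
  have "(\<Sum>(x,y)\<in>offdiag {1..r}. alt_char r N a (\<sigma> \<circ> transpose x y)) =
     (\<Sum>p\<in>Perm N. sign p * (\<Sum>(x,y)\<in>offdiag {1..r}. num_fixed r N (shifted a p) (\<sigma> \<circ> transpose x y)))"
    unfolding alt_char_def sum_distrib_left case_prod_unfold by (rule sum.swap)
  also have "\<dots> = (\<Sum>p\<in>Perm N. sign p * ((\<Sum>i<N. shifted a p i * (shifted a p i - 1)) * num_fixed r N (shifted a p) \<sigma>))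
     + (\<Sum>p\<in>Perm N. sign p * (\<Sum>(i,j)\<in>{(i,j). i < N \<and> j < N \<and> i \<noteq> j}. int (card (Gset r N \<sigma> i j (shifted a p)))))"
    unfolding num_fixed_casimir[OF assms] by (simp only: distrib_left sum.distrib)
  also have "\<dots> = (\<Sum>p\<in>Perm N. sign p * (((\<Sum>i<N. shifted a p i * (shifted a p i - 1))
       - 2 * (\<Sum>j<N. int (p j) * shifted a p j)) * num_fixed r N (shifted a p) \<sigma>))"
    unfolding alternating_exchange sum_distrib_left[of "-2"] sum.distrib[symmetric]
    by (rule sum.cong) (simp_all only: algebra_simps)
  also have "\<dots> = (\<Sum>p\<in>Perm N. sign p * (casimir_eigenvalue N a * num_fixed r N (shifted a p) \<sigma>))"
  proof (rule sum.cong[OF refl])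
    fix p assume p: "p \<in> Perm N"
    \<comment> \<open>For \<open>b = a + p\<close> one has
      \<open>b * (b - 1) - 2 * p * b = a * (a - 1) - p * (p + 1)\<close>: the mixed terms cancel,
      and the sum over all values of \<open>p\<close> does not depend on \<open>p\<close>.\<close>
    have "(\<Sum>j<N. int j * (int j + 1)) = (\<Sum>j<N. int (p j) * (int (p j) + 1))"
      using sum.permute[of p "{..<N}" "\<lambda>j. int j * (int j + 1)"] p by (simp add: comp_def)
    then have "(\<Sum>i<N. shifted a p i * (shifted a p i - 1)) - 2 * (\<Sum>j<N. int (p j) * shifted a p j) = casimir_eigenvalue N a"
      unfolding casimir_eigenvalue_def
      by (simp add: sum_distrib_left) (simp add: sum_subtractf[symmetric] shifted_def algebra_simps)
    then show "sign p * (((\<Sum>i<N. shifted a p i * (shifted a p i - 1)) - 2 * (\<Sum>j<N. int (p j) * shifted a p j)) * num_fixed r N (shifted a p) \<sigma>)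
      = sign p * (casimir_eigenvalue N a * num_fixed r N (shifted a p) \<sigma>)" by simp
  qed
  finally show ?thesis by (simp add: alt_char_def sum_distrib_left ac_simps)
qed

section \<open>Permutation characters of words\<close>

lemma num_fixed_conj:
  assumes "\<sigma> \<in> perms r" "\<tau> \<in> perms r"
  shows "num_fixed r N b (\<tau> \<circ> \<sigma> \<circ> inv \<tau>) = num_fixed r N b \<sigma>"
proof -
  have "bij_betw (\<lambda>w. w \<circ> \<tau>) (fixed_words r {..<N} b (\<tau> \<circ> \<sigma> \<circ> inv \<tau>)) (fixed_words r {..<N} b \<sigma>)"
  proof (rule bij_betw_byWitness[where f' = "\<lambda>w. w \<circ> inv \<tau>"])
    show "\<forall>w\<in>fixed_words r {..<N} b (\<tau> \<circ> \<sigma> \<circ> inv \<tau>). w \<circ> \<tau> \<circ> inv \<tau> = w"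
      using assms by (simp add: comp_assoc perms_inv_o)
    show "\<forall>w\<in>fixed_words r {..<N} b \<sigma>. w \<circ> inv \<tau> \<circ> \<tau> = w"
      using assms by (simp add: comp_assoc perms_inv_o)
    show "(\<lambda>w. w \<circ> \<tau>) ` fixed_words r {..<N} b (\<tau> \<circ> \<sigma> \<circ> inv \<tau>) \<subseteq> fixed_words r {..<N} b \<sigma>"
    proof clarify
      fix w assume w: "w \<in> fixed_words r {..<N} b (\<tau> \<circ> \<sigma> \<circ> inv \<tau>)"
      have "w \<circ> \<tau> \<circ> \<sigma> = w \<circ> (\<tau> \<circ> \<sigma> \<circ> inv \<tau>) \<circ> \<tau>"
        using assms by (simp add: comp_assoc perms_inv_o)
      then show "w \<circ> \<tau> \<in> fixed_words r {..<N} b \<sigma>"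
        using w assms words_comp by (auto simp: fixed_words_def)
    qed
    show "(\<lambda>w. w \<circ> inv \<tau>) ` fixed_words r {..<N} b \<sigma> \<subseteq> fixed_words r {..<N} b (\<tau> \<circ> \<sigma> \<circ> inv \<tau>)"
    proof clarify
      fix w assume w: "w \<in> fixed_words r {..<N} b \<sigma>"
      have "w \<circ> inv \<tau> \<circ> (\<tau> \<circ> \<sigma> \<circ> inv \<tau>) = w \<circ> (inv \<tau> \<circ> \<tau>) \<circ> \<sigma> \<circ> inv \<tau>"
        by (simp only: comp_assoc)
      also have "\<dots> = w \<circ> inv \<tau>" using w assms by (simp add: perms_inv_o fixed_words_def)
      finally show "w \<circ> inv \<tau> \<in> fixed_words r {..<N} b (\<tau> \<circ> \<sigma> \<circ> inv \<tau>)"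
        using w assms words_comp perms_inv by (auto simp: fixed_words_def)
    qed
  qed
  then show ?thesis by (simp add: num_fixed_def bij_betw_same_card)
qed

definition classfn :: "nat \<Rightarrow> ((nat \<Rightarrow> nat) \<Rightarrow> 'c) \<Rightarrow> bool" where
  "classfn r f \<longleftrightarrow> (\<forall>\<sigma>\<in>perms r. \<forall>\<tau>\<in>perms r. f (\<tau> \<circ> \<sigma> \<circ> inv \<tau>) = f \<sigma>)"

lemma classfnD: "classfn r f \<Longrightarrow> \<sigma> \<in> perms r \<Longrightarrow> \<tau> \<in> perms r \<Longrightarrow> f (\<tau> \<circ> \<sigma> \<circ> inv \<tau>) = f \<sigma>"
  by (simp add: classfn_def)

lemma classfn_commute:
  assumes "classfn r f" "\<sigma> \<in> perms r" "\<tau> \<in> perms r"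
  shows "f (\<sigma> \<circ> \<tau>) = f (\<tau> \<circ> \<sigma>)"
  using classfnD[OF assms(1), of "\<sigma> \<circ> \<tau>" \<tau>] assms perms_comp[of \<sigma> r \<tau>]
  by (simp add: comp_assoc perms_inv_o)

lemma classfn_alt_char: "classfn r (alt_char r N a)"
  by (auto simp: classfn_def alt_char_def num_fixed_conj intro!: sum.cong)

lemma num_fixed_inv: "\<sigma> \<in> perms r \<Longrightarrow> num_fixed r N b (inv \<sigma>) = num_fixed r N b \<sigma>"
proof -
  assume s: "\<sigma> \<in> perms r"
  have "w \<circ> inv \<sigma> = w \<longleftrightarrow> w \<circ> \<sigma> = w" for w :: "nat \<Rightarrow> nat"
  proof
    assume "w \<circ> inv \<sigma> = w"
    then have "w \<circ> \<sigma> = w \<circ> (inv \<sigma> \<circ> \<sigma>)" by (simp add: comp_assoc[symmetric])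
    then show "w \<circ> \<sigma> = w" using s by (simp add: perms_inv_o)
  next
    assume "w \<circ> \<sigma> = w"
    then have "w \<circ> inv \<sigma> = w \<circ> (\<sigma> \<circ> inv \<sigma>)" by (simp add: comp_assoc[symmetric])
    then show "w \<circ> inv \<sigma> = w" using s by (simp add: perms_inv_o)
  qed
  then show ?thesis by (simp add: num_fixed_def fixed_words_def)
qed

lemma alt_char_inv: "\<sigma> \<in> perms r \<Longrightarrow> alt_char r N a (inv \<sigma>) = alt_char r N a \<sigma>"
  by (simp add: alt_char_def num_fixed_inv)

text \<open>An inequality is enough, because exchanging two letters is an involution.\<close>

lemma num_fixed_swap_letters_le:
  assumes "\<sigma> \<in> perms r" "i < N" "j < N"
  shows "card (fixed_words r {..<N} b \<sigma>) \<le> card (fixed_words r {..<N} (b \<circ> transpose i j) \<sigma>)"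
proof (rule card_inj_on_le[where f = "\<lambda>w. \<lambda>x\<in>{1..r}. transpose i j (w x)"])
  have s: "\<sigma> permutes {1..r}" using assms by (simp add: perms_iff)
  show "inj_on (\<lambda>w. \<lambda>x\<in>{1..r}. transpose i j (w x)) (fixed_words r {..<N} b \<sigma>)"
  proof (rule inj_onI)
    fix w w' assume w: "w \<in> fixed_words r {..<N} b \<sigma>" "w' \<in> fixed_words r {..<N} b \<sigma>"
      and e: "(\<lambda>x\<in>{1..r}. transpose i j (w x)) = (\<lambda>x\<in>{1..r}. transpose i j (w' x))"
    show "w = w'"
    proof (rule extensionalityI[of _ "{1..r}"])
      fix x assume "x \<in> {1..r}"
      then have "transpose i j (w x) = transpose i j (w' x)" using fun_cong[OF e, of x] by simp
      then show "w x = w' x" by (metis transpose_involutory)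
    qed (use w in \<open>auto simp: fixed_words_def words_def PiE_iff\<close>)
  qed
  show "(\<lambda>w. \<lambda>x\<in>{1..r}. transpose i j (w x)) ` fixed_words r {..<N} b \<sigma> \<subseteq> fixed_words r {..<N} (b \<circ> transpose i j) \<sigma>"
  proof clarify
    fix w assume w: "w \<in> fixed_words r {..<N} b \<sigma>"
    let ?v = "\<lambda>x\<in>{1..r}. transpose i j (w x)"
    have ww: "w \<in> words r {..<N} b" and ws: "w \<circ> \<sigma> = w" using w by (auto simp: fixed_words_def)
    have tl: "transpose i j l < N \<longleftrightarrow> l < N" for l using assms by (auto simp: transpose_def)
    have "?v \<in> {1..r} \<rightarrow>\<^sub>E {..<N}" using words_in[OF ww] by (auto simp: tl)
    moreover have "int (card {x \<in> {1..r}. ?v x = l}) = (b \<circ> transpose i j) l" if "l < N" for l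
    proof -
      have "transpose i j y = l \<longleftrightarrow> y = transpose i j l" for y by (metis transpose_involutory)
      then have "{x \<in> {1..r}. ?v x = l} = {x \<in> {1..r}. w x = transpose i j l}" by auto
      then show ?thesis using words_count[OF ww, of "transpose i j l"] that by (simp add: tl)
    qed
    moreover have "?v \<circ> \<sigma> = ?v"
    proof
      fix x
      have "w (\<sigma> x) = w x" using ws by (metis comp_apply)
      then show "(?v \<circ> \<sigma>) x = ?v x"
        using permutes_in_image[OF s, of x] by (auto simp: restrict_def)
    qed
    ultimately show "?v \<in> fixed_words r {..<N} (b \<circ> transpose i j) \<sigma>"
      by (auto simp: fixed_words_def words_def)
  qed
qed simp

lemma num_fixed_swap_letters:
  assumes "\<sigma> \<in> perms r" "i < N" "j < N"
  shows "num_fixed r N (b \<circ> transpose i j) \<sigma> = num_fixed r N b \<sigma>"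
  using num_fixed_swap_letters_le[OF assms, of b] num_fixed_swap_letters_le[OF assms, of "b \<circ> transpose i j"]
  by (simp add: num_fixed_def comp_assoc)

text \<open>A determinant with two equal rows: exchanging two values of \<open>p\<close> merely
  renames letters of the content, which preserves the number of fixed words.\<close>

lemma alt_char_eq_0:
  assumes "\<sigma> \<in> perms r" "i < N" "j < N" "i \<noteq> j" "a i = a j"
  shows "alt_char r N a \<sigma> = 0"
  unfolding alt_char_def
proof (rule sum_involution_eq_0[where \<tau> = "\<lambda>p. p \<circ> transpose i j"])
  fix p assume p: "p \<in> Perm N"
  show "p \<circ> transpose i j \<in> Perm N" using p assms by (intro Perm_swap)
  show "p \<circ> transpose i j \<circ> transpose i j = p" by (rule swap_swap)
  have "shifted a (p \<circ> transpose i j) = shifted a p \<circ> transpose i j"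
    using assms by (auto simp: shifted_def fun_eq_iff transpose_def)
  then show "sign (p \<circ> transpose i j) * num_fixed r N (shifted a (p \<circ> transpose i j)) \<sigma> = - (sign p * num_fixed r N (shifted a p) \<sigma>)"
    using assms p sign_swap[OF p assms(4)] by (simp add: num_fixed_swap_letters)
qed

lemma card_Suc_Collect:
  "card {x \<in> {1..Suc r}. P x} = card {x \<in> {1..r}. P x} + of_bool (P (Suc r))"
proof -
  have "{x \<in> {1..Suc r}. P x} = {x \<in> {1..r}. P x} \<union> (if P (Suc r) then {Suc r} else {})"
    by (auto simp: le_Suc_eq)
  then show ?thesis by (auto simp: card_insert_if)
qed

lemma words_extend:
  assumes "u \<in> words r A (b(i := b i - 1))" "i \<in> A"
  shows "u(Suc r := i) \<in> words (Suc r) A b"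
proof -
  have "u(Suc r := i) \<in> {1..Suc r} \<rightarrow>\<^sub>E A"
    using assms by (auto simp: words_def PiE_iff extensional_def le_Suc_eq)
  moreover have c: "card {x \<in> {1..r}. (u(Suc r := i)) x = l} = card {x \<in> {1..r}. u x = l}" for l
    by (rule arg_cong[of _ _ card]) auto
  have "int (card {x \<in> {1..Suc r}. (u(Suc r := i)) x = l}) = b l" if "l \<in> A" for l
    using words_count[OF assms(1) that] by (simp only: card_Suc_Collect c) auto
  ultimately show ?thesis unfolding words_def by blast
qed

lemma words_restrict:
  assumes "w \<in> words (Suc r) A b" "w (Suc r) = i"
  shows "w(Suc r := undefined) \<in> words r A (b(i := b i - 1))"
proof -
  have "w(Suc r := undefined) \<in> {1..r} \<rightarrow>\<^sub>E A"
    using assms by (auto simp: words_def PiE_iff extensional_def le_Suc_eq)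
  moreover have c: "card {x \<in> {1..r}. (w(Suc r := undefined)) x = l} = card {x \<in> {1..r}. w x = l}" for l
    by (rule arg_cong[of _ _ card]) auto
  have "int (card {x \<in> {1..r}. (w(Suc r := undefined)) x = l}) = (b(i := b i - 1)) l" if "l \<in> A" for l
    using words_count[OF assms(1) that] assms(2) by (simp only: card_Suc_Collect c) auto
  ultimately show ?thesis unfolding words_def by blast
qed

lemma perms_Suc: "\<sigma> \<in> perms r \<Longrightarrow> \<sigma> \<in> perms (Suc r)"
  by (auto simp: perms_iff intro: permutes_subset)

lemma perms_fix: "\<sigma> \<in> perms r \<Longrightarrow> r < x \<Longrightarrow> \<sigma> x = x"
  by (auto simp: perms_iff intro: permutes_not_in)

lemma perms_SucD: "\<sigma> \<in> perms (Suc r) \<Longrightarrow> \<sigma> (Suc r) = Suc r \<Longrightarrow> \<sigma> \<in> perms r"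
  unfolding perms_iff by (rule permutes_superset) (auto simp: le_Suc_eq)

lemma upd_comp_perm:
  assumes "\<sigma> \<in> perms r"
  shows "w(Suc r := i) \<circ> \<sigma> = (w \<circ> \<sigma>)(Suc r := i)"
proof
  fix x
  have "\<sigma> x = Suc r \<longleftrightarrow> x = Suc r"
    using perms_fix[OF assms, of "Suc r"] perms_inv_app(2)[OF assms] by (metis lessI)
  then show "(w(Suc r := i) \<circ> \<sigma>) x = ((w \<circ> \<sigma>)(Suc r := i)) x" by simp
qed

text \<open>A permutation of the first \<open>r\<close> places leaves the letter at place
  \<open>Suc r\<close> alone, so that letter can be deleted and recorded as
  \<open>i\<close>.\<close>

lemma num_fixed_restrict:
  assumes "\<sigma> \<in> perms r"
  shows "num_fixed (Suc r) N b \<sigma> = (\<Sum>i<N. num_fixed r N (b(i := b i - 1)) \<sigma>)"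
proof -
  have "card (fixed_words (Suc r) {..<N} b \<sigma>) = (\<Sum>i<N. card {w \<in> fixed_words (Suc r) {..<N} b \<sigma>. w (Suc r) = i})"
    unfolding card_eq_sum by (rule sum.group[symmetric]) (use words_in in \<open>fastforce simp: fixed_words_def\<close>)+
  also have "\<dots> = (\<Sum>i<N. card (fixed_words r {..<N} (b(i := b i - 1)) \<sigma>))"
  proof (rule sum.cong[OF refl])
    fix i assume i: "i \<in> {..<N}"
    show "card {w \<in> fixed_words (Suc r) {..<N} b \<sigma>. w (Suc r) = i} = card (fixed_words r {..<N} (b(i := b i - 1)) \<sigma>)"
    proof (rule bij_betw_same_card, rule bij_betw_byWitness[where f = "\<lambda>w. w(Suc r := undefined)" and f' = "\<lambda>u. u(Suc r := i)"])
      show "\<forall>u\<in>fixed_words r {..<N} (b(i := b i - 1)) \<sigma>. u(Suc r := i, Suc r := undefined) = u"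
        by (auto simp: fixed_words_def words_def PiE_iff extensional_def fun_eq_iff)
      show "(\<lambda>w. w(Suc r := undefined)) ` {w \<in> fixed_words (Suc r) {..<N} b \<sigma>. w (Suc r) = i} \<subseteq> fixed_words r {..<N} (b(i := b i - 1)) \<sigma>"
        using words_restrict assms by (auto simp: fixed_words_def upd_comp_perm)
      show "(\<lambda>u. u(Suc r := i)) ` fixed_words r {..<N} (b(i := b i - 1)) \<sigma> \<subseteq> {w \<in> fixed_words (Suc r) {..<N} b \<sigma>. w (Suc r) = i}"
        using words_extend[OF _ i] assms by (auto simp: fixed_words_def upd_comp_perm)
    qed auto
  qed
  finally show ?thesis by (simp add: num_fixed_def)
qed

lemma shifted_upd: "(shifted a p)(i := shifted a p i + k) = shifted (a(i := a i + k)) p"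
  by (auto simp: shifted_def)

text \<open>Branching rule for restriction. If \<open>a\<close> is strictly decreasing, a summand
  that is no longer so has two equal entries and vanishes by \<open>alt_char_eq_0\<close>.\<close>

lemma alt_char_restrict:
  assumes "\<sigma> \<in> perms r"
  shows "alt_char (Suc r) N a \<sigma> = (\<Sum>i<N. alt_char r N (a(i := a i - 1)) \<sigma>)"
  unfolding alt_char_def num_fixed_restrict[OF assms] sum_distrib_left using shifted_upd[of a _ _ "-1"]
  by (subst sum.swap) simp

section \<open>Averages of class functions over Young subgroups\<close>

definition stab_pairs :: "nat \<Rightarrow> nat set \<Rightarrow> (nat \<Rightarrow> int) \<Rightarrow> ((nat \<Rightarrow> nat) \<times> (nat \<Rightarrow> nat)) set" where
  "stab_pairs r A b = {(w,\<sigma>). w \<in> words r A b \<and> \<sigma> \<in> perms r \<and> w \<circ> \<sigma> = w}"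

definition stab_pairs_at :: "nat \<Rightarrow> nat set \<Rightarrow> (nat \<Rightarrow> int) \<Rightarrow> nat \<Rightarrow> nat set \<Rightarrow> ((nat \<Rightarrow> nat) \<times> (nat \<Rightarrow> nat)) set" where
  "stab_pairs_at r A b l K = {(w,\<sigma>) \<in> stab_pairs r A b. {x \<in> {1..r}. w x = l} = K}"

text \<open>The inner product of \<open>f\<close> with the permutation character on words. For a
  class function it is, by Frobenius reciprocity, the average of \<open>f\<close> over a Young
  subgroup of type \<open>b\<close>, and 0 if there are no words. The set of letters is a parameter
  because letters are later split off one at a time.\<close>

definition young_trace :: "nat \<Rightarrow> nat set \<Rightarrow> (nat \<Rightarrow> int) \<Rightarrow> ((nat \<Rightarrow> nat) \<Rightarrow> complex) \<Rightarrow> complex" where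
  "young_trace r A b f = (\<Sum>(w,\<sigma>)\<in>stab_pairs r A b. f \<sigma>) / fact r"

lemma finite_stab_pairs [simp]: "finite A \<Longrightarrow> finite (stab_pairs r A b)"
  by (rule finite_subset[of _ "words r A b \<times> perms r"]) (auto simp: stab_pairs_def)

lemma ex_perm_image:
  assumes "finite S" "K \<subseteq> S" "K' \<subseteq> S" "card K = card K'"
  obtains \<pi> where "\<pi> permutes S" "\<pi> ` K = K'"
proof -
  have fin: "finite K" "finite K'" using assms finite_subset by auto
  obtain f where f: "bij_betw f K K'" using finite_same_card_bij[OF fin assms(4)] by auto
  have "card (S - K) = card (S - K')" using assms fin by (simp add: card_Diff_subset)
  then obtain g where g: "bij_betw g (S - K) (S - K')" using finite_same_card_bij[of "S-K" "S-K'"] assms by auto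
  define h where "h x = (if x \<in> K then f x else if x \<in> S then g x else x)" for x
  have "bij_betw h K K'" using f by (rule bij_betw_cong[THEN iffD1, rotated]) (simp add: h_def)
  moreover have "bij_betw h (S - K) (S - K')" using g by (rule bij_betw_cong[THEN iffD1, rotated]) (simp add: h_def)
  ultimately have "bij_betw h (K \<union> (S - K)) (K' \<union> (S - K'))" by (rule bij_betw_combine) auto
  then have "bij_betw h S S" using assms by (simp add: Un_absorb1)
  then have "h permutes S" using assms(2) by (intro bij_imp_permutes) (auto simp: h_def)
  moreover have "h ` K = K'" using \<open>bij_betw h K K'\<close> by (simp add: bij_betw_def)
  ultimately show ?thesis by (rule that)
qed

text \<open>Conjugating pairs by \<open>\<pi>\<close> moves the block of the letter \<open>l\<close>
  from \<open>K\<close> to its image, so a class function sees only the size of the block.\<close>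

lemma sum_stab_pairs_at_conj:
  assumes "classfn r f" "\<pi> \<in> perms r" "finite A"
  shows "(\<Sum>(w,\<sigma>)\<in>stab_pairs_at r A b l K. f \<sigma>) = (\<Sum>(w,\<sigma>)\<in>stab_pairs_at r A b l (\<pi> ` K). f \<sigma>)"
proof (rule sum.reindex_bij_witness[where j = "\<lambda>(w,\<sigma>). (w \<circ> inv \<pi>, \<pi> \<circ> \<sigma> \<circ> inv \<pi>)"
      and i = "\<lambda>(w,\<sigma>). (w \<circ> \<pi>, inv \<pi> \<circ> \<sigma> \<circ> \<pi>)"])
  have p: "\<pi> permutes {1..r}" using assms by (simp add: perms_iff)
  have i1: "inv \<pi> \<circ> (\<pi> \<circ> g) = g" and i2: "\<pi> \<circ> (inv \<pi> \<circ> g) = g" for g :: "nat \<Rightarrow> nat"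
    using perms_inv_o[OF assms(2)] by (simp_all add: comp_assoc[symmetric])
  note simps = comp_assoc i1 i2 perms_inv_o[OF assms(2)]
  have im: "x \<in> \<pi> ` K \<longleftrightarrow> inv \<pi> x \<in> K" for x K
    using perms_inv_app[OF assms(2)] by (metis image_iff)
  have img: "{x \<in> {1..r}. (w \<circ> inv \<pi>) x = l} = \<pi> ` {x \<in> {1..r}. w x = l}" for w
    by (rule set_eqI) (simp only: im mem_Collect_eq comp_apply permutes_in_image[OF permutes_inv[OF p]])
  have img': "\<pi> ` {x \<in> {1..r}. (w \<circ> \<pi>) x = l} = {x \<in> {1..r}. w x = l}" for w
    using img[of "w \<circ> \<pi>"] by (simp add: simps)
  fix t assume t: "t \<in> stab_pairs_at r A b l K"
  then obtain w \<sigma> where t': "t = (w,\<sigma>)" "w \<in> words r A b" "\<sigma> \<in> perms r" "w \<circ> \<sigma> = w" "{x \<in> {1..r}. w x = l} = K"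
    by (auto simp: stab_pairs_at_def stab_pairs_def)
  show "(case case t of (w,\<sigma>) \<Rightarrow> (w \<circ> inv \<pi>, \<pi> \<circ> \<sigma> \<circ> inv \<pi>) of (w,\<sigma>) \<Rightarrow> (w \<circ> \<pi>, inv \<pi> \<circ> \<sigma> \<circ> \<pi>)) = t"
    by (simp add: t' simps)
  have "w \<circ> (\<sigma> \<circ> inv \<pi>) = w \<circ> inv \<pi>" using t'(4) by (simp add: comp_assoc[symmetric])
  then show "(case t of (w,\<sigma>) \<Rightarrow> (w \<circ> inv \<pi>, \<pi> \<circ> \<sigma> \<circ> inv \<pi>)) \<in> stab_pairs_at r A b l (\<pi> ` K)"
    using t' img words_comp[OF t'(2) perms_inv[OF assms(2)]] assms perms_comp perms_inv
    by (auto simp: stab_pairs_at_def stab_pairs_def simps simp del: comp_apply)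
  show "(case case t of (w,\<sigma>) \<Rightarrow> (w \<circ> inv \<pi>, \<pi> \<circ> \<sigma> \<circ> inv \<pi>) of (w,\<sigma>) \<Rightarrow> f \<sigma>) = (case t of (w,\<sigma>) \<Rightarrow> f \<sigma>)"
    using classfnD[OF assms(1) t'(3) assms(2)] by (simp add: t')
next
  have p: "\<pi> permutes {1..r}" using assms by (simp add: perms_iff)
  have i1: "inv \<pi> \<circ> (\<pi> \<circ> g) = g" and i2: "\<pi> \<circ> (inv \<pi> \<circ> g) = g" for g :: "nat \<Rightarrow> nat"
    using perms_inv_o[OF assms(2)] by (simp_all add: comp_assoc[symmetric])
  note simps = comp_assoc i1 i2 perms_inv_o[OF assms(2)]
  fix t assume t: "t \<in> stab_pairs_at r A b l (\<pi> ` K)"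
  then obtain w \<sigma> where t': "t = (w,\<sigma>)" "w \<in> words r A b" "\<sigma> \<in> perms r" "w \<circ> \<sigma> = w" "{x \<in> {1..r}. w x = l} = \<pi> ` K"
    by (auto simp: stab_pairs_at_def stab_pairs_def)
  show "(case case t of (w,\<sigma>) \<Rightarrow> (w \<circ> \<pi>, inv \<pi> \<circ> \<sigma> \<circ> \<pi>) of (w,\<sigma>) \<Rightarrow> (w \<circ> inv \<pi>, \<pi> \<circ> \<sigma> \<circ> inv \<pi>)) = t"
    by (simp add: t' simps)
  have "w \<circ> (\<sigma> \<circ> \<pi>) = w \<circ> \<pi>" using t'(4) by (simp add: comp_assoc[symmetric])
  moreover have "{x \<in> {1..r}. (w \<circ> \<pi>) x = l} = K"
  proof -
    have "x \<in> {x \<in> {1..r}. (w \<circ> \<pi>) x = l} \<longleftrightarrow> \<pi> x \<in> {x \<in> {1..r}. w x = l}" for x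
      using permutes_in_image[OF p] by auto
    then have "x \<in> {x \<in> {1..r}. (w \<circ> \<pi>) x = l} \<longleftrightarrow> x \<in> K" for x
      unfolding t'(5) using permutes_inj[OF p] by (simp add: inj_image_mem_iff)
    then show ?thesis by blast
  qed
  ultimately show "(case t of (w,\<sigma>) \<Rightarrow> (w \<circ> \<pi>, inv \<pi> \<circ> \<sigma> \<circ> \<pi>)) \<in> stab_pairs_at r A b l K"
    using t' words_comp[OF t'(2) assms(2)] assms perms_comp perms_inv
    by (auto simp: stab_pairs_at_def stab_pairs_def simps simp del: comp_apply)
qed

text \<open>All blocks of size \<open>k\<close> contribute equally; the block can therefore be put
  at the most convenient places.\<close>

lemma sum_stab_pairs_block:
  assumes "classfn r f" "finite A" "l \<in> A" "b l = int k" "K \<subseteq> {1..r}" "card K = k"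
  shows "(\<Sum>(w,\<sigma>)\<in>stab_pairs r A b. f \<sigma>) = of_nat (r choose k) * (\<Sum>(w,\<sigma>)\<in>stab_pairs_at r A b l K. f \<sigma> :: complex)"
proof -
  let ?Ks = "{L. L \<subseteq> {1..r} \<and> card L = k}"
  have "(\<Sum>(w,\<sigma>)\<in>stab_pairs r A b. f \<sigma>) =
      (\<Sum>L\<in>?Ks. \<Sum>(w,\<sigma>)\<in>{t \<in> stab_pairs r A b. (case t of (w,\<sigma>) \<Rightarrow> {x \<in> {1..r}. w x = l}) = L}. f \<sigma>)"
  proof (rule sum.group[symmetric])
    show "(\<lambda>t. case t of (w,\<sigma>) \<Rightarrow> {x \<in> {1..r}. w x = l}) ` stab_pairs r A b \<subseteq> ?Ks"
      using words_count[of _ r A b l] assms(3,4) by (fastforce simp: stab_pairs_def)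
  qed (use assms(2) in auto)
  also have "\<dots> = (\<Sum>L\<in>?Ks. \<Sum>(w,\<sigma>)\<in>stab_pairs_at r A b l L. f \<sigma>)"
    by (intro sum.cong refl) (auto simp: stab_pairs_at_def)
  also have "\<dots> = (\<Sum>L\<in>?Ks. \<Sum>(w,\<sigma>)\<in>stab_pairs_at r A b l K. f \<sigma>)"
  proof (rule sum.cong[OF refl])
    fix L assume "L \<in> ?Ks"
    then obtain \<pi> where "\<pi> permutes {1..r}" "\<pi> ` L = K"
      using ex_perm_image[of "{1..r}" L K] assms by auto
    then show "(\<Sum>(w,\<sigma>)\<in>stab_pairs_at r A b l L. f \<sigma>) = (\<Sum>(w,\<sigma>)\<in>stab_pairs_at r A b l K. f \<sigma>)"
      using sum_stab_pairs_at_conj[OF assms(1) _ assms(2), of \<pi> b l L] by (simp add: perms_iff)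
  qed
  also have "\<dots> = of_nat (r choose k) * (\<Sum>(w,\<sigma>)\<in>stab_pairs_at r A b l K. f \<sigma>)"
    using n_subsets[of "{1..r}" k] by simp
  finally show ?thesis .
qed

text \<open>The only occurrence of \<open>l\<close> is put at the last place, which every
  stabilising permutation must then fix. The \<open>Suc r\<close> possible places cancel against the
  factorials.\<close>

lemma young_trace_last_letter:
  assumes "classfn (Suc r) f" "finite A" "l \<in> A" "b l = 0"
  shows "young_trace (Suc r) A (b(l := 1)) f = young_trace r A b f"
proof -
  have bb: "(b(l := 1))(l := (b(l := 1)) l - 1) = b" using assms by auto
  have "(\<Sum>(w,\<sigma>)\<in>stab_pairs (Suc r) A (b(l := 1)). f \<sigma>) =
      of_nat (Suc r choose 1) * (\<Sum>(w,\<sigma>)\<in>stab_pairs_at (Suc r) A (b(l := 1)) l {Suc r}. f \<sigma>)"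
    by (rule sum_stab_pairs_block) (use assms in auto)
  also have "(\<Sum>(w,\<sigma>)\<in>stab_pairs_at (Suc r) A (b(l := 1)) l {Suc r}. f \<sigma>) = (\<Sum>(w,\<sigma>)\<in>stab_pairs r A b. f \<sigma>)"
  proof (rule sum.reindex_bij_witness[where j = "\<lambda>(w,\<sigma>). (w(Suc r := undefined), \<sigma>)" and i = "\<lambda>(w,\<sigma>). (w(Suc r := l), \<sigma>)"])
    fix t assume "t \<in> stab_pairs_at (Suc r) A (b(l := 1)) l {Suc r}"
    then obtain w \<sigma> where t': "t = (w,\<sigma>)" "w \<in> words (Suc r) A (b(l := 1))" "\<sigma> \<in> perms (Suc r)" "w \<circ> \<sigma> = w"
      "{x \<in> {1..Suc r}. w x = l} = {Suc r}"
      by (auto simp: stab_pairs_at_def stab_pairs_def)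
    have wl: "w (Suc r) = l" using t'(5) by auto
    show "(case case t of (w,\<sigma>) \<Rightarrow> (w(Suc r := undefined), \<sigma>) of (w,\<sigma>) \<Rightarrow> (w(Suc r := l), \<sigma>)) = t"
      using t' wl by auto
    have "w (\<sigma> (Suc r)) = l" using t'(4) wl by (metis comp_apply)
    moreover have "\<sigma> (Suc r) \<in> {1..Suc r}" using t'(3) permutes_in_image[of \<sigma> "{1..Suc r}" "Suc r"] by (auto simp: perms_iff)
    ultimately have "\<sigma> (Suc r) \<in> {x \<in> {1..Suc r}. w x = l}" by blast
    then have "\<sigma> (Suc r) = Suc r" unfolding t'(5) by simp
    then have s: "\<sigma> \<in> perms r" using t'(3) by (rule perms_SucD[rotated])
    have "w(Suc r := undefined) \<in> words r A b"
      using words_restrict[OF t'(2) wl] by (simp only: bb)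
    moreover have "w(Suc r := undefined) \<circ> \<sigma> = w(Suc r := undefined)"
      by (simp only: upd_comp_perm[OF s] t'(4))
    ultimately show "(case t of (w,\<sigma>) \<Rightarrow> (w(Suc r := undefined), \<sigma>)) \<in> stab_pairs r A b"
      unfolding stab_pairs_def t'(1) using s by (simp only: mem_Collect_eq prod.case simp_thms)
  next
    fix t assume "t \<in> stab_pairs r A b"
    then obtain w \<sigma> where t': "t = (w,\<sigma>)" "w \<in> words r A b" "\<sigma> \<in> perms r" "w \<circ> \<sigma> = w"
      by (auto simp: stab_pairs_def)
    have un: "w (Suc r) = undefined" using t'(2) by (auto simp: words_def PiE_iff extensional_def)
    then show "(case case t of (w,\<sigma>) \<Rightarrow> (w(Suc r := l), \<sigma>) of (w,\<sigma>) \<Rightarrow> (w(Suc r := undefined), \<sigma>)) = t"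
      using t' by auto
    have "card {x \<in> {1..r}. w x = l} = 0" using words_count[OF t'(2) assms(3)] assms(4) by simp
    then have "{x \<in> {1..r}. w x = l} = {}" by simp
    then have "{x \<in> {1..Suc r}. (w(Suc r := l)) x = l} = {Suc r}" by (auto simp: le_Suc_eq)
    then show "(case t of (w,\<sigma>) \<Rightarrow> (w(Suc r := l), \<sigma>)) \<in> stab_pairs_at (Suc r) A (b(l := 1)) l {Suc r}"
    proof -
      assume 1: "{x \<in> {1..Suc r}. (w(Suc r := l)) x = l} = {Suc r}"
      have 2: "w(Suc r := l) \<in> words (Suc r) A (b(l := 1))"
        by (rule words_extend) (use t'(2) assms(3) in \<open>simp_all only: bb\<close>)
      have 3: "w(Suc r := l) \<circ> \<sigma> = w(Suc r := l)"
        by (simp only: upd_comp_perm[OF t'(3)] t'(4))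
      show ?thesis unfolding stab_pairs_at_def stab_pairs_def t'(1) using 1 2 3 perms_Suc[OF t'(3)]
        by (simp only: mem_Collect_eq prod.case simp_thms)
    qed
  qed auto
  finally show ?thesis unfolding young_trace_def fact_Suc choose_one by (simp only: mult_divide_mult_cancel_left of_nat_mult) (simp del: of_nat_Suc)
qed

lemma young_trace_neg: "i \<in> A \<Longrightarrow> b i < 0 \<Longrightarrow> young_trace r A b f = 0"
  by (simp add: young_trace_def stab_pairs_def words_neg)

definition alt_trace :: "nat \<Rightarrow> nat \<Rightarrow> (nat \<Rightarrow> int) \<Rightarrow> ((nat \<Rightarrow> nat) \<Rightarrow> complex) \<Rightarrow> complex" where
  "alt_trace r N a f = (\<Sum>\<sigma>\<in>perms r. of_int (alt_char r N a \<sigma>) * f \<sigma>) / fact r"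

lemma young_trace_num_fixed: "young_trace r {..<N} b f = (\<Sum>\<sigma>\<in>perms r. of_int (num_fixed r N b \<sigma>) * f \<sigma>) / fact r"
proof -
  have "(\<Sum>(w,\<sigma>)\<in>stab_pairs r {..<N} b. f \<sigma>) = (\<Sum>(\<sigma>,w)\<in>(SIGMA \<sigma>:perms r. fixed_words r {..<N} b \<sigma>). f \<sigma>)"
    by (rule sum.reindex_bij_witness[where i = prod.swap and j = prod.swap]) (auto simp: stab_pairs_def fixed_words_def)
  also have "\<dots> = (\<Sum>\<sigma>\<in>perms r. of_int (num_fixed r N b \<sigma>) * f \<sigma>)"
    by (subst sum.Sigma[symmetric]) (auto simp: num_fixed_def)
  finally show ?thesis by (simp add: young_trace_def)
qed

lemma alt_trace_young_trace: "alt_trace r N a f = (\<Sum>p\<in>Perm N. of_int (sign p) * young_trace r {..<N} (shifted a p) f)"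
  unfolding alt_trace_def young_trace_num_fixed alt_char_def
  by (simp add: sum_divide_distrib sum_distrib_left sum_distrib_right mult_ac) (rule sum.swap)

text \<open>Multiplication by the first power sum, in determinantal form: adding 1 to one row in all ways
  is the same as adding 1 to one column in all ways, and only the last column survives.\<close>
lemma alt_trace_pieri:
  assumes "classfn (Suc r) f" "0 < N" "a (N - 1) = 1 - int N"
  shows "(\<Sum>i<N. alt_trace (Suc r) N (a(i := a i + 1)) f) = alt_trace r N a f"
proof -
  let ?F = "\<lambda>p i. of_int (sign p) * young_trace (Suc r) {..<N} ((shifted a p)(i := shifted a p i + 1)) f"
  let ?T1 = "{(p,i). p \<in> Perm N \<and> i < N \<and> p i < N - 1}" and ?T2 = "{(p,i). p \<in> Perm N \<and> i < N \<and> p i = N - 1}"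
  have le: "p i < N - 1 \<or> p i = N - 1" if "p \<in> Perm N" "i < N" for p i
    using Perm_less[OF that(1), of i] that(2) by linarith
  have T: "Perm N \<times> {..<N} = ?T1 \<union> ?T2"
    using le by auto
  have fin: "finite ?T1" "finite ?T2"
    by (rule finite_subset[of _ "Perm N \<times> {..<N}"], auto)+
  have "(\<Sum>i<N. alt_trace (Suc r) N (a(i := a i + 1)) f) = (\<Sum>(p,i)\<in>Perm N \<times> {..<N}. ?F p i)"
    unfolding alt_trace_young_trace shifted_upd[symmetric] by (subst sum.swap) (simp add: sum.cartesian_product)
  also have "\<dots> = (\<Sum>(p,i)\<in>?T1. ?F p i) + (\<Sum>(p,i)\<in>?T2. ?F p i)"
    unfolding T by (rule sum.union_disjoint) (use fin in auto)
  \<comment> \<open>Row \<open>j\<close> has \<open>p j = Suc (p i)\<close>: raising row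
    \<open>i\<close> for \<open>p\<close> and raising row \<open>j\<close> for the exchanged
    permutation give the same vector.\<close>
  also have "(\<Sum>(p,i)\<in>?T1. ?F p i) = 0"
  proof (rule sum_involution_eq_0[where \<tau> = "\<lambda>(p,i). (p \<circ> transpose i (inv p (Suc (p i))), inv p (Suc (p i)))"])
    fix t assume "t \<in> ?T1"
    then obtain p i where t: "t = (p,i)" "p \<in> Perm N" "i < N" "p i < N - 1" by auto
    define j where "j = inv p (Suc (p i))"
    have pj: "p j = Suc (p i)" using t by (simp add: j_def Perm_inv)
    have jN: "j < N" unfolding j_def using t by (subst Perm_inv_less) auto
    have ij: "i \<noteq> j" using pj by auto
    have P: "p \<circ> transpose i j \<in> Perm N" using t jN by (intro Perm_swap)
    show "(case t of (p,i) \<Rightarrow> (p \<circ> transpose i (inv p (Suc (p i))), inv p (Suc (p i)))) \<in> ?T1"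
      using P jN t by (simp add: j_def[symmetric])
    have "inv (p \<circ> transpose i j) (Suc ((p \<circ> transpose i j) j)) = i"
      using Perm_inv(2)[OF P, of i] pj by simp
    then show "(\<lambda>(p,i). (p \<circ> transpose i (inv p (Suc (p i))), inv p (Suc (p i)))) ((\<lambda>(p,i). (p \<circ> transpose i (inv p (Suc (p i))), inv p (Suc (p i)))) t) = t"
      using t by (simp add: j_def[symmetric] comp_assoc transpose_commute)
    have "(shifted a (p \<circ> transpose i j))(j := shifted a (p \<circ> transpose i j) j + 1) = (shifted a p)(i := shifted a p i + 1)"
      using pj ij by (auto simp: shifted_def fun_eq_iff transpose_def)
    then show "(case (\<lambda>(p,i). (p \<circ> transpose i (inv p (Suc (p i))), inv p (Suc (p i)))) t of (p,i) \<Rightarrow> ?F p i) = - (case t of (p,i) \<Rightarrow> ?F p i)"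
      using t sign_swap[OF t(2) ij] by (simp add: j_def[symmetric])
  qed
  \<comment> \<open>The last row is empty by the hypothesis on \<open>a (N - 1)\<close>, so its
    entry is negative unless it sits in the last column or is the one raised. Hence only
    \<open>i = N - 1\<close> survives, where the entry 0 becomes a letter used once.\<close>
  also have "(\<Sum>(p,i)\<in>?T2. ?F p i) = (\<Sum>(p,i)\<in>(\<lambda>p. (p, N - 1)) ` {p \<in> Perm N. p (N - 1) = N - 1}. ?F p i)"
  proof (rule sum.mono_neutral_right[OF fin(2)])
    show "(\<lambda>p. (p, N - 1)) ` {p \<in> Perm N. p (N - 1) = N - 1} \<subseteq> ?T2" using assms(2) by auto
    show "\<forall>t\<in>?T2 - (\<lambda>p. (p, N - 1)) ` {p \<in> Perm N. p (N - 1) = N - 1}. (case t of (p,i) \<Rightarrow> ?F p i) = 0"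
    proof
      fix t assume t': "t \<in> ?T2 - (\<lambda>p. (p, N - 1)) ` {p \<in> Perm N. p (N - 1) = N - 1}"
      then obtain p i where t: "t = (p,i)" "p \<in> Perm N" "i < N" "p i = N - 1" by auto
      have i: "i \<noteq> N - 1" using t' t by auto
      have "p (N - 1) \<noteq> N - 1" using i t Perm_inj[OF t(2), of i "N - 1"] by simp
      moreover have "p (N - 1) < N" using Perm_less[OF t(2)] assms(2) by simp
      ultimately have "p (N - 1) < N - 1" by simp
      then have "((shifted a p)(i := shifted a p i + 1)) (N - 1) < 0"
        using i assms(3) by (simp add: shifted_def)
      then have "young_trace (Suc r) {..<N} ((shifted a p)(i := shifted a p i + 1)) f = 0"
        using assms(2) by (intro young_trace_neg[of "N - 1"]) auto
      then show "(case t of (p,i) \<Rightarrow> ?F p i) = 0" by (simp add: t)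
    qed
  qed
  also have "\<dots> = (\<Sum>p\<in>{p \<in> Perm N. p (N - 1) = N - 1}. ?F p (N - 1))"
    by (subst sum.reindex) (auto simp: inj_on_def)
  also have "\<dots> = (\<Sum>p\<in>{p \<in> Perm N. p (N - 1) = N - 1}. of_int (sign p) * young_trace r {..<N} (shifted a p) f)"
  proof (rule sum.cong[OF refl])
    fix p assume "p \<in> {p \<in> Perm N. p (N - 1) = N - 1}"
    then have "shifted a p (N - 1) = 0" using assms by (simp add: shifted_def)
    then show "?F p (N - 1) = of_int (sign p) * young_trace r {..<N} (shifted a p) f"
      using young_trace_last_letter[OF assms(1), of "{..<N}" "N - 1" "shifted a p"] assms(2) by simp
  qed
  also have "\<dots> = alt_trace r N a f"
    unfolding alt_trace_young_trace
  proof (rule sum.mono_neutral_left)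
    show "\<forall>p\<in>Perm N - {p \<in> Perm N. p (N - 1) = N - 1}. of_int (sign p) * young_trace r {..<N} (shifted a p) f = 0"
    proof
      fix p assume p: "p \<in> Perm N - {p \<in> Perm N. p (N - 1) = N - 1}"
      have "p (N - 1) < N - 1 \<or> p (N - 1) = N - 1" using le[of p "N - 1"] p assms(2) by simp
      then have "p (N - 1) < N - 1" using p by blast
      then have "young_trace r {..<N} (shifted a p) f = 0"
        using assms by (intro young_trace_neg[of "N - 1"]) (auto simp: shifted_def)
      then show "of_int (sign p) * young_trace r {..<N} (shifted a p) f = 0" by simp
    qed
  qed auto
  finally show ?thesis by (simp only: add_0_left)
qed

section \<open>The group algebra of the symmetric groups\<close>

text \<open>The finitary symmetric group on the positive integers, written additively so that
  finitely supported functions on it form its group algebra.\<close>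

typedef sperm = "{f :: nat \<Rightarrow> nat. \<exists>k. f permutes {1..k}}" morphisms ap Sp
  by (rule exI[of _ id]) (auto intro: permutes_id)

lemma sperm_comp:
  assumes "\<exists>k. f permutes {1..k}" "\<exists>k. g permutes {1..k}"
  shows "\<exists>k. f \<circ> g permutes {1..k::nat}"
proof -
  obtain k l where "f permutes {1..k}" "g permutes {1..l}" using assms by auto
  then have "f permutes {1..max k l}" "g permutes {1..max k l}"
    by - (rule permutes_subset, assumption, simp)+
  then show ?thesis using permutes_compose by blast
qed

instantiation sperm :: group_add
begin
definition "0 = Sp id"
definition "a + b = Sp (ap a \<circ> ap b)"
definition "- a = Sp (inv (ap a))"
definition "a - b = a + - (b :: sperm)"

lemma ap_zero: "ap 0 = id"
  unfolding zero_sperm_def by (rule Sp_inverse) (auto intro: permutes_id)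

lemma ap_plus: "ap (a + b) = ap a \<circ> ap b"
  unfolding plus_sperm_def using ap[of a] ap[of b] by (intro Sp_inverse) (simp only: mem_Collect_eq sperm_comp)

lemma ap_uminus: "ap (- a) = inv (ap a)"
  unfolding uminus_sperm_def using ap[of a] by (intro Sp_inverse) (auto intro: permutes_inv)

instance
proof
  fix a b c :: sperm
  show "a + b + c = a + (b + c)" by (simp add: ap_inject[symmetric] ap_plus comp_assoc)
  show "0 + a = a" by (simp add: ap_inject[symmetric] ap_plus ap_zero)
  show "a + 0 = a" by (simp add: ap_inject[symmetric] ap_plus ap_zero)
  show "- a + a = 0"
    using ap[of a] by (auto simp: ap_inject[symmetric] ap_plus ap_zero ap_uminus permutes_inv_o)
  show "a + - b = a - b" by (simp add: minus_sperm_def)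
qed
end

definition sym_perms :: "nat \<Rightarrow> sperm set" where
  "sym_perms r = {s. ap s \<in> perms r}"

lemma ap_Sp: "\<sigma> \<in> perms r \<Longrightarrow> ap (Sp \<sigma>) = \<sigma>"
  by (rule Sp_inverse) (auto simp: perms_iff)

lemma Sp_ap: "Sp (ap s) = s"
  by (rule ap_inverse)

lemma bij_ap: "bij_betw ap (sym_perms r) (perms r)"
  by (rule bij_betw_byWitness[where f' = Sp]) (auto simp: sym_perms_def ap_Sp Sp_ap)

lemma finite_sym_perms [simp]: "finite (sym_perms r)"
  using bij_betw_finite[OF bij_ap[of r]] by simp

lemma sum_sym_perms: "(\<Sum>s\<in>sym_perms r. f (ap s)) = (\<Sum>\<sigma>\<in>perms r. f \<sigma>)"
  by (rule sum.reindex_bij_betw[OF bij_ap])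

lemma card_sym_perms: "card (sym_perms r) = fact r"
  using bij_betw_same_card[OF bij_ap[of r]] card_permutations[of "{1..r}" r]
  by (simp add: perms_def)

lemma sym_perms_zero: "0 \<in> sym_perms r" by (simp add: sym_perms_def ap_zero perms_iff permutes_id)
lemma sym_perms_plus: "a \<in> sym_perms r \<Longrightarrow> b \<in> sym_perms r \<Longrightarrow> a + b \<in> sym_perms r" by (simp add: sym_perms_def ap_plus perms_comp)
lemma sym_perms_uminus: "a \<in> sym_perms r \<Longrightarrow> - a \<in> sym_perms r" by (simp add: sym_perms_def ap_uminus perms_inv)
lemma sym_perms_Suc: "a \<in> sym_perms r \<Longrightarrow> a \<in> sym_perms (Suc r)" by (simp add: sym_perms_def perms_Suc)

text \<open>Real coefficients are what the positivity arguments need. As the group is written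
  additively, the unit of the algebra sits at the group element 0.\<close>

type_synonym ga = "sperm \<Rightarrow>\<^sub>0 real"

abbreviation coef :: "ga \<Rightarrow> sperm \<Rightarrow> real" where "coef \<equiv> Poly_Mapping.lookup"
abbreviation gelem :: "sperm \<Rightarrow> real \<Rightarrow> ga" where "gelem \<equiv> Poly_Mapping.single"
abbreviation scalar :: "real \<Rightarrow> ga" where "scalar \<equiv> Poly_Mapping.single 0"

lemma ga_expand:
  assumes "finite S" "Poly_Mapping.keys x \<subseteq> S"
  shows "x = (\<Sum>s\<in>S. gelem s (coef x s))"
proof (rule poly_mapping_eqI)
  fix k
  show "coef x k = coef (\<Sum>s\<in>S. gelem s (coef x s)) k"
    using assms by (auto simp: lookup_sum lookup_single when_def in_keys_iff)
qed

lemma coef_gelem_mult: "coef (gelem s c * y) t = c * coef y (- s + t)"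
proof -
  have y: "y = (\<Sum>u\<in>Poly_Mapping.keys y. gelem u (coef y u))" by (rule ga_expand) auto
  have "gelem s c * y = (\<Sum>u\<in>Poly_Mapping.keys y. gelem (s + u) (c * coef y u))"
    using arg_cong[OF y, of "\<lambda>z. gelem s c * z"] unfolding sum_distrib_left mult_single .
  moreover have "s + u = t \<longleftrightarrow> u = - s + t" for u by (metis add_minus_cancel minus_add_cancel)
  ultimately have "coef (gelem s c * y) t = (\<Sum>u\<in>Poly_Mapping.keys y. if u = - s + t then c * coef y u else 0)"
    by (simp only: lookup_sum lookup_single when_def)
  then show ?thesis by (auto simp: in_keys_iff)
qed

lemma coef_mult_gelem: "coef (y * gelem s c) t = coef y (t - s) * c"
proof -
  have y: "y = (\<Sum>u\<in>Poly_Mapping.keys y. gelem u (coef y u))" by (rule ga_expand) auto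
  have "y * gelem s c = (\<Sum>u\<in>Poly_Mapping.keys y. gelem (u + s) (coef y u * c))"
    using arg_cong[OF y, of "\<lambda>z. z * gelem s c"] unfolding sum_distrib_right mult_single .
  moreover have "u + s = t \<longleftrightarrow> u = t - s" for u by (rule eq_diff_eq[symmetric])
  ultimately have "coef (y * gelem s c) t = (\<Sum>u\<in>Poly_Mapping.keys y. if u = t - s then coef y u * c else 0)"
    by (simp only: lookup_sum lookup_single when_def)
  then show ?thesis by (auto simp: in_keys_iff)
qed

lemma coef_mult:
  assumes "finite S" "Poly_Mapping.keys x \<subseteq> S"
  shows "coef (x * y) t = (\<Sum>s\<in>S. coef x s * coef y (- s + t))"
proof -
  have "coef (x * y) t = coef ((\<Sum>s\<in>S. gelem s (coef x s)) * y) t" using ga_expand[OF assms] by simp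
  then show ?thesis by (simp add: sum_distrib_right lookup_sum coef_gelem_mult)
qed

lemma scalar_coef [simp]: "coef (scalar c * x) t = c * coef x t"
  by (simp add: coef_gelem_mult)

lemma scalar_comm: "scalar c * x = x * scalar c"
  by (rule poly_mapping_eqI) (simp add: coef_mult_gelem)

lemma scalar_mult: "scalar c * scalar d = scalar (c * d)"
  by (simp add: mult_single)

lemma scalar_left: "x * (scalar c * y) = scalar c * (x * y)"
  by (metis mult.assoc scalar_comm)

definition supported :: "nat \<Rightarrow> ga \<Rightarrow> bool" where
  "supported r x \<longleftrightarrow> Poly_Mapping.keys x \<subseteq> sym_perms r"

lemma supported_coef: "supported r x \<longleftrightarrow> (\<forall>s. s \<notin> sym_perms r \<longrightarrow> coef x s = 0)"
  by (auto simp: supported_def subset_iff in_keys_iff)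

lemma supported_mult: "supported r x \<Longrightarrow> supported r y \<Longrightarrow> supported r (x * y)"
  using keys_mult[of x y] sym_perms_plus by (fastforce simp: supported_def)

lemma supported_gelem: "s \<in> sym_perms r \<Longrightarrow> supported r (gelem s c)"
  by (auto simp: supported_def)

lemma supported_scalar: "supported r (scalar c)"
  by (rule supported_gelem[OF sym_perms_zero])

lemma supported_1: "supported r 1"
  using supported_scalar[of r 1] by simp

lemma supported_diff: "supported r x \<Longrightarrow> supported r y \<Longrightarrow> supported r (x - y)"
  by (auto simp: supported_coef lookup_minus)

lemma supported_sum: "(\<And>i. i \<in> I \<Longrightarrow> supported r (f i)) \<Longrightarrow> supported r (sum f I)"
  by (auto simp: supported_coef lookup_sum)

lemma supported_Suc: "supported r x \<Longrightarrow> supported (Suc r) x"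
  using sym_perms_Suc by (auto simp: supported_def)

lemma supported_expand: "supported r x \<Longrightarrow> x = (\<Sum>s\<in>sym_perms r. gelem s (coef x s))"
  by (rule ga_expand) (auto simp: supported_def)

text \<open>The adjoint for the inner product in which the permutations are orthonormal, see
  \<open>coef_mult_star\<close>.\<close>

definition star :: "ga \<Rightarrow> ga" where
  "star x = Poly_Mapping.map_key uminus x"

lemma coef_star [simp]: "coef (star x) s = coef x (- s)"
  unfolding star_def by (subst map_key.rep_eq) (auto simp: inj_def)

lemma star_star [simp]: "star (star x) = x"
  by (rule poly_mapping_eqI) simp

lemma star_sum: "star (sum f I) = (\<Sum>i\<in>I. star (f i))"
  by (rule poly_mapping_eqI) (simp add: lookup_sum)

lemma star_diff: "star (x - y) = star x - star y"
  by (rule poly_mapping_eqI) (simp add: lookup_minus)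

lemma star_gelem: "star (gelem s c) = gelem (- s) c"
  by (rule poly_mapping_eqI) (auto simp: lookup_single when_def)

lemma star_mult: "star (x * y) = star y * star x"
proof (rule poly_mapping_eqI)
  fix t
  let ?S = "Poly_Mapping.keys x"
  have k: "Poly_Mapping.keys (star x) = uminus ` ?S"
  proof (intro set_eqI)
    fix s show "s \<in> Poly_Mapping.keys (star x) \<longleftrightarrow> s \<in> uminus ` ?S"
      by (metis coef_star image_iff in_keys_iff minus_minus)
  qed
  have "star y * star x = (\<Sum>s\<in>?S. star y * gelem (- s) (coef x s))"
  proof -
    have "star x = (\<Sum>s\<in>?S. gelem (- s) (coef x s))"
      using ga_expand[of ?S x] star_sum[of "\<lambda>s. gelem s (coef x s)" ?S] by (simp add: star_gelem)
    then show ?thesis by (simp add: sum_distrib_left)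
  qed
  then have "coef (star y * star x) t = (\<Sum>s\<in>?S. coef y (- (t + s)) * coef x s)"
    by (simp add: lookup_sum coef_mult_gelem)
  then show "coef (star (x * y)) t = coef (star y * star x) t"
    by (simp add: coef_mult[of ?S x] minus_add mult.commute)
qed

lemma star_one [simp]: "star 1 = 1"
  using star_gelem[of 0 1] by simp

lemma coef_mult_star: "supported r x \<Longrightarrow> coef (x * star y) 0 = (\<Sum>s\<in>sym_perms r. coef x s * coef y s)"
  by (subst coef_mult[of "sym_perms r"]) (auto simp: supported_def)

text \<open>The coefficient of the identity is a trace form.\<close>

lemma coef_mult_comm: "coef (x * y) 0 = coef (y * x) 0"
proof -
  have "coef (x * y) 0 = (\<Sum>s\<in>Poly_Mapping.keys x. coef x s * coef y (- s))"
    by (subst coef_mult[of "Poly_Mapping.keys x"]) auto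
  moreover have "y * x = (\<Sum>s\<in>Poly_Mapping.keys x. y * gelem s (coef x s))"
    using ga_expand[of "Poly_Mapping.keys x" x] by (metis finite_keys subset_refl sum_distrib_left)
  then have "coef (y * x) 0 = (\<Sum>s\<in>Poly_Mapping.keys x. coef y (- s) * coef x s)"
    by (simp add: lookup_sum coef_mult_gelem)
  ultimately show ?thesis by (simp add: mult.commute)
qed

section \<open>Class functions as traces on the group algebra\<close>

definition class_ext :: "nat \<Rightarrow> ((nat \<Rightarrow> nat) \<Rightarrow> complex) \<Rightarrow> ga \<Rightarrow> complex" where
  "class_ext r f x = (\<Sum>s\<in>sym_perms r. of_real (coef x s) * f (ap s))"

lemma class_ext_add: "class_ext r f (x + y) = class_ext r f x + class_ext r f y"
  by (simp add: class_ext_def lookup_add sum.distrib distrib_right)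

lemma class_ext_zero: "class_ext r f 0 = 0"
  by (simp add: class_ext_def)

lemma class_ext_diff: "class_ext r f (x - y) = class_ext r f x - class_ext r f y"
  by (simp add: class_ext_def lookup_minus sum_subtractf left_diff_distrib)

lemma class_ext_scalar: "class_ext r f (scalar c * x) = of_real c * class_ext r f x"
  by (simp add: class_ext_def sum_distrib_left mult.assoc)

lemma class_ext_sum: "class_ext r f (sum g I) = (\<Sum>i\<in>I. class_ext r f (g i))"
  by (induction I rule: infinite_finite_induct) (simp_all add: class_ext_add class_ext_zero)

lemma class_ext_cong: "(\<And>\<sigma>. \<sigma> \<in> perms r \<Longrightarrow> f \<sigma> = g \<sigma>) \<Longrightarrow> class_ext r f x = class_ext r g x"
  by (auto simp: class_ext_def sym_perms_def intro!: sum.cong)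

lemma class_ext_mono:
  assumes "supported r x"
  shows "class_ext (Suc r) f x = class_ext r f x"
  unfolding class_ext_def by (rule sum.mono_neutral_right) (use assms sym_perms_Suc in \<open>auto simp: supported_coef\<close>)

lemma class_ext_mult_gelem:
  assumes "supported r x" "s \<in> sym_perms r"
  shows "class_ext r f (x * gelem s 1) = class_ext r (\<lambda>\<sigma>. f (\<sigma> \<circ> ap s)) x"
  unfolding class_ext_def
  by (rule sum.reindex_bij_witness[where i = "\<lambda>t. t + s" and j = "\<lambda>t. t - s"])
    (use assms sym_perms_plus sym_perms_uminus in \<open>auto simp: coef_mult_gelem ap_plus[symmetric] diff_conv_add_uminus add.assoc simp del: add_uminus_conv_diff\<close>)

section \<open>Jucys--Murphy elements and the sum of all transpositions\<close>

definition transp_elem :: "nat \<Rightarrow> nat \<Rightarrow> sperm" where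
  "transp_elem i j = Sp (transpose i j)"

lemma ap_transp_elem: "1 \<le> i \<Longrightarrow> 1 \<le> j \<Longrightarrow> ap (transp_elem i j) = transpose i j"
  unfolding transp_elem_def by (rule ap_Sp[of _ "max i j"]) (auto intro: perms_transpose)

lemma transp_elem_sym_perms: "i \<in> {1..r} \<Longrightarrow> j \<in> {1..r} \<Longrightarrow> transp_elem i j \<in> sym_perms r"
  by (simp add: sym_perms_def ap_transp_elem) (simp add: perms_transpose)

lemma transp_elem_sym: "transp_elem i j = transp_elem j i"
  by (simp add: transp_elem_def transpose_commute)

definition jm_elem :: "nat \<Rightarrow> ga" where
  "jm_elem k = (\<Sum>i\<in>{1..<k}. gelem (transp_elem i k) 1)"

text \<open>Ordered pairs count every transposition twice; this explains the doubled Jucys--Murphy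
  element in \<open>all_transps_Suc\<close> and the factors 2 in the eigenvalues.\<close>

definition all_transps :: "nat \<Rightarrow> ga" where
  "all_transps r = (\<Sum>(i,j)\<in>offdiag {1..r}. gelem (transp_elem i j) 1)"

lemma supported_jm_elem: "k \<le> r \<Longrightarrow> supported r (jm_elem k)"
  unfolding jm_elem_def by (intro supported_sum supported_gelem transp_elem_sym_perms) auto

lemma supported_all_transps: "supported r (all_transps r)"
  unfolding all_transps_def by (intro supported_sum) (auto simp: offdiag_def intro!: supported_gelem transp_elem_sym_perms)

lemma all_transps_Suc: "all_transps (Suc r) = all_transps r + (jm_elem (Suc r) + jm_elem (Suc r))"
proof -
  have o: "offdiag {1..Suc r} = offdiag {1..r} \<union> ((\<lambda>i. (i, Suc r)) ` {1..<Suc r} \<union> (\<lambda>i. (Suc r, i)) ` {1..<Suc r})"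
    by (auto simp: offdiag_def le_Suc_eq)
  have "all_transps (Suc r) = all_transps r + (\<Sum>(i,j)\<in>((\<lambda>i. (i, Suc r)) ` {1..<Suc r} \<union> (\<lambda>i. (Suc r, i)) ` {1..<Suc r}). gelem (transp_elem i j) 1)"
    unfolding all_transps_def o by (rule sum.union_disjoint, simp, simp, auto simp: offdiag_def)
  also have "(\<Sum>(i,j)\<in>((\<lambda>i. (i, Suc r)) ` {1..<Suc r} \<union> (\<lambda>i. (Suc r, i)) ` {1..<Suc r}). gelem (transp_elem i j) 1) = jm_elem (Suc r) + jm_elem (Suc r)"
    by (subst sum.union_disjoint, simp, simp, force)
      (simp add: sum.reindex inj_on_def jm_elem_def transp_elem_sym[of "Suc r"])
  finally show ?thesis .
qed

lemma star_jm_elem: "star (jm_elem k) = jm_elem k"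
proof -
  have "- transp_elem i k = transp_elem i k" if "i \<in> {1..<k}" for i
    using that by (auto simp: ap_inject[symmetric] ap_uminus ap_transp_elem)
  then show ?thesis by (auto simp: jm_elem_def star_sum star_gelem intro: sum.cong)
qed

text \<open>Conjugation permutes the transpositions.\<close>

lemma all_transps_commute_gelem:
  assumes "s \<in> sym_perms r"
  shows "gelem s c * all_transps r = all_transps r * gelem s c"
proof -
  have p: "ap s permutes {1..r}" using assms by (simp add: sym_perms_def perms_iff)
  have inr: "ap s i \<in> {1..r} \<longleftrightarrow> i \<in> {1..r}" "inv (ap s) i \<in> {1..r} \<longleftrightarrow> i \<in> {1..r}" for i
    by (rule permutes_in_image[OF p], rule permutes_in_image[OF permutes_inv[OF p]])
  have eq: "ap s i = ap s j \<longleftrightarrow> i = j" "inv (ap s) i = inv (ap s) j \<longleftrightarrow> i = j" for i j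
    by (rule inj_eq[OF permutes_inj[OF p]], rule inj_eq[OF permutes_inj[OF permutes_inv[OF p]]])
  have conj: "s + transp_elem i j = transp_elem (ap s i) (ap s j) + s" if "i \<in> {1..r}" "j \<in> {1..r}" for i j
  proof -
    have "ap s i \<in> {1..r}" "ap s j \<in> {1..r}" using that inr by blast+
    then have "ap (transp_elem (ap s i) (ap s j)) = transpose (ap s i) (ap s j)" "ap (transp_elem i j) = transpose i j"
      using that by (auto intro: ap_transp_elem)
    then have "ap (s + transp_elem i j) = ap (transp_elem (ap s i) (ap s j) + s)"
      using transpose_comp_eq[OF permutes_bij[OF p], of "ap s i" "ap s j"]
      by (simp add: ap_plus permutes_inverses[OF p])
    then show ?thesis by (simp only: ap_inject)
  qed
  have "gelem s c * all_transps r = (\<Sum>(i,j)\<in>offdiag {1..r}. gelem (s + transp_elem i j) c)"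
    by (simp add: all_transps_def sum_distrib_left case_prod_unfold mult_single)
  also have "\<dots> = (\<Sum>(i,j)\<in>offdiag {1..r}. gelem (transp_elem (ap s i) (ap s j) + s) c)"
    by (rule sum.cong) (auto simp: offdiag_def conj)
  also have "\<dots> = (\<Sum>(i,j)\<in>offdiag {1..r}. gelem (transp_elem i j + s) c)"
    by (rule sum.reindex_bij_witness[where i = "\<lambda>(i,j). (inv (ap s) i, inv (ap s) j)" and j = "\<lambda>(i,j). (ap s i, ap s j)"])
      (auto simp: offdiag_def inr eq permutes_inverses[OF p] simp del: atLeastAtMost_iff One_nat_def)
  also have "\<dots> = all_transps r * gelem s c"
    by (simp add: all_transps_def sum_distrib_right case_prod_unfold mult_single)
  finally show ?thesis .
qed

lemma all_transps_commute:
  assumes "supported r x"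
  shows "x * all_transps r = all_transps r * x"
proof -
  have "x * all_transps r = (\<Sum>s\<in>sym_perms r. gelem s (coef x s) * all_transps r)"
    using arg_cong[OF supported_expand[OF assms], of "\<lambda>z. z * all_transps r"] unfolding sum_distrib_right .
  also have "\<dots> = (\<Sum>s\<in>sym_perms r. all_transps r * gelem s (coef x s))"
    by (rule sum.cong) (simp_all add: all_transps_commute_gelem)
  also have "\<dots> = all_transps r * x"
    using arg_cong[OF supported_expand[OF assms], of "\<lambda>z. all_transps r * z"] unfolding sum_distrib_left by (rule sym)
  finally show ?thesis .
qed

lemma double_cancel: "x + x = y + y \<Longrightarrow> x = (y :: ga)"
  by (rule poly_mapping_eqI) (metis lookup_add mult_2 mult_cancel_left zero_neq_numeral)

text \<open>Twice the Jucys--Murphy element is the difference of the sums of transpositions at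
  levels \<open>Suc r\<close> and \<open>r\<close>, and both commute with the smaller
  algebra.\<close>

lemma jm_elem_commute:
  assumes "supported r x"
  shows "x * jm_elem (Suc r) = jm_elem (Suc r) * x"
proof (rule double_cancel)
  have "x * all_transps (Suc r) = all_transps (Suc r) * x" by (rule all_transps_commute[OF supported_Suc[OF assms]])
  then show "x * jm_elem (Suc r) + x * jm_elem (Suc r) = jm_elem (Suc r) * x + jm_elem (Suc r) * x"
    using all_transps_commute[OF assms] by (simp add: all_transps_Suc distrib_left distrib_right)
qed

text \<open>Multiplication by \<open>all_transps\<close> moved to the side of the function, so that
  the induction on the factors of \<open>lin_prod\<close> can use its hypothesis for
  \<open>casimir r f\<close> in place of \<open>f\<close>.\<close>

definition casimir :: "nat \<Rightarrow> ((nat \<Rightarrow> nat) \<Rightarrow> complex) \<Rightarrow> (nat \<Rightarrow> nat) \<Rightarrow> complex" where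
  "casimir r f \<sigma> = (\<Sum>(x,y)\<in>offdiag {1..r}. f (\<sigma> \<circ> transpose x y))"

lemma class_ext_casimir:
  assumes "supported r x"
  shows "class_ext r (casimir r f) x = class_ext r f (x * all_transps r)"
proof -
  have "class_ext r f (x * all_transps r) = (\<Sum>(i,j)\<in>offdiag {1..r}. class_ext r f (x * gelem (transp_elem i j) 1))"
    by (simp add: all_transps_def sum_distrib_left class_ext_sum case_prod_unfold)
  also have "\<dots> = (\<Sum>(i,j)\<in>offdiag {1..r}. class_ext r (\<lambda>\<sigma>. f (\<sigma> \<circ> transpose i j)) x)"
    by (rule sum.cong) (use assms in \<open>auto simp: offdiag_def class_ext_mult_gelem transp_elem_sym_perms ap_transp_elem simp del: comp_apply\<close>)
  also have "\<dots> = class_ext r (casimir r f) x"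
    unfolding class_ext_def casimir_def sum_distrib_left case_prod_unfold by (rule sum.swap)
  finally show ?thesis by simp
qed

lemma classfn_class_ext_commute:
  assumes "classfn r f" "supported r x" "supported r y"
  shows "class_ext r f (x * y) = class_ext r f (y * x)"
proof -
  have 1: "class_ext r f (gelem s c * gelem t d) = class_ext r f (gelem t d * gelem s c)" if "s \<in> sym_perms r" "t \<in> sym_perms r" for s t c d
  proof -
    have e: "class_ext r f (gelem u e) = of_real e * f (ap u)" if "u \<in> sym_perms r" for u e
    proof -
      have "class_ext r f (gelem u e) = (\<Sum>s\<in>sym_perms r. if s = u then of_real e * f (ap u) else 0)"
        unfolding class_ext_def by (rule sum.cong) (auto simp: lookup_single when_def)
      then show ?thesis using that by simp
    qed
    show ?thesis using that classfn_commute[OF assms(1), of "ap s" "ap t"]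
      by (simp add: mult_single e sym_perms_plus ap_plus sym_perms_def perms_comp mult.commute)
  qed
  have "x * y = (\<Sum>s\<in>sym_perms r. \<Sum>t\<in>sym_perms r. gelem s (coef x s) * gelem t (coef y t))"
    using arg_cong2[OF supported_expand[OF assms(2)] supported_expand[OF assms(3)], of "(*)"] unfolding sum_product .
  moreover have "y * x = (\<Sum>t\<in>sym_perms r. \<Sum>s\<in>sym_perms r. gelem t (coef y t) * gelem s (coef x s))"
    using arg_cong2[OF supported_expand[OF assms(3)] supported_expand[OF assms(2)], of "(*)"] unfolding sum_product .
  ultimately have "class_ext r f (x * y) = (\<Sum>s\<in>sym_perms r. \<Sum>t\<in>sym_perms r. class_ext r f (gelem s (coef x s) * gelem t (coef y t)))"
    and y: "class_ext r f (y * x) = (\<Sum>t\<in>sym_perms r. \<Sum>s\<in>sym_perms r. class_ext r f (gelem t (coef y t) * gelem s (coef x s)))"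
    by (simp_all only: class_ext_sum)
  note this(1)
  also have "(\<Sum>s\<in>sym_perms r. \<Sum>t\<in>sym_perms r. class_ext r f (gelem s (coef x s) * gelem t (coef y t))) =
      (\<Sum>s\<in>sym_perms r. \<Sum>t\<in>sym_perms r. class_ext r f (gelem t (coef y t) * gelem s (coef x s)))"
    by (intro sum.cong refl 1)
  also have "\<dots> = class_ext r f (y * x)" unfolding y by (rule sum.swap)
  finally show ?thesis .
qed

text \<open>Centrality of \<open>all_transps\<close> combined with the trace property of
  \<open>f\<close>.\<close>

lemma classfn_casimir:
  assumes "classfn r f"
  shows "classfn r (casimir r f)"
  unfolding classfn_def
proof (intro ballI)
  fix \<sigma> \<tau> assume st: "\<sigma> \<in> perms r" "\<tau> \<in> perms r"
  have e: "casimir r f \<rho> = class_ext r f (gelem (Sp \<rho>) 1 * all_transps r)" if "\<rho> \<in> perms r" for \<rho>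
  proof -
    have "class_ext r (casimir r f) (gelem (Sp \<rho>) 1) = (\<Sum>s\<in>sym_perms r. if s = Sp \<rho> then casimir r f \<rho> else 0)"
      unfolding class_ext_def by (rule sum.cong) (use that in \<open>auto simp: lookup_single when_def ap_Sp\<close>)
    moreover have "Sp \<rho> \<in> sym_perms r" using that by (simp add: sym_perms_def ap_Sp)
    ultimately have "class_ext r (casimir r f) (gelem (Sp \<rho>) 1) = casimir r f \<rho>" by simp
    then show ?thesis using class_ext_casimir[of r "gelem (Sp \<rho>) 1" f] that by (simp add: supported_gelem sym_perms_def ap_Sp)
  qed
  have S: "Sp \<sigma> \<in> sym_perms r" "Sp \<tau> \<in> sym_perms r" using st by (simp_all add: sym_perms_def ap_Sp)
  have c: "\<tau> \<circ> \<sigma> \<circ> inv \<tau> \<in> perms r" using st by (intro perms_comp perms_inv)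
  have "Sp (\<tau> \<circ> \<sigma> \<circ> inv \<tau>) = Sp \<tau> + Sp \<sigma> + - Sp \<tau>"
    using st c by (simp add: ap_inject[symmetric] ap_plus ap_uminus ap_Sp del: add_uminus_conv_diff)
  then have "gelem (Sp (\<tau> \<circ> \<sigma> \<circ> inv \<tau>)) 1 * all_transps r = gelem (Sp \<tau>) 1 * (gelem (Sp \<sigma>) 1 * (gelem (- Sp \<tau>) 1 * all_transps r))"
    by (simp only: mult_single mult.assoc[symmetric] mult_1_left add.assoc)
  also have "\<dots> = gelem (Sp \<tau>) 1 * (gelem (Sp \<sigma>) 1 * all_transps r * gelem (- Sp \<tau>) 1)"
    using all_transps_commute_gelem[OF sym_perms_uminus[OF S(2)], of 1] by (simp add: mult.assoc)
  finally have "casimir r f (\<tau> \<circ> \<sigma> \<circ> inv \<tau>) = class_ext r f (gelem (Sp \<tau>) 1 * (gelem (Sp \<sigma>) 1 * all_transps r * gelem (- Sp \<tau>) 1))"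
    using e[OF c] by simp
  also have "\<dots> = class_ext r f (gelem (Sp \<sigma>) 1 * all_transps r * gelem (- Sp \<tau>) 1 * gelem (Sp \<tau>) 1)"
    by (rule classfn_class_ext_commute[OF assms]) (use S in \<open>auto intro!: supported_mult supported_gelem supported_all_transps sym_perms_uminus\<close>)
  also have "\<dots> = casimir r f \<sigma>"
    using e[OF st(1)] by (simp add: mult.assoc mult_single)
  finally show "casimir r f (\<tau> \<circ> \<sigma> \<circ> inv \<tau>) = casimir r f \<sigma>" .
qed

text \<open>Transpositions are involutions, so \<open>casimir\<close> is self-adjoint and can be
  moved over to \<open>alt_char\<close>, which is an eigenfunction.\<close>

lemma alt_trace_casimir: "alt_trace r N a (casimir r f) = of_int (casimir_eigenvalue N a) * alt_trace r N a f"
proof -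
  have "(\<Sum>\<sigma>\<in>perms r. of_int (alt_char r N a \<sigma>) * casimir r f \<sigma>) =
     (\<Sum>(x,y)\<in>offdiag {1..r}. \<Sum>\<sigma>\<in>perms r. of_int (alt_char r N a \<sigma>) * f (\<sigma> \<circ> transpose x y))"
    unfolding casimir_def sum_distrib_left case_prod_unfold by (rule sum.swap)
  also have "\<dots> = (\<Sum>(x,y)\<in>offdiag {1..r}. \<Sum>\<sigma>\<in>perms r. of_int (alt_char r N a (\<sigma> \<circ> transpose x y)) * f \<sigma>)"
  proof (rule sum.cong[OF refl], clarify)
    fix x y assume "(x,y) \<in> offdiag {1..r}"
    then have t: "transpose x y \<in> perms r" by (auto simp: offdiag_def intro!: perms_transpose)
    show "(\<Sum>\<sigma>\<in>perms r. of_int (alt_char r N a \<sigma>) * f (\<sigma> \<circ> transpose x y)) =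
        (\<Sum>\<sigma>\<in>perms r. of_int (alt_char r N a (\<sigma> \<circ> transpose x y)) * f \<sigma>)"
      by (rule sum.reindex_bij_witness[where i = "\<lambda>\<sigma>. \<sigma> \<circ> transpose x y" and j = "\<lambda>\<sigma>. \<sigma> \<circ> transpose x y"])
        (use t in \<open>auto simp: comp_assoc perms_comp\<close>)
  qed
  also have "\<dots> = (\<Sum>\<sigma>\<in>perms r. of_int (\<Sum>(x,y)\<in>offdiag {1..r}. alt_char r N a (\<sigma> \<circ> transpose x y)) * f \<sigma>)"
    unfolding of_int_sum sum_distrib_right case_prod_unfold by (rule sum.swap)
  also have "\<dots> = of_int (casimir_eigenvalue N a) * (\<Sum>\<sigma>\<in>perms r. of_int (alt_char r N a \<sigma>) * f \<sigma>)"
    unfolding sum_distrib_left by (rule sum.cong) (simp_all only: alt_char_casimir of_int_mult mult.assoc)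
  finally show ?thesis by (simp add: alt_trace_def)
qed

lemma casimir_alt_char: "\<sigma> \<in> perms r \<Longrightarrow> casimir r (\<lambda>\<sigma>. of_int (alt_char r N a \<sigma>)) \<sigma> = of_int (casimir_eigenvalue N a) * of_int (alt_char r N a \<sigma>)"
  using alt_char_casimir[of \<sigma> r N a] unfolding casimir_def by (simp add: case_prod_unfold flip: of_int_sum of_int_mult)

section \<open>Seminormal idempotents\<close>

definition lin_prod :: "ga \<Rightarrow> real list \<Rightarrow> ga" where
  "lin_prod y cs = prod_list (map (\<lambda>c. y - scalar c) cs)"

lemma lin_prod_Nil [simp]: "lin_prod y [] = 1"
  and lin_prod_Cons [simp]: "lin_prod y (c # cs) = (y - scalar c) * lin_prod y cs"
  and lin_prod_append: "lin_prod y (cs @ ds) = lin_prod y cs * lin_prod y ds"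
  by (simp_all add: lin_prod_def)

lemma lin_prod_commute:
  assumes "x * y = y * x"
  shows "x * lin_prod y cs = lin_prod y cs * x"
proof (induction cs)
  case (Cons c cs)
  have "x * (y - scalar c) = (y - scalar c) * x"
    using assms scalar_comm[of c x] by (simp add: left_diff_distrib right_diff_distrib)
  then show ?case using Cons by (simp add: mult.assoc[symmetric]) (simp add: mult.assoc)
qed simp

lemma lin_prod_commute_factor: "(y - scalar c) * lin_prod y cs = lin_prod y cs * (y - scalar c)"
  by (rule lin_prod_commute) (simp add: left_diff_distrib right_diff_distrib scalar_comm)

lemma lin_prod_eigen:
  assumes "y * e = scalar c * e"
  shows "lin_prod y cs * e = scalar (\<Prod>d\<leftarrow>cs. (c - d)) * e"
proof (induction cs)
  case (Cons d cs)
  have "(y - scalar d) * e = scalar (c - d) * e"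
    using assms by (simp add: left_diff_distrib single_diff)
  note h = this
  have "lin_prod y (d # cs) * e = (y - scalar d) * (lin_prod y cs * e)" by (simp only: lin_prod_Cons mult.assoc)
  also have "\<dots> = (y - scalar d) * (scalar (\<Prod>d\<leftarrow>cs. (c - d)) * e)" by (simp only: Cons)
  also have "\<dots> = scalar (\<Prod>d\<leftarrow>cs. (c - d)) * ((y - scalar d) * e)" by (rule scalar_left)
  also have "\<dots> = scalar ((\<Prod>d\<leftarrow>cs. (c - d)) * (c - d)) * e"
    by (simp only: h mult.assoc[symmetric] scalar_mult)
  finally show ?case by (simp add: mult.commute)
qed simp

lemma star_lin_prod:
  assumes "star y = y"
  shows "star (lin_prod y cs) = lin_prod y cs"
  by (induction cs) (use assms in \<open>simp_all add: star_mult star_diff star_gelem lin_prod_commute_factor\<close>)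

lemma supported_lin_prod: "supported r y \<Longrightarrow> supported r (lin_prod y cs)"
  by (induction cs) (auto intro!: supported_1 supported_mult supported_diff supported_scalar)

definition add_box :: "(nat \<Rightarrow> int) \<Rightarrow> nat \<Rightarrow> nat \<Rightarrow> int" where
  "add_box a i = a(i := a i + 1)"

lemma add_box_apply: "add_box a i j = (if j = i then a i + 1 else a j)"
  by (simp add: add_box_def)

lemma casimir_eigenvalue_add:
  assumes "i < N"
  shows "casimir_eigenvalue N (add_box a i) = casimir_eigenvalue N a + 2 * a i"
proof -
  have "(\<Sum>j<N. add_box a i j * (add_box a i j - 1)) = (\<Sum>j<N. a j * (a j - 1)) + 2 * a i"
    using assms by (simp add: sum.remove[of "{..<N}" i] add_box_apply algebra_simps)
  then show ?thesis by (simp add: casimir_eigenvalue_def)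
qed

lemma casimir_eigenvalue_cong: "(\<And>i. i < N \<Longrightarrow> a i = b i) \<Longrightarrow> casimir_eigenvalue N a = casimir_eigenvalue N b"
  by (simp add: casimir_eigenvalue_def)

text \<open>Rows are numbered from 0 and \<open>\<rho> k\<close> is the row of the box \<open>k\<close>.  The row end is the length of the row
  minus its index, that is, the content of the box that would extend it.\<close>
primrec row_ends :: "(nat \<Rightarrow> nat) \<Rightarrow> nat \<Rightarrow> nat \<Rightarrow> int" where
  "row_ends \<rho> 0 = (\<lambda>i. - int i)"
| "row_ends \<rho> (Suc k) = add_box (row_ends \<rho> k) (\<rho> (Suc k))"

text \<open>The row end is read just before the box is added, and is then the content of the box
  \<open>k\<close>.\<close>

definition row_content :: "(nat \<Rightarrow> nat) \<Rightarrow> nat \<Rightarrow> real" where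
  "row_content \<rho> k = real_of_int (row_ends \<rho> (k - 1) (\<rho> k))"

definition other_ends :: "nat \<Rightarrow> (nat \<Rightarrow> nat) \<Rightarrow> nat \<Rightarrow> real list" where
  "other_ends N \<rho> k = map (\<lambda>i. real_of_int (row_ends \<rho> k i)) ([0..<\<rho> (Suc k)] @ [Suc (\<rho> (Suc k))..<N])"

text \<open>Each step multiplies by the Lagrange polynomial in the next Jucys--Murphy element that
  selects the content of the added box among all row ends.\<close>
primrec seminormal_elem :: "nat \<Rightarrow> (nat \<Rightarrow> nat) \<Rightarrow> nat \<Rightarrow> ga" where
  "seminormal_elem N \<rho> 0 = 1"
| "seminormal_elem N \<rho> (Suc k) = scalar (1 / (\<Prod>d\<leftarrow>other_ends N \<rho> k. (row_content \<rho> (Suc k) - d))) * (lin_prod (jm_elem (Suc k)) (other_ends N \<rho> k) * seminormal_elem N \<rho> k)"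

text \<open>For row ends this is the weak decrease of the parts, as the index is subtracted.
  Distinctness keeps the Lagrange denominators nonzero.\<close>

definition strict_decr :: "nat \<Rightarrow> (nat \<Rightarrow> int) \<Rightarrow> bool" where
  "strict_decr N a \<longleftrightarrow> (\<forall>i j. i < j \<longrightarrow> j < N \<longrightarrow> a j < a i)"

lemma casimir_eigenvalue_row_ends:
  assumes "\<forall>j\<in>{1..k}. \<rho> j < N"
  shows "real_of_int (casimir_eigenvalue N (row_ends \<rho> k)) = (\<Sum>j\<in>{1..k}. 2 * row_content \<rho> j)"
  using assms
proof (induction k)
  case 0
  show ?case by (simp add: casimir_eigenvalue_def algebra_simps)
next
  case (Suc k)
  have "casimir_eigenvalue N (row_ends \<rho> (Suc k)) = casimir_eigenvalue N (row_ends \<rho> k) + 2 * row_ends \<rho> k (\<rho> (Suc k))"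
    unfolding row_ends.simps by (rule casimir_eigenvalue_add) (use Suc.prems in auto)
  moreover have "real_of_int (casimir_eigenvalue N (row_ends \<rho> k)) = (\<Sum>j\<in>{1..k}. 2 * row_content \<rho> j)"
    using Suc by auto
  ultimately show ?case by (simp del: row_ends.simps) (simp add: row_content_def)
qed

lemma all_transps_jm_elem: "all_transps k = (\<Sum>j\<in>{1..k}. jm_elem j + jm_elem j)"
  by (induction k) (simp_all add: all_transps_Suc, simp add: all_transps_def offdiag_def)

lemma all_transps_eigen:
  assumes "\<forall>j\<in>{1..k}. \<rho> j < N" "\<forall>j\<in>{1..k}. jm_elem j * e = scalar (row_content \<rho> j) * e"
  shows "all_transps k * e = scalar (real_of_int (casimir_eigenvalue N (row_ends \<rho> k))) * e"
proof -
  have "all_transps k * e = (\<Sum>j\<in>{1..k}. scalar (2 * row_content \<rho> j) * e)"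
    unfolding all_transps_jm_elem sum_distrib_right
    by (rule sum.cong) (use assms in \<open>simp_all only: distrib_right mult_2 single_add\<close>)
  also have "\<dots> = scalar (\<Sum>j\<in>{1..k}. 2 * row_content \<rho> j) * e"
  proof -
    have "(\<Sum>j\<in>S. scalar (f j)) = scalar (\<Sum>j\<in>S. f j)" for S :: "nat set" and f
      by (induction S rule: infinite_finite_induct) (simp_all add: single_add)
    then show ?thesis by (simp add: sum_distrib_right[symmetric])
  qed
  finally show ?thesis using casimir_eigenvalue_row_ends[OF assms(1)] by simp
qed

lemma classfn_Suc: "classfn (Suc k) f \<Longrightarrow> classfn k f"
  using perms_Suc by (auto simp: classfn_def)

text \<open>Of the two sums of transpositions whose difference is the doubled Jucys--Murphy element,
  the larger acts through \<open>casimir\<close>; the smaller commutes past \<open>lin_prod\<close>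
  and acts on \<open>E\<close> by the scalar \<open>e\<close>.\<close>

lemma class_ext_lin_prod_double:
  assumes E: "supported k E" and ev: "all_transps k * E = scalar e * E"
  shows "2 * class_ext (Suc k) f ((jm_elem (Suc k)) * (lin_prod (jm_elem (Suc k)) cs * E)) =
    class_ext (Suc k) (casimir (Suc k) f) (lin_prod (jm_elem (Suc k)) cs * E) - of_real e * class_ext (Suc k) f (lin_prod (jm_elem (Suc k)) cs * E)"
proof -
  let ?X = "lin_prod (jm_elem (Suc k)) cs * E"
  have X: "supported (Suc k) ?X" using E by (intro supported_mult supported_lin_prod supported_jm_elem supported_Suc) auto
  have "all_transps k * ?X = lin_prod (jm_elem (Suc k)) cs * (all_transps k * E)"
    using lin_prod_commute[OF jm_elem_commute[OF supported_all_transps], of k cs] by (simp add: mult.assoc[symmetric])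
  then have 1: "all_transps k * ?X = scalar e * ?X" by (simp only: ev scalar_left[of "lin_prod _ _"])
  have "jm_elem (Suc k) * ?X + jm_elem (Suc k) * ?X = all_transps (Suc k) * ?X - all_transps k * ?X"
    by (simp add: all_transps_Suc distrib_right)
  then have "class_ext (Suc k) f (jm_elem (Suc k) * ?X + jm_elem (Suc k) * ?X) = class_ext (Suc k) f (?X * all_transps (Suc k)) - class_ext (Suc k) f (scalar e * ?X)"
    by (simp only: class_ext_diff 1 all_transps_commute[OF X])
  then show ?thesis by (simp only: class_ext_add class_ext_casimir[OF X] class_ext_scalar mult_2)
qed

text \<open>Under class functions the next Jucys--Murphy element acts on \<open>E\<close> as if it
  were diagonal with the row ends as spectrum. Without factors this is the branching rule
  \<open>alt_trace_pieri\<close>; a further factor contributes half the difference of Casimir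
  eigenvalues, which for a box added in row \<open>i\<close> is \<open>a i\<close>.\<close>

lemma class_ext_lin_prod:
  assumes E: "supported k E" and ev: "all_transps k * E = scalar (real_of_int (casimir_eigenvalue N a)) * E"
    and transp_elem: "\<And>f. classfn k f \<Longrightarrow> class_ext k f E = alt_trace k N a f"
    and a: "0 < N" "a (N - 1) = 1 - int N"
    and f: "classfn (Suc k) f"
  shows "class_ext (Suc k) f (lin_prod (jm_elem (Suc k)) cs * E) =
    (\<Sum>i<N. of_real (\<Prod>d\<leftarrow>cs. (real_of_int (a i) - d)) * alt_trace (Suc k) N (add_box a i) f)"
  using f
proof (induction cs arbitrary: f)
  case Nil
  then have "class_ext (Suc k) f E = alt_trace k N a f" using class_ext_mono[OF E] transp_elem classfn_Suc by metis
  also have "\<dots> = (\<Sum>i<N. alt_trace (Suc k) N (add_box a i) f)"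
    unfolding add_box_def by (rule alt_trace_pieri[where a = a, OF Nil a, symmetric])
  finally show ?case by simp
next
  case (Cons c cs)
  let ?X = "lin_prod (jm_elem (Suc k)) cs * E"
  let ?P = "\<lambda>i. complex_of_real (\<Prod>d\<leftarrow>cs. (real_of_int (a i) - d))"
  let ?s = "\<lambda>i. alt_trace (Suc k) N (add_box a i) f"
  have "2 * class_ext (Suc k) f (jm_elem (Suc k) * ?X) = (\<Sum>i<N. ?P i * (of_int (casimir_eigenvalue N (add_box a i)) * ?s i)) - of_int (casimir_eigenvalue N a) * (\<Sum>i<N. ?P i * ?s i)"
    using Cons.IH[OF Cons.prems] Cons.IH[OF classfn_casimir[OF Cons.prems]]
    unfolding class_ext_lin_prod_double[OF E ev] alt_trace_casimir by simp
  also have "\<dots> = (\<Sum>i<N. 2 * (?P i * (of_int (a i) * ?s i)))"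
    unfolding sum_distrib_left sum_subtractf[symmetric]
    by (rule sum.cong) (simp_all add: casimir_eigenvalue_add distrib_right distrib_left mult_ac)
  finally have "class_ext (Suc k) f (jm_elem (Suc k) * ?X) = (\<Sum>i<N. ?P i * (of_int (a i) * ?s i))"
    by (simp add: sum_distrib_left[symmetric])
  moreover have "class_ext (Suc k) f (lin_prod (jm_elem (Suc k)) (c # cs) * E) = class_ext (Suc k) f (jm_elem (Suc k) * ?X) - of_real c * class_ext (Suc k) f ?X"
    by (simp add: left_diff_distrib mult.assoc class_ext_diff class_ext_scalar)
  ultimately show ?case using Cons.IH[OF Cons.prems]
    by (simp add: sum_distrib_left sum_subtractf[symmetric] left_diff_distrib right_diff_distrib mult_ac)
qed

lemma words_0: "words 0 {..<N} b = (if \<forall>i<N. b i = 0 then {\<lambda>_. undefined} else {})"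
  by (auto simp: words_def)

lemma perms_0: "perms 0 = {id}"
  by (auto simp: perms_def)

lemma strict_decr_perm_id:
  assumes "strict_decr N b" "p \<in> Perm N" "\<forall>i<N. b i + int (p i) = 0"
  shows "p = id"
proof (rule permutes_natset_ge[where S = "{..<N}"])
  show "p permutes {..<N}" using assms by simp
  have mono: "p i < p j" if "i < j" "j < N" for i j
  proof -
    have "b j < b i" using assms(1) that by (simp add: strict_decr_def)
    moreover have "int (p i) = - b i" "int (p j) = - b j" using assms(3) that by (smt (verit) less_trans)+
    ultimately show ?thesis by linarith
  qed
  have "i < N \<longrightarrow> i \<le> p i" for i
  proof (induction i)
    case (Suc i)
    then show ?case using mono[of i "Suc i"] by linarith
  qed simp
  then show "\<forall>z\<in>{..<N}. z \<le> p z" by auto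
qed

text \<open>With no places every entry of the content must be 0, and for strictly decreasing
  \<open>b\<close> this leaves only the identity permutation.\<close>

lemma alt_char_0:
  assumes "strict_decr N b"
  shows "alt_char 0 N b id = of_bool (\<forall>i<N. b i = - int i)"
proof -
  have "alt_char 0 N b id = (\<Sum>p\<in>Perm N. sign p * of_bool (\<forall>i<N. b i + int (p i) = 0))"
  proof -
    have "num_fixed 0 N c id = of_bool (\<forall>i<N. c i = 0)" for c by (simp add: num_fixed_def fixed_words_def words_0)
    then show ?thesis by (simp only: alt_char_def shifted_def)
  qed
  also have "\<dots> = (\<Sum>p\<in>Perm N. if p = id then of_bool (\<forall>i<N. b i = - int i) else 0)"
  proof (rule sum.cong[OF refl])
    fix p assume p: "p \<in> Perm N"
    show "sign p * of_bool (\<forall>i<N. b i + int (p i) = 0) = (if p = id then of_bool (\<forall>i<N. b i = - int i) else 0)"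
      using strict_decr_perm_id[OF assms p] by (auto simp: eq_neg_iff_add_eq_0)
  qed
  also have "\<dots> = of_bool (\<forall>i<N. b i = - int i)"
    by (simp add: permutes_id)
  finally show ?thesis .
qed

lemma class_ext_0: "class_ext 0 f 1 = f id"
proof -
  have "sym_perms 0 = {0}" by (auto simp: sym_perms_def perms_0 ap_zero ap_inject[symmetric])
  then show ?thesis by (simp add: class_ext_def ap_zero)
qed

lemma class_ext_coef0: "supported r x \<Longrightarrow> class_ext r (\<lambda>\<sigma>. of_bool (\<sigma> = id)) x = of_real (coef x 0)"
proof -
  have "class_ext r (\<lambda>\<sigma>. of_bool (\<sigma> = id)) x = (\<Sum>s\<in>sym_perms r. if s = 0 then of_real (coef x 0) else 0)"
  proof -
    have "ap s = id \<longleftrightarrow> s = 0" for s by (metis ap_zero ap_inject)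
    then show ?thesis unfolding class_ext_def by (intro sum.cong) auto
  qed
  then show ?thesis by (simp add: sym_perms_zero)
qed

lemma classfn_id: "classfn r (\<lambda>\<sigma>. of_bool (\<sigma> = id) :: complex)"
  unfolding classfn_def
proof (intro ballI)
  fix \<sigma> \<tau> assume "\<sigma> \<in> perms r" "\<tau> \<in> perms r"
  have "\<sigma> = id" if "\<tau> \<circ> \<sigma> \<circ> inv \<tau> = id"
  proof -
    have "\<sigma> = inv \<tau> \<circ> (\<tau> \<circ> \<sigma> \<circ> inv \<tau>) \<circ> \<tau>"
      using perms_inv_o[OF \<open>\<tau> \<in> perms r\<close>] by (simp add: comp_assoc) (simp add: comp_assoc[symmetric])
    then show ?thesis using that perms_inv_o[OF \<open>\<tau> \<in> perms r\<close>] by simp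
  qed
  then show "of_bool (\<tau> \<circ> \<sigma> \<circ> inv \<tau> = id) = (of_bool (\<sigma> = id) :: complex)"
    using perms_inv_o[OF \<open>\<tau> \<in> perms r\<close>] by auto
qed

text \<open>For self-adjoint \<open>q\<close> the coefficient of the identity in
  \<open>q * q\<close> is the sum of the squares of all coefficients.\<close>

lemma selfadjoint_square_0:
  assumes "supported r q" "star q = q" "coef (q * q) 0 = 0"
  shows "q = 0"
proof (rule poly_mapping_eqI)
  fix s
  have "(\<Sum>s\<in>sym_perms r. coef q s * coef q s) = 0"
    using coef_mult_star[OF assms(1), of q] assms by simp
  then have "\<forall>s\<in>sym_perms r. coef q s * coef q s = 0"
    by (subst (asm) sum_nonneg_eq_0_iff) auto
  then show "coef q s = coef 0 s" using assms(1) by (cases "s \<in> sym_perms r") (auto simp: supported_coef)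
qed

lemma prod_list_map_eq_0: "c \<in> set cs \<Longrightarrow> (\<Prod>d\<leftarrow>cs. (c - d :: real)) = 0"
  by (auto simp: prod_list_zero_iff)

text \<open>The last of the \<open>N\<close> rows is still empty before every step; this is the
  hypothesis of \<open>alt_trace_pieri\<close>.\<close>

locale tableau =
  fixes N :: nat and \<rho> :: "nat \<Rightarrow> nat" and r :: nat
  assumes N_pos: "0 < N"
    and rho_less: "k < r \<Longrightarrow> \<rho> (Suc k) < N"
    and row_ends_strict_decr: "k \<le> r \<Longrightarrow> strict_decr N (row_ends \<rho> k)"
    and row_ends_last: "k < r \<Longrightarrow> row_ends \<rho> k (N - 1) = 1 - int N"
begin

abbreviation a where "a \<equiv> row_ends \<rho>"
abbreviation E where "E \<equiv> seminormal_elem N \<rho>"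

lemma a_inj: "k \<le> r \<Longrightarrow> i < N \<Longrightarrow> j < N \<Longrightarrow> a k i = a k j \<longleftrightarrow> i = j"
  using row_ends_strict_decr[of k] unfolding strict_decr_def by (metis less_irrefl linorder_neqE_nat)

lemma rho_less': "j \<in> {1..k} \<Longrightarrow> k \<le> r \<Longrightarrow> \<rho> j < N"
  using rho_less[of "j - 1"] by auto

lemma other_ends_set: "k < r \<Longrightarrow> set (other_ends N \<rho> k) = (\<lambda>i. real_of_int (a k i)) ` ({..<N} - {\<rho> (Suc k)})"
  using rho_less[of k] by (force simp: other_ends_def)

lemma other_ends_prod:
  assumes "k < r" "i < N" "i \<noteq> \<rho> (Suc k)"
  shows "(\<Prod>d\<leftarrow>other_ends N \<rho> k. (real_of_int (a k i) - d)) = 0"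
  by (rule prod_list_map_eq_0) (use assms in \<open>auto simp: other_ends_set\<close>)

lemma other_ends_denom:
  assumes "k < r"
  shows "(\<Prod>d\<leftarrow>other_ends N \<rho> k. (row_content \<rho> (Suc k) - d)) \<noteq> 0"
  using a_inj[of k "\<rho> (Suc k)"] rho_less[OF assms] assms
  by (auto simp: prod_list_zero_iff row_content_def other_ends_set)

lemma lin_prod_all:
  assumes "k < r"
  shows "(y - scalar (row_content \<rho> (Suc k))) * lin_prod y (other_ends N \<rho> k) = lin_prod y (map (\<lambda>i. real_of_int (a k i)) [0..<N])"
proof -
  let ?m = "\<rho> (Suc k)" and ?f = "\<lambda>i. real_of_int (a k i)"
  have "[0..<N] = [0..<?m] @ ?m # [Suc ?m..<N]"
    using rho_less[OF assms] upt_add_eq_append[of 0 ?m "N - ?m"] upt_conv_Cons[of ?m N] by simp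
  then have "lin_prod y (map ?f [0..<N]) = lin_prod y (map ?f [0..<?m]) * (y - scalar (?f ?m)) * lin_prod y (map ?f [Suc ?m..<N])"
    by (simp add: lin_prod_append mult.assoc)
  also have "\<dots> = (y - scalar (?f ?m)) * lin_prod y (map ?f [0..<?m]) * lin_prod y (map ?f [Suc ?m..<N])"
    by (simp only: lin_prod_commute_factor)
  finally show ?thesis by (simp add: other_ends_def lin_prod_append row_content_def mult.assoc)
qed

text \<open>Carried together: the annihilation that yields the next eigenvalue needs the trace
  formula at this level, and the next trace formula needs the eigenvalues at this level.\<close>

definition invariant :: "nat \<Rightarrow> bool" where
  "invariant k \<longleftrightarrow> supported k (E k) \<and> star (E k) = E k \<and> E k * E k = E k \<and>
    (\<forall>j\<in>{1..k}. jm_elem j * E k = scalar (row_content \<rho> j) * E k) \<and>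
    (\<forall>f. classfn k f \<longrightarrow> class_ext k f (E k) = alt_trace k N (a k) f)"

lemma invariant_0: "invariant 0"
proof -
  have "alt_char 0 N (a 0) id = 1"
    using row_ends_strict_decr[of 0] by (subst alt_char_0) auto
  then show ?thesis
    by (simp add: invariant_def supported_1 class_ext_0 alt_trace_def perms_0)
qed

lemma invariant_all_transps:
  assumes "invariant k" "k \<le> r"
  shows "all_transps k * E k = scalar (real_of_int (casimir_eigenvalue N (a k))) * E k"
  by (rule all_transps_eigen) (use assms rho_less' in \<open>auto simp: invariant_def\<close>)

lemma invariant_class_ext_lin_prod:
  assumes "invariant k" "k < r" "classfn (Suc k) f"
  shows "class_ext (Suc k) f (lin_prod (jm_elem (Suc k)) cs * E k) =
    (\<Sum>i<N. of_real (\<Prod>d\<leftarrow>cs. (real_of_int (a k i) - d)) * alt_trace (Suc k) N (add_box (a k) i) f)"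
  by (rule class_ext_lin_prod) (use assms N_pos row_ends_last invariant_all_transps in \<open>auto simp: invariant_def\<close>)

text \<open>The product over all row ends annihilates, because the trace formula kills its square.\<close>
lemma lin_prod_all_0:
  assumes "invariant k" "k < r"
  shows "lin_prod (jm_elem (Suc k)) (map (\<lambda>i. real_of_int (a k i)) [0..<N]) * E k = 0"
proof (rule selfadjoint_square_0)
  let ?l = "map (\<lambda>i. real_of_int (a k i)) [0..<N]" and ?y = "jm_elem (Suc k)"
  have EA: "supported k (E k)" "star (E k) = E k" "E k * E k = E k" using assms by (auto simp: invariant_def)
  have com: "E k * lin_prod ?y cs = lin_prod ?y cs * E k" for cs by (rule lin_prod_commute[OF jm_elem_commute[OF EA(1)]])
  show "supported (Suc k) (lin_prod ?y ?l * E k)" using EA by (intro supported_mult supported_lin_prod supported_jm_elem supported_Suc) auto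
  show "star (lin_prod ?y ?l * E k) = lin_prod ?y ?l * E k"
    by (simp add: star_mult EA star_lin_prod star_jm_elem com)
  have "lin_prod ?y ?l * E k * (lin_prod ?y ?l * E k) = lin_prod ?y ?l * (E k * lin_prod ?y ?l) * E k"
    by (simp only: mult.assoc)
  also have "\<dots> = lin_prod ?y (?l @ ?l) * E k"
    by (simp add: com lin_prod_append mult.assoc EA)
  finally have sq: "lin_prod ?y ?l * E k * (lin_prod ?y ?l * E k) = lin_prod ?y (?l @ ?l) * E k" .
  have A: "supported (Suc k) (lin_prod ?y (?l @ ?l) * E k)" using EA by (intro supported_mult supported_lin_prod supported_jm_elem supported_Suc) auto
  have "(\<Prod>d\<leftarrow>?l @ ?l. (real_of_int (a k i) - d)) = 0" if "i < N" for i
    by (rule prod_list_map_eq_0) (use that in auto)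
  then have "complex_of_real (coef (lin_prod ?y (?l @ ?l) * E k) 0) = 0"
    using invariant_class_ext_lin_prod[OF assms classfn_id, of "?l @ ?l"] class_ext_coef0[OF A] by simp
  then show "coef (lin_prod ?y ?l * E k * (lin_prod ?y ?l * E k)) 0 = 0" by (simp add: sq)
qed

lemma invariant_Suc:
  assumes inv: "invariant k" and k: "k < r"
  shows "invariant (Suc k)"
proof -
  let ?y = "jm_elem (Suc k)" and ?c = "row_content \<rho> (Suc k)" and ?ns = "other_ends N \<rho> k"
  define D where "D = (\<Prod>d\<leftarrow>?ns. (?c - d))"
  have D: "D \<noteq> 0" using other_ends_denom[OF k] by (simp add: D_def)
  define L where "L = lin_prod ?y ?ns"
  have E': "E (Suc k) = scalar (1 / D) * (L * E k)" by (simp add: D_def L_def)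
  have EA: "supported k (E k)" "star (E k) = E k" "E k * E k = E k" using inv by (auto simp: invariant_def)
  have com: "x * L = L * x" if "supported k x" for x
    unfolding L_def by (rule lin_prod_commute[OF jm_elem_commute[OF that]])
  have A: "supported (Suc k) (E (Suc k))"
    unfolding E' L_def using EA by (intro supported_mult supported_lin_prod supported_jm_elem supported_Suc supported_scalar) auto
  have ev: "?y * E (Suc k) = scalar ?c * E (Suc k)"
  proof -
    have "(?y - scalar ?c) * (L * E k) = 0"
      using lin_prod_all_0[OF inv k] lin_prod_all[OF k, of ?y] by (simp add: L_def mult.assoc[symmetric])
    then have "?y * (L * E k) = scalar ?c * (L * E k)" by (simp add: left_diff_distrib)
    then have "?y * E (Suc k) = scalar (1 / D) * (scalar ?c * (L * E k))"
      unfolding E' scalar_left[of ?y] by simp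
    also have "\<dots> = scalar ?c * E (Suc k)" unfolding E' by (rule scalar_left)
    finally show ?thesis .
  qed
  have ev': "jm_elem j * E (Suc k) = scalar (row_content \<rho> j) * E (Suc k)" if "j \<in> {1..k}" for j
  proof -
    have "jm_elem j * (L * E k) = L * (jm_elem j * E k)"
      using com[OF supported_jm_elem, of j] that by (simp add: mult.assoc[symmetric])
    also have "\<dots> = scalar (row_content \<rho> j) * (L * E k)" using inv that by (simp add: invariant_def scalar_left[of L])
    finally have "jm_elem j * E (Suc k) = scalar (1 / D) * (scalar (row_content \<rho> j) * (L * E k))"
      unfolding E' scalar_left[of "jm_elem j"] by simp
    also have "\<dots> = scalar (row_content \<rho> j) * E (Suc k)" unfolding E' by (rule scalar_left)
    finally show ?thesis .
  qed
  have st: "star (E (Suc k)) = E (Suc k)"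
  proof -
    have "star L = L" unfolding L_def by (rule star_lin_prod[OF star_jm_elem])
    then have "star (E (Suc k)) = E k * L * scalar (1 / D)"
      unfolding E' by (simp add: star_mult star_gelem EA)
    then show ?thesis unfolding E' by (simp only: com[OF EA(1)] scalar_comm)
  qed
  have EE: "E k * E (Suc k) = E (Suc k)"
  proof -
    have "E k * (L * E k) = L * (E k * E k)" using com[OF EA(1)] by (simp add: mult.assoc[symmetric])
    then show ?thesis unfolding E' by (simp add: scalar_left[of "E k"] EA)
  qed
  have "E (Suc k) * E (Suc k) = scalar (1 / D) * (L * (E k * E (Suc k)))"
    by (subst E') (simp add: mult.assoc)
  \<comment> \<open>\<open>E (Suc k)\<close> is already known to be an eigenvector of
    \<open>?y\<close> for the content \<open>?c\<close>, where the unnormalised Lagrange polynomial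
    takes the value \<open>D\<close>.\<close>
  also have "\<dots> = scalar (1 / D) * (scalar D * E (Suc k))"
    unfolding EE using lin_prod_eigen[OF ev, of ?ns] by (simp add: L_def D_def)
  also have "\<dots> = E (Suc k)" using D by (simp add: mult.assoc[symmetric] scalar_mult)
  finally have id: "E (Suc k) * E (Suc k) = E (Suc k)" .
  have transp_elem: "class_ext (Suc k) f (E (Suc k)) = alt_trace (Suc k) N (a (Suc k)) f" if f: "classfn (Suc k) f" for f
  proof -
    let ?m = "\<rho> (Suc k)"
    \<comment> \<open>The Lagrange polynomial vanishes at every row end except that of the row
      receiving the box.\<close>
    have "class_ext (Suc k) f (L * E k) = (\<Sum>i<N. if i = ?m then of_real D * alt_trace (Suc k) N (add_box (a k) i) f else 0)"
      unfolding L_def invariant_class_ext_lin_prod[OF inv k f]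
      by (rule sum.cong) (use other_ends_prod[OF k] in \<open>auto simp: D_def row_content_def\<close>)
    also have "\<dots> = of_real D * alt_trace (Suc k) N (a (Suc k)) f" using rho_less[OF k] by simp
    finally show ?thesis unfolding E' class_ext_scalar using D by simp
  qed
  show ?thesis unfolding invariant_def
    using A st id ev ev' transp_elem by (auto simp: le_Suc_eq)
qed

lemma invariant: "k \<le> r \<Longrightarrow> invariant k"
  by (induction k) (auto simp: invariant_0 intro: invariant_Suc)

text \<open>By restriction and induction the value on \<open>E k\<close> is nonzero only if
  \<open>b\<close> arises from \<open>a k\<close> by adding one box. As \<open>alt_char\<close> is a
  Casimir eigenfunction, the next Jucys--Murphy element acts on this value by one number, at which
  the Lagrange polynomial is 0 unless the box lies in the row prescribed by
  \<open>\<rho>\<close>.\<close>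

lemma alt_char_orthogonal:
  assumes "k \<le> r" "strict_decr N b"
  shows "class_ext k (\<lambda>\<sigma>. of_int (alt_char k N b \<sigma>)) (E k) = of_bool (\<forall>i<N. b i = a k i)"
  using assms
proof (induction k arbitrary: b)
  case 0
  then show ?case by (simp add: class_ext_0 alt_char_0)
next
  case (Suc k)
  let ?f = "\<lambda>\<sigma>. complex_of_int (alt_char (Suc k) N b \<sigma>)"
  let ?y = "jm_elem (Suc k)"
  have k: "k < r" using Suc.prems by simp
  have inv: "invariant k" using invariant[of k] k by simp
  then have EA: "supported k (E k)" by (simp add: invariant_def)
  \<comment> \<open>The number by which \<open>jm_elem (Suc k)\<close> acts: half the difference of
    the two Casimir eigenvalues.\<close>
  define \<kappa> where "\<kappa> = (real_of_int (casimir_eigenvalue N b) - real_of_int (casimir_eigenvalue N (a k))) / 2"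
  have ev: "all_transps k * E k = scalar (real_of_int (casimir_eigenvalue N (a k))) * E k"
    using invariant_all_transps[OF inv] k by simp
  have lin_prod: "class_ext (Suc k) ?f (lin_prod ?y cs * E k) = of_real (\<Prod>d\<leftarrow>cs. (\<kappa> - d)) * class_ext (Suc k) ?f (E k)" for cs
  proof (induction cs)
    case (Cons c cs)
    let ?X = "lin_prod ?y cs * E k"
    have "class_ext (Suc k) (casimir (Suc k) ?f) ?X = of_int (casimir_eigenvalue N b) * class_ext (Suc k) ?f ?X"
      using class_ext_cong[of "Suc k" "casimir (Suc k) ?f" "\<lambda>\<sigma>. of_int (casimir_eigenvalue N b) * ?f \<sigma>" ?X]
      by (simp add: casimir_alt_char) (simp add: class_ext_def sum_distrib_left mult_ac)
    then have "2 * class_ext (Suc k) ?f (?y * ?X) = 2 * (of_real \<kappa> * class_ext (Suc k) ?f ?X)"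
      unfolding class_ext_lin_prod_double[OF EA ev] by (simp add: \<kappa>_def left_diff_distrib)
    then have "class_ext (Suc k) ?f (?y * ?X) = of_real \<kappa> * class_ext (Suc k) ?f ?X" by simp
    then have "class_ext (Suc k) ?f (lin_prod ?y (c # cs) * E k) = (of_real \<kappa> - of_real c) * class_ext (Suc k) ?f ?X"
      by (simp add: left_diff_distrib mult.assoc class_ext_diff class_ext_scalar)
    then show ?case using Cons by simp
  qed simp
  have base: "class_ext (Suc k) ?f (E k) = (\<Sum>i<N. of_bool (\<forall>j<N. (b(i := b i - 1)) j = a k j))"
  proof -
    have "class_ext (Suc k) ?f (E k) = class_ext k ?f (E k)" by (rule class_ext_mono[OF EA])
    also have "\<dots> = class_ext k (\<lambda>\<sigma>. \<Sum>i<N. of_int (alt_char k N (b(i := b i - 1)) \<sigma>)) (E k)"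
      by (rule class_ext_cong) (simp add: alt_char_restrict)
    also have "\<dots> = (\<Sum>i<N. class_ext k (\<lambda>\<sigma>. of_int (alt_char k N (b(i := b i - 1)) \<sigma>)) (E k))"
      unfolding class_ext_def sum_distrib_left by (rule sum.swap)
    also have "\<dots> = (\<Sum>i<N. of_bool (\<forall>j<N. (b(i := b i - 1)) j = a k j))"
    proof (rule sum.cong[OF refl])
      fix i assume "i \<in> {..<N}"
      then have i: "i < N" by simp
      show "class_ext k (\<lambda>\<sigma>. of_int (alt_char k N (b(i := b i - 1)) \<sigma>)) (E k) = of_bool (\<forall>j<N. (b(i := b i - 1)) j = a k j)"
      proof (cases "strict_decr N (b(i := b i - 1))")
        case True
        then show ?thesis using Suc.IH k by simp
      next
        case False
        \<comment> \<open>Strictness can only fail because row \<open>i\<close> was lowered onto a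
          later row end, which makes two entries equal.\<close>
        then obtain u v where uv: "u < v" "v < N" "(b(i := b i - 1)) u \<le> (b(i := b i - 1)) v"
          by (auto simp: strict_decr_def not_less)
        have "b v < b u" using Suc.prems(2) uv by (simp add: strict_decr_def)
        then have ui: "u = i" "v \<noteq> i" "b v = b i - 1" using uv by (auto split: if_splits)
        have "alt_char k N (b(i := b i - 1)) \<sigma> = 0" if "\<sigma> \<in> perms k" for \<sigma>
          by (rule alt_char_eq_0[of \<sigma> k i N v]) (use that i uv ui in auto)
        then have "class_ext k (\<lambda>\<sigma>. of_int (alt_char k N (b(i := b i - 1)) \<sigma>)) (E k) = 0"
          using class_ext_cong[of k "\<lambda>\<sigma>. of_int (alt_char k N (b(i := b i - 1)) \<sigma>)" "\<lambda>_. 0" "E k"] by (simp add: class_ext_def)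
        moreover have "\<not> (\<forall>j<N. (b(i := b i - 1)) j = a k j)"
        proof
          assume "\<forall>j<N. (b(i := b i - 1)) j = a k j"
          then have "a k u \<le> a k v" using uv by auto
          then show False using row_ends_strict_decr[of k] uv k by (auto simp: strict_decr_def not_less[symmetric])
        qed
        ultimately show ?thesis by simp
      qed
    qed
    finally show ?thesis .
  qed
  have main: "class_ext (Suc k) ?f (E (Suc k)) =
      of_real ((\<Prod>d\<leftarrow>other_ends N \<rho> k. (\<kappa> - d)) / (\<Prod>d\<leftarrow>other_ends N \<rho> k. (row_content \<rho> (Suc k) - d))) * class_ext (Suc k) ?f (E k)"
    by (simp add: class_ext_scalar lin_prod)
  let ?m = "\<rho> (Suc k)"
  have iff: "(\<forall>j<N. (b(i := b i - 1)) j = a k j) \<longleftrightarrow> (\<forall>j<N. b j = (add_box (a k) i) j)" if "i < N" for i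
    using that by (auto simp: add_box_apply)
  show ?case
  proof (cases "\<exists>i<N. \<forall>j<N. b j = (add_box (a k) i) j")
    case False
    then have "class_ext (Suc k) ?f (E k) = 0"
      unfolding base using iff by (auto intro!: sum.neutral)
    moreover have "\<not> (\<forall>i<N. b i = a (Suc k) i)" using False rho_less[OF k] by auto
    ultimately show ?thesis using main by simp
  next
    case True
    then obtain i where i: "i < N" and b: "\<forall>j<N. b j = (add_box (a k) i) j" by auto
    have uniq: "i' = i" if "i' < N" "\<forall>j<N. b j = (add_box (a k) i') j" for i'
    proof (rule ccontr)
      assume ne: "i' \<noteq> i"
      have "b i = a k i + 1" using b i by (simp add: add_box_apply)
      moreover have "b i = a k i" using that(2) i ne by (simp add: add_box_apply)
      ultimately show False by linarith
    qed
    have "class_ext (Suc k) ?f (E k) = (\<Sum>i'<N. if i' = i then 1 else 0)"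
      unfolding base
    proof (rule sum.cong[OF refl])
      fix i' assume "i' \<in> {..<N}"
      then have i': "i' < N" by simp
      have "(\<forall>j<N. b j = add_box (a k) i' j) \<longleftrightarrow> i' = i" using uniq[OF i'] b by blast
      then show "of_bool (\<forall>j<N. (b(i' := b i' - 1)) j = a k j) = (if i' = i then 1 else 0 :: complex)"
        by (simp only: iff[OF i'] of_bool_def)
    qed
    then have 1: "class_ext (Suc k) ?f (E k) = 1" using i by simp
    have "casimir_eigenvalue N b = casimir_eigenvalue N (a k) + 2 * a k i"
      using casimir_eigenvalue_cong[of N b "add_box (a k) i"] b casimir_eigenvalue_add[OF i, of "a k"] by simp
    then have \<kappa>: "\<kappa> = real_of_int (a k i)" by (simp add: \<kappa>_def)
    show ?thesis
    proof (cases "i = ?m")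
      case True
      then have "(\<Prod>d\<leftarrow>other_ends N \<rho> k. (\<kappa> - d)) = (\<Prod>d\<leftarrow>other_ends N \<rho> k. (row_content \<rho> (Suc k) - d))"
        by (simp add: \<kappa> row_content_def)
      moreover have "\<forall>i<N. b i = a (Suc k) i" using b True by simp
      ultimately show ?thesis using main 1 other_ends_denom[OF k] by simp
    next
      case False
      then have "(\<Prod>d\<leftarrow>other_ends N \<rho> k. (\<kappa> - d)) = 0" using other_ends_prod[OF k i] by (simp add: \<kappa>)
      moreover have "\<not> (\<forall>i<N. b i = a (Suc k) i)" using uniq[OF rho_less[OF k]] False by auto
      ultimately show ?thesis using main by simp
    qed
  qed
qed

section \<open>The corner cut out by the idempotent, and its uniqueness\<close>

lemma E_props:
  shows supported_E: "supported r (E r)" and star_E: "star (E r) = E r" and idem_E: "E r * E r = E r"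
    and jm_elem_E: "j \<in> {1..r} \<Longrightarrow> jm_elem j * E r = scalar (row_content \<rho> j) * E r"
    and class_ext_E: "classfn r f \<Longrightarrow> class_ext r f (E r) = alt_trace r N (a r) f"
  using invariant[of r] by (auto simp: invariant_def)

lemma E_jm_elem: "j \<in> {1..r} \<Longrightarrow> E r * jm_elem j = scalar (row_content \<rho> j) * E r"
  using arg_cong[OF jm_elem_E, of j star] by (simp add: star_mult star_gelem star_E star_jm_elem scalar_comm)

lemma class_ext_alt_char_E: "class_ext r (\<lambda>\<sigma>. of_int (alt_char r N (a r) \<sigma>)) (E r) = 1"
  using alt_char_orthogonal[of r "a r"] row_ends_strict_decr[of r] by simp

abbreviation X where "X s \<equiv> E r * gelem s 1 * E r"

lemma supported_X: "s \<in> sym_perms r \<Longrightarrow> supported r (X s)"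
  by (intro supported_mult supported_E supported_gelem)

text \<open>Cutting with \<open>E r\<close> on both sides is an orthogonal projection
  \<open>P\<close>, and \<open><P s, P s> = <s, P s>\<close>.\<close>

lemma X_norm:
  assumes "s \<in> sym_perms r"
  shows "(\<Sum>t\<in>sym_perms r. coef (X s) t * coef (X s) t) = coef (X s) s"
proof -
  have "(\<Sum>t\<in>sym_perms r. coef (X s) t * coef (X s) t) = coef (X s * star (X s)) 0"
    by (rule coef_mult_star[OF supported_X[OF assms], symmetric])
  also have "X s * star (X s) = E r * gelem s 1 * (E r * E r) * gelem (- s) 1 * E r"
    by (simp only: star_mult star_gelem star_E mult.assoc)
  also have "\<dots> = E r * (gelem s 1 * E r * gelem (- s) 1 * E r)"
    by (simp only: idem_E mult.assoc)
  also have "coef \<dots> 0 = coef (gelem s 1 * E r * gelem (- s) 1 * E r * E r) 0"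
    by (rule coef_mult_comm)
  also have "\<dots> = coef (gelem s 1 * E r * gelem (- s) 1 * E r) 0"
    by (simp only: idem_E mult.assoc)
  also have "\<dots> = coef (E r * (gelem s 1 * E r * gelem (- s) 1)) 0"
    by (rule coef_mult_comm)
  also have "\<dots> = coef (X s * gelem (- s) 1) 0" by (simp only: mult.assoc)
  also have "\<dots> = coef (X s) s" by (simp add: coef_mult_gelem)
  finally show ?thesis .
qed

text \<open>Self-adjointness of the same projection, together with the fact that it fixes
  \<open>E r\<close>.\<close>

lemma X_E:
  assumes "s \<in> sym_perms r"
  shows "(\<Sum>t\<in>sym_perms r. coef (X s) t * coef (E r) t) = coef (E r) s"
proof -
  have "(\<Sum>t\<in>sym_perms r. coef (X s) t * coef (E r) t) = coef (X s * star (E r)) 0"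
    by (rule coef_mult_star[OF supported_X[OF assms], symmetric])
  also have "\<dots> = coef (E r * (gelem s 1 * E r)) 0" by (simp only: star_E idem_E mult.assoc)
  also have "\<dots> = coef (gelem s 1 * E r * E r) 0" by (rule coef_mult_comm)
  also have "\<dots> = coef (gelem s 1 * E r) 0" by (simp only: idem_E mult.assoc)
  also have "\<dots> = coef (star (E r)) s" by (simp add: coef_gelem_mult)
  finally show ?thesis by (simp only: star_E)
qed

lemma E_norm: "(\<Sum>t\<in>sym_perms r. coef (E r) t * coef (E r) t) = coef (E r) 0"
  using coef_mult_star[OF supported_E, of "E r"] by (simp add: star_E idem_E)

lemma E_norm_nonzero: "coef (E r) 0 \<noteq> 0"
proof
  assume "coef (E r) 0 = 0"
  then have "E r = 0" by (intro selfadjoint_square_0[of r]) (simp_all add: supported_E star_E idem_E)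
  then show False using class_ext_alt_char_E by (simp add: class_ext_zero)
qed

text \<open>Makes the trace formula pointwise. It is applied to the class function that counts the
  \<open>s\<close> conjugating the inverse of \<open>u\<close> to a given permutation, so that its
  right-hand side averages \<open>alt_char\<close> over one conjugacy class. The sum on the left is
  the trace of left multiplication by \<open>u\<close> and right multiplication by
  \<open>E r\<close>, the character of the left ideal.\<close>

lemma sum_conjugates:
  assumes u: "u \<in> sym_perms r"
  shows "(\<Sum>s\<in>sym_perms r. complex_of_real (coef (E r) (- s + (- u + s)))) = of_int (alt_char r N (a r) (ap u))"
proof -
  let ?c = "\<lambda>s. - s + (- u + s)"
  let ?f = "\<lambda>\<sigma>. of_nat (card {s \<in> sym_perms r. ap (?c s) = \<sigma>}) :: complex"
  have cS: "?c s \<in> sym_perms r" if "s \<in> sym_perms r" for s using that u by (intro sym_perms_plus sym_perms_uminus)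
  have sum_f: "(\<Sum>v\<in>sym_perms r. g v * ?f (ap v)) = (\<Sum>s\<in>sym_perms r. g (?c s))" for g :: "sperm \<Rightarrow> complex"
  proof -
    have "(\<Sum>s\<in>sym_perms r. g (?c s)) = (\<Sum>v\<in>sym_perms r. \<Sum>s\<in>{s \<in> sym_perms r. ?c s = v}. g (?c s))"
      by (rule sum.group[symmetric]) (use cS in auto)
    also have "\<dots> = (\<Sum>v\<in>sym_perms r. g v * ?f (ap v))"
      by (rule sum.cong) (auto simp: ap_inject)
    finally show ?thesis by simp
  qed
  have "classfn r ?f"
    unfolding classfn_def
  proof (intro ballI)
    fix \<sigma> \<tau> assume st: "\<sigma> \<in> perms r" "\<tau> \<in> perms r"
    define t where "t = Sp \<tau>"
    have t: "ap t = \<tau>" "t \<in> sym_perms r" using st by (auto simp: t_def sym_perms_def ap_Sp)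
    have conj: "?c (s + - t) = t + ?c s + - t" for s by (simp only: minus_add minus_minus add.assoc)
    have "ap (?c (s + - t)) = \<tau> \<circ> \<sigma> \<circ> inv \<tau> \<longleftrightarrow> ap (?c s) = \<sigma>" for s
    proof -
      have "ap (?c (s + - t)) = \<tau> \<circ> ap (?c s) \<circ> inv \<tau>"
        unfolding conj by (simp only: ap_plus ap_uminus t)
      moreover have "x = y" if "\<tau> \<circ> x \<circ> inv \<tau> = \<tau> \<circ> y \<circ> inv \<tau>" for x y
      proof -
        have "x = inv \<tau> \<circ> (\<tau> \<circ> x \<circ> inv \<tau>) \<circ> \<tau>" for x
        proof -
          have "inv \<tau> \<circ> (\<tau> \<circ> x \<circ> inv \<tau>) \<circ> \<tau> = (inv \<tau> \<circ> \<tau>) \<circ> x \<circ> (inv \<tau> \<circ> \<tau>)" by (simp only: comp_assoc)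
          then show ?thesis by (simp add: perms_inv_o[OF st(2)])
        qed
        then show ?thesis using that by metis
      qed
      ultimately show ?thesis by auto
    qed
    then have "bij_betw (\<lambda>s. s + - t) {s \<in> sym_perms r. ap (?c s) = \<sigma>} {s \<in> sym_perms r. ap (?c s) = \<tau> \<circ> \<sigma> \<circ> inv \<tau>}"
      apply (intro bij_betw_byWitness[where f' = "\<lambda>s. s + t"])
      subgoal by (simp add: add.assoc)
      subgoal by (simp add: add.assoc)
      subgoal using sym_perms_plus[OF _ sym_perms_uminus[OF t(2)]] by (auto simp del: add_uminus_conv_diff)
      subgoal premises p
      proof clarify
        fix s assume s: "s \<in> sym_perms r" "ap (?c s) = \<tau> \<circ> \<sigma> \<circ> inv \<tau>"
        have "(s + t) + - t = s" by (simp add: add.assoc)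
        then have "ap (?c (s + t + - t)) = \<tau> \<circ> \<sigma> \<circ> inv \<tau>" using s(2) by (simp only:)
        then have "ap (?c (s + t)) = \<sigma>" using p[of "s + t"] by blast
        then show "s + t \<in> sym_perms r \<and> ap (?c (s + t)) = \<sigma>" using sym_perms_plus[OF s(1) t(2)] by blast
      qed
      done
    then show "?f (\<tau> \<circ> \<sigma> \<circ> inv \<tau>) = ?f \<sigma>" by (simp add: bij_betw_same_card)
  qed
  then have "class_ext r ?f (E r) = alt_trace r N (a r) ?f" by (rule class_ext_E)
  also have "\<dots> = (\<Sum>v\<in>sym_perms r. of_int (alt_char r N (a r) (ap v)) * ?f (ap v)) / fact r"
    unfolding alt_trace_def by (subst sum_sym_perms[symmetric]) simp
  also have "\<dots> = (\<Sum>s\<in>sym_perms r. of_int (alt_char r N (a r) (ap (?c s)))) / fact r"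
    by (subst sum_f) simp
  also have "(\<Sum>s\<in>sym_perms r. of_int (alt_char r N (a r) (ap (?c s)))) = (\<Sum>s\<in>sym_perms r. of_int (alt_char r N (a r) (ap u)) :: complex)"
  proof (rule sum.cong[OF refl])
    fix s assume s: "s \<in> sym_perms r"
    have "alt_char r N (a r) (ap (?c s)) = alt_char r N (a r) (inv (ap s) \<circ> inv (ap u) \<circ> inv (inv (ap s)))"
      using s by (simp add: ap_plus ap_uminus comp_assoc inv_inv_eq sym_perms_def perms_iff permutes_bij)
    also have "\<dots> = alt_char r N (a r) (inv (ap u))"
      by (rule classfnD[OF classfn_alt_char]) (use s u in \<open>auto simp: sym_perms_def intro: perms_inv\<close>)
    also have "\<dots> = alt_char r N (a r) (ap u)" by (rule alt_char_inv) (use u in \<open>simp add: sym_perms_def\<close>)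
    finally show "of_int (alt_char r N (a r) (ap (?c s))) = (of_int (alt_char r N (a r) (ap u)) :: complex)" by simp
  qed
  also have "\<dots> / fact r = of_int (alt_char r N (a r) (ap u))" by (simp add: card_sym_perms)
  finally show ?thesis unfolding class_ext_def sum_f .
qed

text \<open>The trace of \<open>x \<mapsto> E x E\<close> on the group algebra is the norm of the character, i.e. 1.\<close>
lemma X_trace: "(\<Sum>s\<in>sym_perms r. coef (X s) s) = 1"
proof -
  have "coef (X s) s = (\<Sum>u\<in>sym_perms r. coef (E r) u * coef (E r) (- s + (- u + s)))" for s
  proof -
    have "coef (X s) s = coef (X s * gelem (- s) 1) 0" by (simp add: coef_mult_gelem)
    also have "\<dots> = coef (E r * (gelem s 1 * (E r * gelem (- s) 1))) 0" by (simp only: mult.assoc)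
    also have "\<dots> = (\<Sum>u\<in>sym_perms r. coef (E r) u * coef (E r) (- s + (- u + s)))"
      by (subst coef_mult[of "sym_perms r"]) (use supported_E in \<open>simp_all add: supported_def coef_gelem_mult coef_mult_gelem diff_conv_add_uminus add.assoc del: add_uminus_conv_diff\<close>)
    finally show ?thesis .
  qed
  then have "complex_of_real (\<Sum>s\<in>sym_perms r. coef (X s) s) =
      (\<Sum>s\<in>sym_perms r. \<Sum>u\<in>sym_perms r. of_real (coef (E r) u) * of_real (coef (E r) (- s + (- u + s))))"
    by simp
  also have "\<dots> = (\<Sum>u\<in>sym_perms r. of_real (coef (E r) u) * (\<Sum>s\<in>sym_perms r. of_real (coef (E r) (- s + (- u + s)))))"
    unfolding sum_distrib_left by (rule sum.swap)
  also have "\<dots> = class_ext r (\<lambda>\<sigma>. of_int (alt_char r N (a r) \<sigma>)) (E r)"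
    unfolding class_ext_def by (rule sum.cong) (simp_all only: sum_conjugates)
  also have "\<dots> = 1" by (rule class_ext_alt_char_E)
  finally show ?thesis using of_real_eq_1_iff by blast
qed

text \<open>Compare the projection with the orthogonal projection onto the line of
  \<open>E r\<close>: the squared Hilbert--Schmidt norm of the difference is the difference of the
  traces, \<open>1 - 1\<close>.\<close>

lemma X_rank_one:
  assumes "s \<in> sym_perms r"
  shows "X s = scalar (coef (E r) s / coef (E r) 0) * E r"
proof -
  let ?e = "coef (E r)" and ?n = "coef (E r) 0"
  have n: "?n \<noteq> 0" by (rule E_norm_nonzero)
  have row: "(\<Sum>t\<in>sym_perms r. (coef (X s) t - ?e s / ?n * ?e t)\<^sup>2) = coef (X s) s - ?e s * ?e s / ?n" if "s \<in> sym_perms r" for s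
  proof -
    have "(\<Sum>t\<in>sym_perms r. (coef (X s) t - ?e s / ?n * ?e t)\<^sup>2) =
        (\<Sum>t\<in>sym_perms r. coef (X s) t * coef (X s) t) - 2 * (?e s / ?n) * (\<Sum>t\<in>sym_perms r. coef (X s) t * ?e t)
        + (?e s / ?n)\<^sup>2 * (\<Sum>t\<in>sym_perms r. ?e t * ?e t)"
      unfolding sum_distrib_left sum_subtractf[symmetric] sum.distrib[symmetric]
      by (rule sum.cong) (simp_all add: power2_eq_square algebra_simps)
    also have "\<dots> = coef (X s) s - 2 * (?e s / ?n) * ?e s + (?e s / ?n)\<^sup>2 * ?n"
      by (simp only: X_norm[OF that] X_E[OF that] E_norm)
    also have "\<dots> = coef (X s) s - ?e s * ?e s / ?n" using n by (simp add: power2_eq_square field_simps)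
    finally show ?thesis .
  qed
  have "(\<Sum>s\<in>sym_perms r. \<Sum>t\<in>sym_perms r. (coef (X s) t - ?e s / ?n * ?e t)\<^sup>2) = (\<Sum>s\<in>sym_perms r. coef (X s) s) - (\<Sum>s\<in>sym_perms r. ?e s * ?e s) / ?n"
    unfolding sum_divide_distrib sum_subtractf[symmetric] by (rule sum.cong[OF refl]) (rule row)
  also have "\<dots> = 0" using n by (simp add: X_trace E_norm)
  finally have "\<forall>s\<in>sym_perms r. (\<Sum>t\<in>sym_perms r. (coef (X s) t - ?e s / ?n * ?e t)\<^sup>2) = 0"
    by (subst (asm) sum_nonneg_eq_0_iff) (auto intro: sum_nonneg)
  then have "(\<Sum>t\<in>sym_perms r. (coef (X s) t - ?e s / ?n * ?e t)\<^sup>2) = 0" using assms by blast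
  then have z: "\<forall>t\<in>sym_perms r. (coef (X s) t - ?e s / ?n * ?e t)\<^sup>2 = 0"
    by (subst (asm) sum_nonneg_eq_0_iff) auto
  show ?thesis
  proof (rule poly_mapping_eqI)
    fix t show "coef (X s) t = coef (scalar (?e s / ?n) * E r) t"
      using z supported_X[OF assms] supported_E by (cases "t \<in> sym_perms r") (auto simp: supported_coef)
  qed
qed

lemma corner:
  assumes "supported r x"
  shows "\<exists>c. E r * x * E r = scalar c * E r"
proof -
  let ?d = "\<lambda>s. coef x s * (coef (E r) s / coef (E r) 0)"
  have "E r * x * E r = (\<Sum>s\<in>sym_perms r. E r * gelem s (coef x s) * E r)"
    using arg_cong[OF supported_expand[OF assms], of "\<lambda>z. E r * z * E r"] unfolding sum_distrib_left sum_distrib_right .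
  also have "\<dots> = (\<Sum>s\<in>sym_perms r. scalar (?d s) * E r)"
  proof (rule sum.cong[OF refl])
    fix s assume s: "s \<in> sym_perms r"
    have "gelem s (coef x s) = scalar (coef x s) * gelem s 1" by (simp add: mult_single)
    then have "E r * gelem s (coef x s) * E r = scalar (coef x s) * X s"
      by (simp add: scalar_left[of "E r"] mult.assoc)
    then show "E r * gelem s (coef x s) * E r = scalar (?d s) * E r"
      by (simp add: X_rank_one[OF s] mult.assoc[symmetric] mult_single)
  qed
  also have "\<dots> = scalar (\<Sum>s\<in>sym_perms r. ?d s) * E r"
  proof -
    have "(\<Sum>j\<in>S. scalar (f j)) = scalar (\<Sum>j\<in>S. f j)" for S :: "sperm set" and f
      by (induction S rule: infinite_finite_induct) (simp_all add: single_add)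
    then show ?thesis by (simp add: sum_distrib_right[symmetric])
  qed
  finally show ?thesis by blast
qed

text \<open>On a common eigenvector with the same contents every normalised Lagrange polynomial
  evaluates to 1.\<close>

lemma E_absorb:
  assumes "\<And>j. j \<in> {1..r} \<Longrightarrow> jm_elem j * e = scalar (row_content \<rho> j) * e"
  shows "k \<le> r \<Longrightarrow> E k * e = e"
proof (induction k)
  case (Suc k)
  have "lin_prod (jm_elem (Suc k)) (other_ends N \<rho> k) * e = scalar (\<Prod>d\<leftarrow>other_ends N \<rho> k. (row_content \<rho> (Suc k) - d)) * e"
    by (rule lin_prod_eigen, rule assms) (use Suc.prems in auto)
  then show ?case using Suc other_ends_denom[of k]
    by (simp add: mult.assoc) (simp add: mult.assoc[symmetric] mult_single)
qed simp

text \<open>\<open>star\<close> exchanges the two eigenvector conditions, so \<open>e\<close> is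
  absorbed by \<open>E r\<close> on both sides and lies in the one-dimensional corner.\<close>

lemma unique:
  assumes "supported r e" "\<And>j. j \<in> {1..r} \<Longrightarrow> jm_elem j * e = scalar (row_content \<rho> j) * e"
    "\<And>j. j \<in> {1..r} \<Longrightarrow> e * jm_elem j = scalar (row_content \<rho> j) * e"
  shows "\<exists>c. e = scalar c * E r"
proof -
  have 1: "E r * e = e" by (rule E_absorb[OF assms(2)]) auto
  have "jm_elem j * star e = scalar (row_content \<rho> j) * star e" if "j \<in> {1..r}" for j
    using arg_cong[OF assms(3)[OF that], of star] by (simp add: star_mult star_gelem star_jm_elem scalar_comm)
  then have "E r * star e = star e" by (rule E_absorb) auto
  then have "star (E r * star e) = e" by simp
  then have 2: "e * E r = e" by (simp add: star_mult star_E)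
  show ?thesis using corner[OF assms(1)] by (simp add: 1 2)
qed

end

section \<open>Tableaux\<close>

lemma initial_segment:
  fixes J :: "nat set"
  assumes "finite J" "\<And>j. j \<in> J \<Longrightarrow> 1 \<le> j" "\<And>j j'. j \<in> J \<Longrightarrow> 1 \<le> j' \<Longrightarrow> j' \<le> j \<Longrightarrow> j' \<in> J"
  shows "J = {1..card J}"
proof (cases "J = {}")
  case False
  define M where "M = Max J"
  have "M \<in> J" using False assms(1) by (simp add: M_def)
  moreover have "j \<le> M" if "j \<in> J" for j using assms(1) that by (simp add: M_def)
  ultimately have "j \<in> J \<longleftrightarrow> j \<in> {1..M}" for j
    using assms(2)[of j] assms(3)[of M j] by auto
  then have "J = {1..M}" by blast
  then show ?thesis by simp
qed simp

lemma sorted_rev_nth: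
  fixes lam :: "nat list"
  shows "sorted (rev lam) \<Longrightarrow> i \<le> j \<Longrightarrow> j < length lam \<Longrightarrow> lam ! j \<le> lam ! i"
  using sorted_rev_nth_mono by blast

lemma diagram_down:
  assumes "sorted (rev lam)" "(i,j) \<in> diagram lam" "1 \<le> i'" "i' \<le> i" "1 \<le> j'" "j' \<le> j"
  shows "(i',j') \<in> diagram lam"
proof -
  have "lam ! (i - 1) \<le> lam ! (i' - 1)"
    using assms by (intro sorted_rev_nth) (auto simp: diagram_def)
  then show ?thesis using assms by (auto simp: diagram_def)
qed

lemma row_ends_card: "row_ends \<rho> k i = int (card {x \<in> {1..k}. \<rho> x = i}) - int i"
proof (induction k)
  case (Suc k)
  then show ?case by (simp only: row_ends.simps add_box_apply card_Suc_Collect) auto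
qed simp

locale syt =
  fixes r :: nat and lam :: "nat list" and T :: "nat \<Rightarrow> nat \<times> nat" and N :: nat
  assumes sorted: "sorted (rev lam)" and syt: "is_syt r lam T" and N: "length lam < N"
begin

definition rho :: "nat \<Rightarrow> nat" where "rho k = fst (T k) - 1"

text \<open>Columns are counted from 1 but rows from 0; only the row index is shifted.\<close>

definition row :: "nat \<Rightarrow> nat \<Rightarrow> nat set" where
  "row k i = {j. \<exists>x\<in>{1..k}. T x = (i + 1, j)}"

lemma T_diagram: "x \<in> {1..r} \<Longrightarrow> T x \<in> diagram lam"
  using syt unfolding is_syt_def bij_betw_def by blast

lemma T_surj: "b \<in> diagram lam \<Longrightarrow> \<exists>x\<in>{1..r}. T x = b"
  using syt unfolding is_syt_def bij_betw_def by (metis imageE)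

lemma T_inj: "x \<in> {1..r} \<Longrightarrow> y \<in> {1..r} \<Longrightarrow> T x = T y \<Longrightarrow> x = y"
  using syt unfolding is_syt_def bij_betw_def inj_on_def by blast

lemma T_mono: "x \<in> {1..r} \<Longrightarrow> y \<in> {1..r} \<Longrightarrow> fst (T x) \<le> fst (T y) \<Longrightarrow> snd (T x) \<le> snd (T y) \<Longrightarrow> x \<le> y"
  using syt unfolding is_syt_def by blast

text \<open>The boxes with entries up to \<open>k\<close> form a diagram again, because a box weakly
  above and to the left carries a smaller or equal entry.\<close>

lemma row_down:
  assumes "k \<le> r" "j \<in> row k i" "1 \<le> j'" "j' \<le> j" "i' \<le> i"
  shows "j' \<in> row k i'"
proof -
  obtain x where x: "x \<in> {1..k}" "T x = (i + 1, j)" using assms by (auto simp: row_def)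
  have xr: "x \<in> {1..r}" using x assms by auto
  have "(i' + 1, j') \<in> diagram lam"
    using diagram_down[OF sorted, of "i + 1" j "i' + 1" j'] T_diagram[OF xr] x assms by simp
  then obtain y where y: "y \<in> {1..r}" "T y = (i' + 1, j')" using T_surj by blast
  have "y \<le> x" by (rule T_mono) (use x y xr assms in auto)
  then show ?thesis using x y by (auto simp: row_def)
qed

lemma row_pos: "k \<le> r \<Longrightarrow> j \<in> row k i \<Longrightarrow> 1 \<le> j"
proof -
  assume "k \<le> r" "j \<in> row k i"
  then obtain x where "x \<in> {1..k}" "T x = (i + 1, j)" by (auto simp: row_def)
  then have "x \<in> {1..r}" "T x = (i + 1, j)" using \<open>k \<le> r\<close> by auto
  then show ?thesis using T_diagram[of x] by (auto simp: diagram_def)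
qed

lemma finite_row: "finite (row k i)"
proof -
  have "row k i \<subseteq> (\<lambda>x. snd (T x)) ` {1..k}" by (force simp: row_def)
  then show ?thesis by (rule finite_subset) simp
qed

lemma row_segment: "k \<le> r \<Longrightarrow> row k i = {1..card (row k i)}"
  by (rule initial_segment[OF finite_row row_pos]) (assumption, assumption, rule row_down, auto)

lemma card_row: "k \<le> r \<Longrightarrow> card {x \<in> {1..k}. rho x = i} = card (row k i)"
proof (rule bij_betw_same_card[of "\<lambda>x. snd (T x)"])
  assume k: "k \<le> r"
  have pos: "1 \<le> fst (T x)" if "x \<in> {1..k}" for x
    using T_diagram[of x] that k by (cases "T x") (auto simp: diagram_def)
  show "bij_betw (\<lambda>x. snd (T x)) {x \<in> {1..k}. rho x = i} (row k i)"
    unfolding bij_betw_def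
  proof
    show "inj_on (\<lambda>x. snd (T x)) {x \<in> {1..k}. rho x = i}"
    proof (rule inj_onI)
      fix x y assume x: "x \<in> {x \<in> {1..k}. rho x = i}" and y: "y \<in> {x \<in> {1..k}. rho x = i}" and e: "snd (T x) = snd (T y)"
      have "fst (T x) - 1 = fst (T y) - 1" using x y by (simp add: rho_def)
      then have "fst (T x) = fst (T y)" using pos[of x] pos[of y] x y by auto
      then have "T x = T y" using e by (simp add: prod_eq_iff)
      then show "x = y" by (rule T_inj[rotated 2]) (use x y k in auto)
    qed
    show "(\<lambda>x. snd (T x)) ` {x \<in> {1..k}. rho x = i} = row k i"
    proof (intro subset_antisym subsetI)
      fix j assume "j \<in> (\<lambda>x. snd (T x)) ` {x \<in> {1..k}. rho x = i}"
      then obtain x where x: "x \<in> {1..k}" "rho x = i" "j = snd (T x)" by auto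
      have "fst (T x) = i + 1" using pos[OF x(1)] x(2) by (simp add: rho_def)
      then have "T x = (i + 1, j)" using x(3) by (simp add: prod_eq_iff)
      then show "j \<in> row k i" using x(1) by (auto simp: row_def)
    next
      fix j assume "j \<in> row k i"
      then obtain x where x: "x \<in> {1..k}" "T x = (i + 1, j)" by (auto simp: row_def)
      then show "j \<in> (\<lambda>x. snd (T x)) ` {x \<in> {1..k}. rho x = i}"
        by (intro image_eqI[of _ _ x]) (auto simp: rho_def)
    qed
  qed
qed

lemma row_ends_row: "k \<le> r \<Longrightarrow> row_ends rho k i = int (card (row k i)) - int i"
  by (simp only: row_ends_card card_row)

text \<open>Before and after the step the occupied columns of this row are initial segments
  differing by one element, which must be the next column.\<close>

lemma rho_content:
  assumes "k < r"
  shows "T (Suc k) = (rho (Suc k) + 1, card (row k (rho (Suc k))) + 1)"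
proof -
  let ?i = "rho (Suc k)"
  obtain i j where T: "T (Suc k) = (i, j)" by (cases "T (Suc k)")
  have d: "(i, j) \<in> diagram lam" using T_diagram[of "Suc k"] assms T by auto
  then have i: "i = ?i + 1" using T by (auto simp: rho_def diagram_def)
  have "row (Suc k) ?i = insert j (row k ?i)"
  proof -
    have "{1..Suc k} = insert (Suc k) {1..k}" by auto
    then show ?thesis using T i unfolding row_def by auto
  qed
  moreover have nj: "j \<notin> row k ?i"
  proof
    assume "j \<in> row k ?i"
    then obtain x where "x \<in> {1..k}" "T x = T (Suc k)" using T i by (auto simp: row_def)
    then show False using T_inj[of x "Suc k"] assms by auto
  qed
  ultimately have c: "card (row (Suc k) ?i) = card (row k ?i) + 1" using finite_row by simp
  have "j \<in> row (Suc k) ?i" using \<open>row (Suc k) ?i = insert j (row k ?i)\<close> by simp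
  then have "j \<le> card (row k ?i) + 1" "1 \<le> j" using row_segment[of "Suc k" ?i] assms c by auto
  moreover have "\<not> j \<le> card (row k ?i)"
  proof
    assume "j \<le> card (row k ?i)"
    then have "j \<in> {1..card (row k ?i)}" using \<open>1 \<le> j\<close> by simp
    moreover have "row k ?i = {1..card (row k ?i)}" by (rule row_segment) (use assms in simp)
    ultimately show False using nj by metis
  qed
  ultimately show ?thesis using T i by simp
qed

lemma row_content_content:
  assumes "k \<in> {1..r}"
  shows "row_content rho k = of_int (content T k)"
proof -
  have "T (Suc (k - 1)) = (rho (Suc (k - 1)) + 1, card (row (k - 1) (rho (Suc (k - 1)))) + 1)"
    by (rule rho_content) (use assms in auto)
  moreover have "row_ends rho (k - 1) (rho k) = int (card (row (k - 1) (rho k))) - int (rho k)"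
    by (rule row_ends_row) (use assms in auto)
  ultimately show ?thesis using assms by (simp add: row_content_def content_def)
qed

lemma row_big: "k \<le> r \<Longrightarrow> length lam \<le> i \<Longrightarrow> row k i = {}"
  using T_diagram by (fastforce simp: row_def diagram_def)

sublocale tableau N rho r
proof
  show "0 < N" using N by simp
  show "rho (Suc k) < N" if "k < r" for k
    using T_diagram[of "Suc k"] that N by (cases "T (Suc k)") (auto simp: rho_def diagram_def)
  show "strict_decr N (row_ends rho k)" if "k \<le> r" for k
    unfolding strict_decr_def
  proof (intro allI impI)
    fix i j assume "i < j" "j < N"
    have "row k j \<subseteq> row k i" using row_down[OF that, of _ j _ i] row_pos[OF that] \<open>i < j\<close> by auto
    then have "card (row k j) \<le> card (row k i)" by (rule card_mono[OF finite_row])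
    then show "row_ends rho k j < row_ends rho k i" using \<open>i < j\<close> by (simp add: row_ends_row that)
  qed
  show "row_ends rho k (N - 1) = 1 - int N" if "k < r" for k
    using row_big[of k "N - 1"] that N by (simp add: row_ends_row of_nat_diff)
qed

text \<open>The final row ends depend on the shape alone; hence the character does not depend on the
  tableau.\<close>

lemma row_ends_final: "row_ends rho r i = int (part lam (Suc i)) - int i"
proof -
  have "row r i = {j. (i + 1, j) \<in> diagram lam}"
    using T_surj T_diagram by (fastforce simp: row_def)
  also have "\<dots> = {1..part lam (Suc i)}" by (auto simp: diagram_def part_def)
  finally show ?thesis by (simp add: row_ends_row)
qed

end

section \<open>The conjugate partition and the transposed tableau\<close>

definition conj_list :: "nat list \<Rightarrow> nat list" where
  "conj_list lam = map (\<lambda>i. conjp lam (Suc i)) [0..<part lam 1]"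

lemma length_conj_list [simp]: "length (conj_list lam) = part lam 1"
  by (simp add: conj_list_def)

text \<open>In a partition the rows of length at least \<open>j\<close> form an initial segment, so
  counting them is the same as locating the last one.\<close>

lemma conjp_iff:
  assumes "sorted (rev lam)"
  shows "i \<le> conjp lam j \<longleftrightarrow> i = 0 \<or> (i \<le> length lam \<and> j \<le> lam ! (i - 1))"
proof -
  let ?S = "{x. x < length lam \<and> j \<le> lam ! x}"
  have down: "y \<in> ?S" if "x \<in> ?S" "y \<le> x" for x y
    using that sorted_rev_nth[OF assms, of y x] by auto
  have "Suc ` ?S = {1..card (Suc ` ?S)}"
  proof (rule initial_segment)
    fix u v assume "u \<in> Suc ` ?S" "1 \<le> v" "v \<le> u"
    then show "v \<in> Suc ` ?S" using down[of "u - 1" "v - 1"] by (intro image_eqI[of _ _ "v - 1"]) auto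
  qed auto
  moreover have "card (Suc ` ?S) = conjp lam j" by (simp add: card_image conjp_def)
  ultimately have "Suc ` ?S = {1..conjp lam j}" by simp
  then have "i \<in> Suc ` ?S \<longleftrightarrow> i \<in> {1..conjp lam j}" by simp
  then show ?thesis by (cases i) (auto simp: image_iff)
qed

lemma conjp_antimono: "i \<le> j \<Longrightarrow> conjp lam j \<le> conjp lam i"
  unfolding conjp_def by (intro card_mono) auto

lemma sorted_conj_list: "sorted (rev (conj_list lam))"
  unfolding sorted_rev_iff_nth_mono by (auto simp: conj_list_def intro: conjp_antimono)

lemma diagram_conj:
  assumes "sorted (rev lam)"
  shows "diagram (conj_list lam) = prod.swap ` diagram lam"
proof -
  have "(j,i) \<in> diagram (conj_list lam) \<longleftrightarrow> (i,j) \<in> diagram lam" for i j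
  proof -
    have "j \<le> part lam 1" if "(i,j) \<in> diagram lam"
      using diagram_down[OF assms that, of 1 j] that by (auto simp: diagram_def part_def)
    moreover have "(j,i) \<in> diagram (conj_list lam) \<longleftrightarrow> 1 \<le> j \<and> j \<le> part lam 1 \<and> 1 \<le> i \<and> i \<le> conjp lam j"
      by (auto simp: diagram_def conj_list_def)
    ultimately show ?thesis using conjp_iff[OF assms, of i j] by (auto simp: diagram_def)
  qed
  then show ?thesis by (auto simp: image_iff prod.swap_def) (metis swap_swap swap_simp fst_conv snd_conv)
qed

lemma is_syt_conj:
  assumes "sorted (rev lam)" "is_syt r lam T"
  shows "is_syt r (conj_list lam) (prod.swap \<circ> T)"
proof -
  have "bij_betw prod.swap (diagram lam) (diagram (conj_list lam))"
    unfolding diagram_conj[OF assms(1)] by (auto simp: bij_betw_def)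
  then have "bij_betw (prod.swap \<circ> T) {1..r} (diagram (conj_list lam))"
    using bij_betw_trans[of T "{1..r}" "diagram lam" prod.swap] assms(2) unfolding is_syt_def by blast
  then show ?thesis using assms(2) unfolding is_syt_def comp_apply fst_swap snd_swap by blast
qed

lemma part_conj:
  assumes "1 \<le> i" "i \<le> part lam 1"
  shows "part (conj_list lam) i = conjp lam i"
proof -
  define n where "n = part lam 1"
  show ?thesis
    using assms unfolding part_def[of "conj_list lam"]
    unfolding conj_list_def n_def[symmetric] by (cases i) simp_all
qed

lemma conjp_1: "is_partition r lam \<Longrightarrow> conjp lam 1 = length lam"
proof -
  assume "is_partition r lam"
  then have "{j. j < length lam \<and> 1 \<le> lam ! j} = {..<length lam}"
    by (force simp: is_partition_def Suc_le_eq)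
  then show ?thesis by (simp add: conjp_def)
qed

section \<open>Coefficients of the tensor products\<close>

lemma finite_submsets [simp]: "finite {a. a \<subseteq># (c :: 'a multiset)}"
proof (rule finite_subset)
  show "{a. a \<subseteq># c} \<subseteq> mset ` {xs. set xs \<subseteq> set_mset c \<and> length xs \<le> size c}"
  proof
    fix a assume "a \<in> {a. a \<subseteq># c}"
    then have a: "a \<subseteq># c" by simp
    obtain xs where "mset xs = a" using ex_mset by blast
    then show "a \<in> mset ` {xs. set xs \<subseteq> set_mset c \<and> length xs \<le> size c}"
      using a size_mset_mono[OF a] set_mset_mono[OF a] by (intro image_eqI[of _ _ xs]) auto
  qed
qed (simp add: finite_lists_length_le)

definition odd_square :: "nat \<Rightarrow> mon \<Rightarrow> bool" where
  "odd_square m a \<longleftrightarrow> (\<exists>g. gen_odd m g \<and> 2 \<le> count a g)"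

definition inversions :: "nat \<Rightarrow> mon \<Rightarrow> mon \<Rightarrow> ((nat \<times> nat) \<times> (nat \<times> nat)) set" where
  "inversions m a b = {(g, h). g \<in># a \<and> h \<in># b \<and> gen_odd m g \<and> gen_odd m h \<and> glt h g}"

lemma mon_sign_alt: "mon_sign m a b = (if odd_square m (a + b) then 0 else (-1) ^ card (inversions m a b))"
  by (simp add: mon_sign_def odd_square_def inversions_def)

lemma finite_inversions: "finite (inversions m a b)"
  by (rule finite_subset[of _ "set_mset a \<times> set_mset b"]) (auto simp: inversions_def)

lemma odd_square_mono: "odd_square m a \<Longrightarrow> a \<subseteq># b \<Longrightarrow> odd_square m b"
  unfolding odd_square_def by (meson le_trans mset_subset_eq_count)

lemma not_odd_square_disjoint:
  assumes "\<not> odd_square m (a + b)" "gen_odd m g" "g \<in># a"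
  shows "g \<notin># b"
proof
  assume "g \<in># b"
  then have "1 \<le> count a g" "1 \<le> count b g" using assms(3) by (simp_all add: Suc_le_eq)
  then have "2 \<le> count (a + b) g" unfolding count_union by linarith
  then show False using assms(1,2) unfolding odd_square_def by blast
qed

text \<open>Associativity of the product of monomials, at the level of signs. When nothing vanishes
  no odd generator is shared, so the inversion counts are additive in both arguments.\<close>

lemma mon_sign_cocycle:
  "mon_sign m a b * mon_sign m (a + b) c = mon_sign m a (b + c) * mon_sign m b c"
proof (cases "odd_square m (a + b + c)")
  case True
  then show ?thesis by (simp add: mon_sign_alt add.assoc)
next
  case False
  have nb: "\<not> odd_square m (a + b)" "\<not> odd_square m (b + c)"
    using False odd_square_mono[of m "a + b" "a + b + c"] odd_square_mono[of m "b + c" "a + b + c"]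
    by (auto simp: add.assoc)
  have 1: "card (inversions m (a + b) c) = card (inversions m a c) + card (inversions m b c)"
    by (subst card_Un_disjoint[symmetric], rule finite_inversions, rule finite_inversions)
      (use not_odd_square_disjoint[OF nb(1)] in \<open>auto simp: inversions_def intro!: arg_cong[of _ _ card]\<close>)
  have 2: "card (inversions m a (b + c)) = card (inversions m a b) + card (inversions m a c)"
    by (subst card_Un_disjoint[symmetric], rule finite_inversions, rule finite_inversions)
      (use not_odd_square_disjoint[OF nb(2)] in \<open>auto simp: inversions_def intro!: arg_cong[of _ _ card]\<close>)
  show ?thesis using False nb by (simp add: mon_sign_alt 1 2 power_add add.assoc)
qed

text \<open>The sign of sorting a word of generators into the normal order of its monomial, and 0 if
  an odd generator repeats.\<close>

primrec gen_prod_sign :: "nat \<Rightarrow> (nat \<times> nat) list \<Rightarrow> complex" where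
  "gen_prod_sign m [] = 1"
| "gen_prod_sign m (g # gs) = mon_sign m {#g#} (mset gs) * gen_prod_sign m gs"

definition gen_prod :: "nat \<Rightarrow> (nat \<times> nat) list \<Rightarrow> sa" where
  "gen_prod m gs = (\<lambda>c. if c = mset gs then gen_prod_sign m gs else 0)"

lemma gen_prod_sign_odd_square: "odd_square m (mset gs) \<Longrightarrow> gen_prod_sign m gs = 0"
  by (cases gs) (auto simp: mon_sign_alt, simp add: odd_square_def)

lemma gen_prod_sign_append: "gen_prod_sign m (gs @ ks) = mon_sign m (mset gs) (mset ks) * (gen_prod_sign m gs * gen_prod_sign m ks)"
proof (induction gs)
  case Nil
  then show ?case using gen_prod_sign_odd_square[of m ks] by (auto simp: mon_sign_alt inversions_def)
next
  case (Cons g gs)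
  have "gen_prod_sign m ((g # gs) @ ks) = (mon_sign m {#g#} (mset gs + mset ks) * mon_sign m (mset gs) (mset ks)) * (gen_prod_sign m gs * gen_prod_sign m ks)"
    using Cons by simp
  then show ?case unfolding mon_sign_cocycle[symmetric] by simp
qed

lemma sa_mult_gen_prod: "sa_mult m (gen_prod m gs) (gen_prod m ks) = gen_prod m (gs @ ks)"
proof
  fix c
  have "sa_mult m (gen_prod m gs) (gen_prod m ks) c =
     (\<Sum>a\<in>{a. a \<subseteq># c}. if a = mset gs then mon_sign m a (c - a) * gen_prod_sign m gs * gen_prod m ks (c - a) else 0)"
    unfolding sa_mult_def by (rule sum.cong) (auto simp: gen_prod_def)
  also have "\<dots> = (if mset gs \<subseteq># c then mon_sign m (mset gs) (c - mset gs) * gen_prod_sign m gs * gen_prod m ks (c - mset gs) else 0)"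
    by simp
  also have "\<dots> = gen_prod m (gs @ ks) c"
  proof (cases "c = mset gs + mset ks")
    case True
    then show ?thesis by (simp add: gen_prod_def gen_prod_sign_append)
  next
    case False
    then have "\<not> (mset gs \<subseteq># c \<and> c - mset gs = mset ks)" by (metis subset_mset.add_diff_inverse)
    then show ?thesis using False by (auto simp: gen_prod_def)
  qed
  finally show "sa_mult m (gen_prod m gs) (gen_prod m ks) c = gen_prod m (gs @ ks) c" .
qed

lemma sa_one_gen_prod: "sa_one = gen_prod m []"
  by (simp add: sa_one_def gen_prod_def fun_eq_iff)

lemma sa_gen_gen_prod: "sa_gen i j = gen_prod m [(i,j)]"
  by (simp add: sa_gen_def gen_prod_def mon_sign_alt odd_square_def inversions_def fun_eq_iff)

lemma sa_mult_scal: "sa_mult m (sa_scal x f) (sa_scal y g) = sa_scal (x * y) (sa_mult m f g)"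
  by (simp add: sa_mult_def sa_scal_def sum_distrib_left fun_eq_iff mult_ac)

lemma sa_mult_zero [simp]: "sa_mult m sa_zero f = sa_zero" "sa_mult m f sa_zero = sa_zero"
  by (simp_all add: sa_mult_def sa_zero_def)

lemma sa_scal_zero [simp]: "sa_scal x sa_zero = sa_zero" "sa_scal 0 f = sa_zero"
  by (simp_all add: sa_scal_def sa_zero_def)

lemma sa_scal_one [simp]: "sa_scal 1 f = f"
  by (simp add: sa_scal_def)

lemma sa_scal_scal [simp]: "sa_scal x (sa_scal y f) = sa_scal (x * y) f"
  by (simp add: sa_scal_def mult.assoc)

lemma sa_twist_zero [simp]: "sa_twist m e sa_zero = sa_zero"
  by (simp add: sa_twist_def sa_zero_def)

lemma sa_twist_even: "even e \<Longrightarrow> sa_twist m e f = f"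
  by (simp add: sa_twist_def)

lemma sa_twist_gen: "sa_twist m e (gen_prod m [g]) = sa_scal ((-1) ^ (e * (bp m (fst g) + bp m (snd g)))) (gen_prod m [g])"
  by (auto simp: sa_twist_def sa_scal_def gen_prod_def fun_eq_iff gen_odd_def minus_one_power_iff)

lemma sa_sum_single:
  assumes "finite S" "x \<in> S" "\<And>y. y \<in> S \<Longrightarrow> y \<noteq> x \<Longrightarrow> F y = sa_zero"
  shows "sa_sum F S = F x"
proof
  fix c
  have "(\<Sum>y\<in>S. F y c) = (\<Sum>y\<in>S. if y = x then F x c else 0)"
    by (rule sum.cong) (use assms(3) in \<open>auto simp: sa_zero_def\<close>)
  then show "sa_sum F S c = F x c" using assms by (simp add: sa_sum_def)
qed

lemma sa_sum_zero: "(\<And>y. y \<in> S \<Longrightarrow> F y = sa_zero) \<Longrightarrow> sa_sum F S = sa_zero"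
  by (simp add: sa_sum_def sa_zero_def)

lemma finite_idx [simp]: "finite (idx m n k)"
  unfolding idx_def using finite_lists_length_eq[of "{1..m+n}" k] by (simp add: conj_commute)

definition entry_parity :: "nat \<Rightarrow> nat list \<Rightarrow> nat list \<Rightarrow> nat \<Rightarrow> nat" where
  "entry_parity m I J a = bp m (I ! a) + bp m (J ! a)"

text \<open>A generator has the parity of its matrix unit; the exponent comes from moving the
  generators of later factors past the matrix units of earlier ones.\<close>

definition koszul_exp :: "nat \<Rightarrow> nat \<Rightarrow> nat list \<Rightarrow> nat list \<Rightarrow> nat" where
  "koszul_exp m k I J = (\<Sum>a<k. \<Sum>b<a. entry_parity m I J a * entry_parity m I J b)"

definition gen_list :: "nat \<Rightarrow> nat list \<Rightarrow> nat list \<Rightarrow> (nat \<times> nat) list" where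
  "gen_list k I J = map (\<lambda>a. (I ! a, J ! a)) [0..<k]"

lemma idx_length: "I \<in> idx m n k \<Longrightarrow> length I = k"
  by (simp add: idx_def)

lemma even_sum: "(\<And>x. x \<in> S \<Longrightarrow> even (f x :: nat)) \<Longrightarrow> even (sum f S)"
  by (rule dvd_sum) auto

lemma minus_one_power_cong: "even (x + y :: nat) \<Longrightarrow> (-1 :: complex) ^ x = (-1) ^ y"
  by (simp add: minus_one_power_iff)

text \<open>Every factor acts at a single tensor place, so after \<open>k'\<close> of them the two
  index tuples can differ only in the first \<open>k'\<close> places.\<close>

lemma Xfold:
  assumes I: "I \<in> idx m n k" and J: "J \<in> idx m n k" and "k' \<le> k"
  shows "foldl (\<lambda>T a. tmult m n k T (Xop a)) tone [0..<k'] I J =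
    (if \<forall>b. k' \<le> b \<and> b < k \<longrightarrow> I ! b = J ! b then sa_scal ((-1) ^ koszul_exp m k' I J) (gen_prod m (gen_list k' I J)) else sa_zero)"
  using assms
proof (induction k' arbitrary: J)
  case 0
  have "(\<forall>b. 0 \<le> b \<and> b < k \<longrightarrow> I ! b = J ! b) \<longleftrightarrow> I = J"
    using I 0 by (auto simp: idx_length list_eq_iff_nth_eq)
  then show ?case by (simp add: tone_def koszul_exp_def gen_list_def sa_one_gen_prod)
next
  case (Suc p)
  let ?T = "foldl (\<lambda>T a. tmult m n k T (Xop a)) tone [0..<p]"
  let ?F = "\<lambda>K. sa_scal (esign m k I K K J) (sa_mult m (?T I K) (sa_twist m (bsum m I + bsum m K) (Xop p K J)))"
  have p: "p < k" using Suc.prems by simp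
  have len: "length I = k" "length J = k" using I Suc.prems by (auto simp: idx_length)
  have step: "foldl (\<lambda>T a. tmult m n k T (Xop a)) tone [0..<Suc p] I J = sa_sum ?F (idx m n k)"
    by (simp add: tmult_def)
  \<comment> \<open>The only intermediate tuple that contributes: \<open>Xop p\<close> keeps all
    places except \<open>p\<close>, and the earlier factors have not touched place
    \<open>p\<close>.\<close>
  define K0 where "K0 = J[p := I ! p]"
  have lenK: "length K0 = k" by (simp add: K0_def len)
  have K0: "K0 \<in> idx m n k"
  proof -
    have "I ! p \<in> {1..m+n}" using I p nth_mem[of p I] unfolding idx_def by blast
    then show ?thesis using Suc.prems(2) set_update_subset_insert[of J p "I ! p"] by (auto simp: idx_def K0_def)
  qed
  have F0: "?F K = sa_zero" if K: "K \<in> idx m n k" and ne: "K \<noteq> K0 \<or> \<not> (\<forall>b. Suc p \<le> b \<and> b < k \<longrightarrow> I ! b = J ! b)" for K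
  proof (cases "(\<forall>b. p \<le> b \<and> b < k \<longrightarrow> I ! b = K ! b) \<and> (\<forall>b<k. b \<noteq> p \<longrightarrow> K ! b = J ! b)")
    case True
    have lK: "length K = k" using K by (rule idx_length)
    have "K = K0"
    proof (rule nth_equalityI)
      fix b assume "b < length K"
      then show "K ! b = K0 ! b" using True lK p len by (cases "b = p") (auto simp: K0_def)
    qed (simp add: lK lenK)
    moreover have "\<forall>b. Suc p \<le> b \<and> b < k \<longrightarrow> I ! b = J ! b"
    proof (intro allI impI)
      fix b assume b: "Suc p \<le> b \<and> b < k"
      then have "I ! b = K ! b" "K ! b = J ! b" using True by auto
      then show "I ! b = J ! b" by simp
    qed
    ultimately show ?thesis using ne by blast
  next
    case False
    then consider "?T I K = sa_zero" | "Xop p K J = sa_zero"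
      using Suc.IH[OF I K] p idx_length[OF K] len by (fastforce simp: Xop_def)
    then show ?thesis by cases simp_all
  qed
  show ?case
  proof (cases "\<forall>b. Suc p \<le> b \<and> b < k \<longrightarrow> I ! b = J ! b")
    case False
    have "sa_sum ?F (idx m n k) = sa_zero" by (rule sa_sum_zero) (rule F0, use False in auto)
    then show ?thesis using False step by auto
  next
    case True
    have "sa_sum ?F (idx m n k) = ?F K0"
      by (rule sa_sum_single[OF finite_idx K0]) (rule F0, auto)
    moreover have "?F K0 = sa_scal ((-1) ^ koszul_exp m (Suc p) I J) (gen_prod m (gen_list (Suc p) I J))"
    proof -
      have Kb: "K0 ! b = (if b = p then I ! p else J ! b)" if "b < k" for b
        using that len by (simp add: K0_def)
      have "\<forall>b. p \<le> b \<and> b < k \<longrightarrow> I ! b = K0 ! b" using True Kb by (auto simp: Suc_le_eq)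
      then have T: "?T I K0 = sa_scal ((-1) ^ koszul_exp m p I K0) (gen_prod m (gen_list p I K0))"
        using Suc.IH[OF I K0] p by simp
      have "koszul_exp m p I K0 = koszul_exp m p I J" unfolding koszul_exp_def entry_parity_def
        by (intro sum.cong refl) (use Kb p in auto)
      moreover have "gen_list p I K0 = gen_list p I J" using Kb p by (auto simp: gen_list_def)
      ultimately have T: "?T I K0 = sa_scal ((-1) ^ koszul_exp m p I J) (gen_prod m (gen_list p I J))" using T by simp
      have X: "Xop p K0 J = gen_prod m [(I ! p, J ! p)]"
        using Kb p len lenK by (auto simp: Xop_def sa_gen_gen_prod)
      \<comment> \<open>\<open>K0\<close> agrees with \<open>J\<close> away from place
        \<open>p\<close>, and with \<open>I\<close> from place \<open>p\<close> on, so every product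
        contains an even factor.\<close>
      have "even (\<Sum>u<k. \<Sum>v<u. (bp m (I ! u) + bp m (K0 ! u)) * (bp m (K0 ! v) + bp m (J ! v)))"
      proof (intro even_sum)
        fix u v assume u: "u \<in> {..<k}" and v: "v \<in> {..<u}"
        show "even ((bp m (I ! u) + bp m (K0 ! u)) * (bp m (K0 ! v) + bp m (J ! v)))"
        proof (cases "v = p")
          case True
          then have "I ! u = K0 ! u" using \<open>\<forall>b. p \<le> b \<and> b < k \<longrightarrow> I ! b = K0 ! b\<close> u v by auto
          then show ?thesis by simp
        next
          case False
          then have "K0 ! v = J ! v" using Kb u v by auto
          then show ?thesis by simp
        qed
      qed
      then have es: "esign m k I K0 K0 J = 1" by (simp add: esign_def)
      \<comment> \<open>The exponent of the twist is the total parity of the matrix units produced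
        so far; the places from \<open>p\<close> on contribute even numbers.\<close>
      have bs: "even (bsum m I + bsum m K0 + (\<Sum>b<p. entry_parity m I J b))"
      proof -
        have "bsum m I + bsum m K0 = (\<Sum>b<k. entry_parity m I K0 b)"
          by (simp add: bsum_def len lenK entry_parity_def sum.distrib)
        also have "{..<k} = {..<p} \<union> {p..<k}" using p by auto
        also have "(\<Sum>b\<in>\<dots>. entry_parity m I K0 b) = (\<Sum>b<p. entry_parity m I K0 b) + (\<Sum>b\<in>{p..<k}. entry_parity m I K0 b)"
          by (rule sum.union_disjoint) auto
        also have "(\<Sum>b<p. entry_parity m I K0 b) = (\<Sum>b<p. entry_parity m I J b)"
          by (rule sum.cong) (use Kb p in \<open>auto simp: entry_parity_def\<close>)
        finally have "bsum m I + bsum m K0 + (\<Sum>b<p. entry_parity m I J b) =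
            2 * (\<Sum>b<p. entry_parity m I J b) + (\<Sum>b\<in>{p..<k}. entry_parity m I K0 b)" by simp
        moreover have "even (\<Sum>b\<in>{p..<k}. entry_parity m I K0 b)"
          by (rule even_sum) (use \<open>\<forall>b. p \<le> b \<and> b < k \<longrightarrow> I ! b = K0 ! b\<close> in \<open>auto simp: entry_parity_def\<close>)
        ultimately show ?thesis by simp
      qed
      have xs: "koszul_exp m (Suc p) I J = koszul_exp m p I J + (\<Sum>b<p. entry_parity m I J b) * entry_parity m I J p"
        by (simp add: koszul_exp_def sum_distrib_left mult.commute)
      have "?F K0 = sa_scal ((-1) ^ koszul_exp m p I J * (-1) ^ ((bsum m I + bsum m K0) * entry_parity m I J p)) (gen_prod m (gen_list p I J @ [(I ! p, J ! p)]))"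
        by (simp add: es T X sa_twist_gen sa_mult_scal sa_mult_gen_prod entry_parity_def)
      also have "(-1 :: complex) ^ koszul_exp m p I J * (-1) ^ ((bsum m I + bsum m K0) * entry_parity m I J p) = (-1) ^ koszul_exp m (Suc p) I J"
        unfolding xs power_add
        by (rule arg_cong[of _ _ "(*) _"], rule minus_one_power_cong) (use bs in \<open>auto simp: distrib_right[symmetric]\<close>)
      finally show ?thesis by (simp add: gen_list_def)
    qed
    ultimately show ?thesis using True step by simp
  qed
qed

lemma Xprod_eq:
  assumes "I \<in> idx m n k" "J \<in> idx m n k"
  shows "Xprod m n k I J = sa_scal ((-1) ^ koszul_exp m k I J) (gen_prod m (gen_list k I J))"
  using Xfold[OF assms order.refl] by (simp add: Xprod_def)

section \<open>Permutations of index tuples and Koszul signs\<close>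

lemma length_pact [simp]: "length (pact \<sigma> J) = length J"
  by (simp add: pact_def)

lemma pact_nth: "a < length J \<Longrightarrow> pact \<sigma> J ! a = J ! (inv \<sigma> (Suc a) - 1)"
  by (simp add: pact_def)

lemma pact_pos:
  assumes "\<sigma> \<in> perms k" "length J = k" "x \<in> {1..k}"
  shows "pact \<sigma> J ! (\<sigma> x - 1) = J ! (x - 1)"
proof -
  have "\<sigma> x \<in> {1..k}" using assms by (auto simp: perms_iff permutes_in_image simp del: atLeastAtMost_iff)
  then show ?thesis using assms by (subst pact_nth) (auto simp: perms_inv_app)
qed

lemma pact_compose:
  assumes "\<sigma> \<in> perms k" "\<tau> \<in> perms k" "length J = k"
  shows "pact \<sigma> (pact \<tau> J) = pact (\<sigma> \<circ> \<tau>) J"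
proof (rule nth_equalityI)
  fix a assume a: "a < length (pact \<sigma> (pact \<tau> J))"
  have "inv \<sigma> (Suc a) \<in> {1..k}" using a assms perms_inv[OF assms(1)]
    by (subst permutes_in_image[of _ "{1..k}"]) (auto simp: perms_iff)
  then have "Suc (inv \<sigma> (Suc a) - 1) = inv \<sigma> (Suc a)" "inv \<sigma> (Suc a) - 1 < length J"
    using assms(3) by auto
  moreover have "inv (\<sigma> \<circ> \<tau>) = inv \<tau> \<circ> inv \<sigma>"
    using assms by (intro o_inv_distrib) (auto simp: perms_iff permutes_bij)
  ultimately show "pact \<sigma> (pact \<tau> J) ! a = pact (\<sigma> \<circ> \<tau>) J ! a"
    using a assms by (simp add: pact_nth)
qed simp

lemma pact_id [simp]: "pact id J = J"
  by (rule nth_equalityI) (auto simp: pact_nth)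

lemma pact_idx: "\<sigma> \<in> perms k \<Longrightarrow> J \<in> idx m n k \<Longrightarrow> pact \<sigma> J \<in> idx m n k"
proof -
  assume s: "\<sigma> \<in> perms k" and J: "J \<in> idx m n k"
  have "J ! (inv \<sigma> (Suc p) - 1) \<in> {1..m+n}" if "p < k" for p
  proof -
    have "inv \<sigma> (Suc p) \<in> {1..k}" using that perms_inv[OF s]
      by (subst permutes_in_image[of _ "{1..k}"]) (auto simp: perms_iff)
    then have "inv \<sigma> (Suc p) - 1 < length J" using J by (auto simp: idx_def)
    then show ?thesis using J nth_mem by (fastforce simp: idx_def)
  qed
  then show ?thesis using J by (auto simp: idx_def pact_def)
qed

lemma sum_pact:
  assumes "\<sigma> \<in> perms k" "length J = k"
  shows "(\<Sum>a<k. f (pact \<sigma> J ! a)) = (\<Sum>a<k. f (J ! a))"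
proof -
  have 1: "(\<Sum>a<k. f (L ! a)) = (\<Sum>x\<in>{1..k}. f (L ! (x - 1)))" for L :: "nat list"
    by (rule sum.reindex_bij_witness[where i = "\<lambda>x. x - 1" and j = Suc]) auto
  have "(\<Sum>x\<in>{1..k}. f (pact \<sigma> J ! (x - 1))) = (\<Sum>x\<in>{1..k}. f (pact \<sigma> J ! (\<sigma> x - 1)))"
    using sum.permute[of \<sigma> "{1..k}" "\<lambda>x. f (pact \<sigma> J ! (x - 1))"] assms by (simp add: perms_iff comp_def)
  also have "\<dots> = (\<Sum>x\<in>{1..k}. f (J ! (x - 1)))"
    by (rule sum.cong) (use pact_pos[OF assms] in auto)
  finally show ?thesis unfolding 1 .
qed

lemma bsum_pact: "\<sigma> \<in> perms k \<Longrightarrow> length J = k \<Longrightarrow> bsum m (pact \<sigma> J) = bsum m J"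
  using sum_pact[of \<sigma> k J "bp m"] by (simp add: bsum_def)

text \<open>Three sources: the sign of the supertrace, the expansion of \<open>\<sigma>\<close> in
  matrix units as in \<open>act_sign\<close>, and the sign in its action on tensors.\<close>

definition koszul_sign :: "nat \<Rightarrow> (nat \<Rightarrow> nat) \<Rightarrow> nat list \<Rightarrow> nat" where
  "koszul_sign m \<sigma> J = bsum m J + (\<Sum>a<length J. \<Sum>b<a. entry_parity m (pact \<sigma> J) J a * bp m (J ! b)) + pinv_sign m \<sigma> J"

text \<open>The summand of \<open>(-1)\<^bsup>|I|\<^esup> \<langle>I | \<sigma> X\<^sub>1 \<dots> X\<^sub>k | I\<rangle>\<close> with \<open>I = \<sigma> J\<close>: the signs of the two matrix products cancel.\<close>
definition koszul_term :: "nat \<Rightarrow> (nat \<Rightarrow> nat) \<Rightarrow> nat list \<Rightarrow> sa" where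
  "koszul_term m \<sigma> J = sa_scal ((-1) ^ koszul_sign m \<sigma> J) (gen_prod m (gen_list (length J) J (pact \<sigma> J)))"

lemma even_gam: "even (gam m I I)"
  unfolding gam_def by (intro dvd_add even_sum) (auto simp: bp_def intro: even_sum)

text \<open>For given \<open>\<sigma>\<close> a single intermediate tuple contributes, the preimage
  of \<open>I\<close>.\<close>

lemma Imm_koszul_term:
  assumes I: "I \<in> idx m n k"
  shows "Imm m n k f I = sa_sum (\<lambda>\<sigma>. sa_scal (f \<sigma>) (koszul_term m \<sigma> (pact (inv \<sigma>) I))) (perms k)"
proof
  fix c
  have len: "length I = k" using I by (rule idx_length)
  let ?y = "\<lambda>\<sigma> J. if I = pact \<sigma> J then act_sign m I J * (-1) ^ pinv_sign m \<sigma> J else 0"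
  let ?x = "\<lambda>J. \<Sum>\<sigma>\<in>perms k. f \<sigma> * ?y \<sigma> J"
  have g: "galg_op m k f I J = sa_scal (?x J) (gen_prod m [])" for J
    by (simp add: galg_op_def perm_op_def sa_sum_def sa_scal_def sum_distrib_right sa_one_gen_prod[symmetric] fun_eq_iff mult.assoc)
  have summand: "sa_scal (esign m k I J J I) (sa_mult m (galg_op m k f I J) (sa_twist m (bsum m I + bsum m J) (Xprod m n k J I)))
      = sa_scal (?x J * (esign m k I J J I * (-1) ^ koszul_exp m k J I)) (gen_prod m (gen_list k J I))" if J: "J \<in> idx m n k" for J
  proof (cases "\<exists>\<sigma>\<in>perms k. I = pact \<sigma> J")
    case True
    \<comment> \<open>A rearrangement keeps the total parity, so the twist is trivial.\<close>
    then have "bsum m I = bsum m J" using bsum_pact idx_length[OF J] by auto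
    then show ?thesis
      using sa_mult_scal[of m "?x J" "gen_prod m []" "(-1) ^ koszul_exp m k J I" "gen_prod m (gen_list k J I)"]
      by (simp add: sa_twist_even Xprod_eq[OF J I] g sa_mult_gen_prod mult_ac)
  next
    case False
    then have "?x J = 0" by (intro sum.neutral) auto
    then show ?thesis by (simp only: g) simp
  qed
  have es: "esign m k I J J I * (-1) ^ koszul_exp m k J I = 1" for J
    unfolding esign_def koszul_exp_def entry_parity_def power_add[symmetric]
    by (simp add: add.commute[of "bp m (J ! _)" "bp m (I ! _)"] flip: mult_2)
  have "Imm m n k f I c = (-1) ^ bsum m I * (\<Sum>J\<in>idx m n k. ?x J * gen_prod m (gen_list k J I) c)"
  proof -
    have "tmult m n k (galg_op m k f) (Xprod m n k) I I c = (\<Sum>J\<in>idx m n k. ?x J * gen_prod m (gen_list k J I) c)"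
      unfolding tmult_def sa_sum_def by (rule sum.cong[OF refl], subst summand) (simp_all add: es sa_scal_def)
    then show ?thesis using even_gam[of m I] by (simp add: Imm_def bra_def sa_scal_def)
  qed
  also have "(\<Sum>J\<in>idx m n k. ?x J * gen_prod m (gen_list k J I) c) =
      (\<Sum>\<sigma>\<in>perms k. \<Sum>J\<in>idx m n k. f \<sigma> * ?y \<sigma> J * gen_prod m (gen_list k J I) c)"
    unfolding sum_distrib_right by (rule sum.swap)
  also have "(-1) ^ bsum m I * \<dots> = (\<Sum>\<sigma>\<in>perms k. f \<sigma> * koszul_term m \<sigma> (pact (inv \<sigma>) I) c)"
  proof (subst sum_distrib_left, rule sum.cong[OF refl])
    fix \<sigma> assume s: "\<sigma> \<in> perms k"
    define J0 where "J0 = pact (inv \<sigma>) I"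
    have J0: "J0 \<in> idx m n k" unfolding J0_def using s I by (intro pact_idx perms_inv)
    have lenJ: "length J0 = k" by (simp add: J0_def len)
    have IJ: "I = pact \<sigma> J0"
      unfolding J0_def using s by (subst pact_compose[OF s perms_inv[OF s] len]) (simp add: perms_inv_o)
    have uniq: "J = J0" if "J \<in> idx m n k" "I = pact \<sigma> J" for J
      unfolding J0_def that(2) using s idx_length[OF that(1)]
      by (subst pact_compose[OF perms_inv[OF s] s]) (simp_all add: perms_inv_o)
    have "(\<Sum>J\<in>idx m n k. f \<sigma> * ?y \<sigma> J * gen_prod m (gen_list k J I) c) =
       (\<Sum>J\<in>idx m n k. if J = J0 then f \<sigma> * (act_sign m I J0 * (-1) ^ pinv_sign m \<sigma> J0) * gen_prod m (gen_list k J0 I) c else 0)"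
      by (rule sum.cong[OF refl]) (use uniq IJ in auto)
    also have "\<dots> = f \<sigma> * (act_sign m I J0 * (-1) ^ pinv_sign m \<sigma> J0) * gen_prod m (gen_list k J0 I) c"
      using J0 by simp
    finally show "(-1) ^ bsum m I * (\<Sum>J\<in>idx m n k. f \<sigma> * ?y \<sigma> J * gen_prod m (gen_list k J I) c) = f \<sigma> * koszul_term m \<sigma> (pact (inv \<sigma>) I) c"
      using bsum_pact[OF s lenJ, of m]
      by (simp add: J0_def[symmetric] koszul_term_def sa_scal_def koszul_sign_def lenJ power_add IJ[symmetric] act_sign_def entry_parity_def)
  qed
  finally show "Imm m n k f I c = sa_sum (\<lambda>\<sigma>. sa_scal (f \<sigma>) (koszul_term m \<sigma> (pact (inv \<sigma>) I))) (perms k) c"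
    by (simp add: sa_sum_def sa_scal_def)
qed

lemma str_Imm: "str m n k (tmult m n k (galg_op m k f) (Xprod m n k)) = sa_sum (Imm m n k f) (idx m n k)"
  by (simp add: str_def Imm_def[abs_def])

section \<open>Invariance of the signed summands under simultaneous conjugation\<close>

lemma gen_prod_sign_pair: "gen_prod_sign m [g,h] = (-1) ^ ((bp m (fst g) + bp m (snd g)) * (bp m (fst h) + bp m (snd h))) * gen_prod_sign m [h,g]"
proof -
  have g: "gen_prod_sign m [x,y] = mon_sign m {#x#} {#y#}" for x y
    by (simp add: mon_sign_alt odd_square_def inversions_def)
  have par: "(-1 :: complex) ^ ((bp m (fst g) + bp m (snd g)) * (bp m (fst h) + bp m (snd h))) =
     (if gen_odd m g \<and> gen_odd m h then - 1 else 1)"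
    by (simp add: minus_one_power_iff gen_odd_def)
  have b: "odd_square m ({#x#} + {#y#}) \<longleftrightarrow> gen_odd m x \<and> x = y" for x y
    by (auto simp: odd_square_def simp del: split_paired_Ex)
  have i: "inversions m {#x#} {#y#} = (if gen_odd m x \<and> gen_odd m y \<and> glt y x then {(x,y)} else {})" for x y
    by (auto simp: inversions_def)
  have tot: "glt g h \<longleftrightarrow> \<not> glt h g" if "g \<noteq> h"
    using that by (auto simp: glt_def prod_eq_iff)
  show ?thesis
    unfolding g mon_sign_alt b i par using tot by auto
qed

lemma gen_prod_swap: "gen_prod m (gs @ g # h # ks) =
  sa_scal ((-1) ^ ((bp m (fst g) + bp m (snd g)) * (bp m (fst h) + bp m (snd h)))) (gen_prod m (gs @ h # g # ks))"
proof -
  have e: "gen_prod_sign m (gs @ x # y # ks) = mon_sign m (mset gs) ({#x,y#} + mset ks) * (gen_prod_sign m gs * (mon_sign m {#x,y#} (mset ks) * (gen_prod_sign m [x,y] * gen_prod_sign m ks)))" for x y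
    using gen_prod_sign_append[of m gs "[x,y] @ ks"] gen_prod_sign_append[of m "[x,y]" ks] by simp
  have "{#g,h#} = {#h,g#}" by simp
  then have "gen_prod_sign m (gs @ g # h # ks) = (-1) ^ ((bp m (fst g) + bp m (snd g)) * (bp m (fst h) + bp m (snd h))) * gen_prod_sign m (gs @ h # g # ks)"
    unfolding e[of g h] e[of h g] gen_prod_sign_pair[of m g h] by (simp only: mult_ac)
  then show ?thesis by (simp add: gen_prod_def sa_scal_def fun_eq_iff add_mset_commute)
qed

definition lower_pairs :: "nat \<Rightarrow> (nat \<times> nat) set" where
  "lower_pairs k = {(a,b). b < a \<and> a < k}"

lemma finite_lower_pairs [simp]: "finite (lower_pairs k)"
  by (rule finite_subset[of _ "{..<k} \<times> {..<k}"]) (auto simp: lower_pairs_def)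

lemma lower_pairs_sum: "(\<Sum>a<k. \<Sum>b<a. F a b) = (\<Sum>(a,b)\<in>lower_pairs k. F a b)"
proof -
  have "lower_pairs k = (SIGMA a:{..<k}. {..<a})" by (auto simp: lower_pairs_def)
  then show ?thesis by (simp add: sum.Sigma)
qed

text \<open>An adjacent exchange permutes the lower pairs, except that \<open>(Suc d, d)\<close> is
  turned around.\<close>

lemma lower_pairs_sum_swap:
  fixes F :: "nat \<Rightarrow> nat \<Rightarrow> nat"
  assumes "Suc d < k"
  shows "(\<Sum>(a,b)\<in>lower_pairs k. F (transpose d (Suc d) a) (transpose d (Suc d) b)) + F (Suc d) d =
    (\<Sum>(a,b)\<in>lower_pairs k. F a b) + F d (Suc d)"
proof -
  let ?t = "transpose d (Suc d)" and ?D = "lower_pairs k - {(Suc d, d)}"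
  have D: "(Suc d, d) \<in> lower_pairs k" using assms by (simp add: lower_pairs_def)
  have inv: "(?t a, ?t b) \<in> ?D" if "(a,b) \<in> ?D" for a b
    using that assms by (auto simp: lower_pairs_def transpose_def)
  have "(\<Sum>(a,b)\<in>?D. F (?t a) (?t b)) = (\<Sum>(a,b)\<in>?D. F a b)"
    by (rule sum.reindex_bij_witness[where i = "\<lambda>(a,b). (?t a, ?t b)" and j = "\<lambda>(a,b). (?t a, ?t b)"])
      (use inv in auto)
  then show ?thesis by (simp add: sum.remove[OF finite_lower_pairs D])
qed

lemma pinv_alt:
  "pinv_sign m \<sigma> J = (\<Sum>(a,b)\<in>lower_pairs (length J). if \<sigma> (Suc a) < \<sigma> (Suc b) then bp m (J ! b) * bp m (J ! a) else 0)"
proof -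
  let ?k = "length J"
  let ?f = "\<lambda>p q. if p < q \<and> \<sigma> q < \<sigma> p then bp m (J ! (p - 1)) * bp m (J ! (q - 1)) else 0"
  have "pinv_sign m \<sigma> J = (\<Sum>(p,q)\<in>{1..?k} \<times> {1..?k}. ?f p q)"
    by (simp add: pinv_sign_def sum.cartesian_product)
  also have "\<dots> = (\<Sum>(p,q)\<in>(\<lambda>(a,b). (Suc b, Suc a)) ` lower_pairs ?k. ?f p q)"
  proof (rule sum.mono_neutral_right)
    show "\<forall>i\<in>{1..?k} \<times> {1..?k} - (\<lambda>(a,b). (Suc b, Suc a)) ` lower_pairs ?k. (case i of (p,q) \<Rightarrow> ?f p q) = 0"
    proof
      fix i assume i: "i \<in> {1..?k} \<times> {1..?k} - (\<lambda>(a,b). (Suc b, Suc a)) ` lower_pairs ?k"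
      obtain p q where pq: "i = (p,q)" by (cases i)
      have "\<not> p < q"
      proof
        assume "p < q"
        then have "(q - 1, p - 1) \<in> lower_pairs ?k" "(p,q) = (Suc (p - 1), Suc (q - 1))" using i pq by (auto simp: lower_pairs_def)
        then have "i \<in> (\<lambda>(a,b). (Suc b, Suc a)) ` lower_pairs ?k" unfolding pq by (intro image_eqI[of _ _ "(q - 1, p - 1)"]) auto
        then show False using i by blast
      qed
      then show "(case i of (p,q) \<Rightarrow> ?f p q) = 0" by (simp add: pq)
    qed
  qed (auto simp: lower_pairs_def)
  also have "\<dots> = (\<Sum>(a,b)\<in>lower_pairs ?k. ?f (Suc b) (Suc a))"
    by (subst sum.reindex) (auto simp: inj_on_def intro!: sum.cong)
  also have "\<dots> = (\<Sum>(a,b)\<in>lower_pairs ?k. if \<sigma> (Suc a) < \<sigma> (Suc b) then bp m (J ! b) * bp m (J ! a) else 0)"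
    by (rule sum.cong) (auto simp: lower_pairs_def)
  finally show ?thesis .
qed

text \<open>Bookkeeping for the next lemma: \<open>x\<close> and \<open>y\<close> correct the Koszul
  sum, \<open>f\<close> and \<open>g\<close> the inversions under right multiplication,
  \<open>z\<close> those under left multiplication, and \<open>e\<close> comes from exchanging two
  generators.\<close>

lemma parity_combine:
  fixes S1 :: nat
  assumes "S1' + x = S1 + y" "P' + f = Q + g" "f + g = w" "even (P + Q + z)" "even (x + y + w + z + e)"
  shows "even ((B + S1' + P') + ((B + S1 + P) + e))"
  using assms by presburger

text \<open>For an adjacent transposition two neighbouring generators change places, and every
  correction to the sign is a product of the parities \<open>i\<close>, \<open>i'\<close>,
  \<open>j\<close>, \<open>j'\<close>; these corrections add up to an even number.\<close>

lemma koszul_term_conj_adj: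
  assumes s: "\<sigma> \<in> perms k" and len: "length J = k" and d: "Suc d < k"
  defines "\<tau> \<equiv> transpose (Suc d) (Suc (Suc d))"
  shows "koszul_term m (\<tau> \<circ> \<sigma> \<circ> \<tau>) (pact \<tau> J) = koszul_term m \<sigma> J"
proof -
  let ?t = "transpose d (Suc d)"
  have tp: "\<tau> \<in> perms k" unfolding \<tau>_def using d by (intro perms_transpose) auto
  have inv\<tau>: "inv \<tau> = \<tau>" by (simp add: \<tau>_def)
  have tS: "\<tau> (Suc a) = Suc (?t a)" for a by (simp add: \<tau>_def transpose_def)
  have tk: "?t a < k \<longleftrightarrow> a < k" for a using d by (auto simp: transpose_def)
  have tt: "\<tau> \<circ> \<tau> = id" by (simp add: \<tau>_def)
  define I where "I = pact \<sigma> J"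
  have lenI: "length I = k" by (simp add: I_def len)
  have nth: "pact \<tau> L ! a = L ! (?t a)" if "a < k" "length L = k" for L a
    using that by (simp add: pact_nth inv\<tau> tS)
  have I': "pact (\<tau> \<circ> \<sigma> \<circ> \<tau>) (pact \<tau> J) = pact \<tau> I"
  proof -
    have "pact (\<tau> \<circ> \<sigma> \<circ> \<tau>) (pact \<tau> J) = pact (\<tau> \<circ> \<sigma> \<circ> \<tau> \<circ> \<tau>) J"
      by (rule pact_compose) (use tp s len in \<open>auto intro: perms_comp\<close>)
    also have "\<tau> \<circ> \<sigma> \<circ> \<tau> \<circ> \<tau> = \<tau> \<circ> \<sigma>" by (simp add: comp_assoc tt)
    also have "pact (\<tau> \<circ> \<sigma>) J = pact \<tau> I" unfolding I_def by (rule pact_compose[symmetric]) (use tp s len in auto)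
    finally show ?thesis .
  qed
  define i where "i = bp m (I ! d)"
  define i' where "i' = bp m (I ! Suc d)"
  define j where "j = bp m (J ! d)"
  define j' where "j' = bp m (J ! Suc d)"
  let ?L = "gen_list k J I"
  have lenL: "length ?L = k" by (simp add: gen_list_def)
  have L: "?L = take d ?L @ (J ! d, I ! d) # (J ! Suc d, I ! Suc d) # drop (Suc (Suc d)) ?L"
    using id_take_nth_drop[of d ?L] Cons_nth_drop_Suc[of "Suc d" ?L] d by (simp add: gen_list_def)
  have L': "gen_list k (pact \<tau> J) (pact \<tau> I) = take d ?L @ (J ! Suc d, I ! Suc d) # (J ! d, I ! d) # drop (Suc (Suc d)) ?L"
  proof (rule nth_equalityI)
    fix a assume "a < length (gen_list k (pact \<tau> J) (pact \<tau> I))"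
    then have a: "a < k" by (simp add: gen_list_def)
    then have "gen_list k (pact \<tau> J) (pact \<tau> I) ! a = (J ! ?t a, I ! ?t a)"
      by (simp add: gen_list_def nth len lenI)
    moreover consider "a < d" | "a = d" | "a = Suc d" | "Suc d < a" by linarith
    then have "(take d ?L @ (J ! Suc d, I ! Suc d) # (J ! d, I ! d) # drop (Suc (Suc d)) ?L) ! a = (J ! ?t a, I ! ?t a)"
    proof cases
      case 4
      then obtain e where "a = Suc (Suc d) + e" using less_iff_Suc_add by auto
      then show ?thesis using a d by (simp add: nth_append gen_list_def)
    qed (use a d in \<open>simp_all add: nth_append gen_list_def\<close>)
    ultimately show "gen_list k (pact \<tau> J) (pact \<tau> I) ! a = (take d ?L @ (J ! Suc d, I ! Suc d) # (J ! d, I ! d) # drop (Suc (Suc d)) ?L) ! a"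
      by simp
  qed (use d in \<open>simp add: gen_list_def\<close>)
  have g: "gen_prod m ?L = sa_scal ((-1) ^ ((j + i) * (j' + i'))) (gen_prod m (gen_list k (pact \<tau> J) (pact \<tau> I)))"
    by (subst L, subst gen_prod_swap) (simp add: L' i_def i'_def j_def j'_def)
  define S1 where "S1 = (\<Sum>(a,b)\<in>lower_pairs k. entry_parity m I J a * bp m (J ! b))"
  define S1' where "S1' = (\<Sum>(a,b)\<in>lower_pairs k. entry_parity m I J (?t a) * bp m (J ! ?t b))"
  define P where "P = pinv_sign m \<sigma> J"
  define P' where "P' = pinv_sign m (\<tau> \<circ> \<sigma> \<circ> \<tau>) (pact \<tau> J)"
  let ?F1 = "\<lambda>a b. if \<sigma> (Suc a) < \<sigma> (Suc b) then bp m (J ! b) * bp m (J ! a) else 0"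
  let ?F2 = "\<lambda>a b. if \<tau> (\<sigma> (Suc a)) < \<tau> (\<sigma> (Suc b)) then bp m (J ! b) * bp m (J ! a) else 0"
  \<comment> \<open>The inversion sum of \<open>\<tau> \<circ> \<sigma>\<close>, half way between
    \<open>\<sigma>\<close> and its conjugate.\<close>
  define Q where "Q = (\<Sum>(a,b)\<in>lower_pairs k. ?F2 a b)"
  have inj: "\<sigma> x = \<sigma> y \<longleftrightarrow> x = y" for x y
    by (rule inj_eq) (use s perms_iff permutes_inj in blast)
  have inj\<tau>: "\<tau> x = \<tau> y \<longleftrightarrow> x = y" for x y
    by (rule inj_eq) (use tp perms_iff permutes_inj in blast)
  have 1: "S1' + (j' + i') * j = S1 + (j + i) * j'"
    using lower_pairs_sum_swap[OF d, of "\<lambda>a b. entry_parity m I J a * bp m (J ! b)"]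
    by (simp add: S1_def S1'_def entry_parity_def i_def i'_def j_def j'_def add.commute)
  have P'_eq: "P' = (\<Sum>(a,b)\<in>lower_pairs k. ?F2 (?t a) (?t b))"
    unfolding P'_def pinv_alt by (rule sum.cong) (auto simp: lower_pairs_def nth len tS)
  have 2: "P' + ?F2 (Suc d) d = Q + ?F2 d (Suc d)"
    unfolding P'_eq Q_def by (rule lower_pairs_sum_swap[OF d])
  have 3: "?F2 (Suc d) d + ?F2 d (Suc d) = j * j'"
  proof -
    have "\<tau> (\<sigma> (Suc d)) \<noteq> \<tau> (\<sigma> (Suc (Suc d)))" by (simp add: inj inj\<tau>)
    then have "\<tau> (\<sigma> (Suc d)) < \<tau> (\<sigma> (Suc (Suc d))) \<longleftrightarrow> \<not> \<tau> (\<sigma> (Suc (Suc d))) < \<tau> (\<sigma> (Suc d))"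
      by linarith
    then show ?thesis by (simp add: j_def j'_def)
  qed
  \<comment> \<open>Composing with \<open>\<tau>\<close> on the left reverses the order only at the
    two places that \<open>\<sigma>\<close> sends to \<open>Suc d\<close> and
    \<open>Suc (Suc d)\<close>; the letters there have parities \<open>i\<close> and
    \<open>i'\<close>.\<close>
  have 4: "even (P + Q + i * i')"
  proof -
    define u where "u = inv \<sigma> (Suc d) - 1"
    define v where "v = inv \<sigma> (Suc (Suc d)) - 1"
    have in1: "inv \<sigma> (Suc d) \<in> {1..k}" "inv \<sigma> (Suc (Suc d)) \<in> {1..k}"
      using perms_inv[OF s] d by (simp_all add: perms_iff permutes_in_image del: One_nat_def atLeastAtMost_iff, simp_all)
    have u: "u < k" "\<sigma> (Suc u) = Suc d" "i = bp m (J ! u)"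
      using in1 d s by (auto simp: u_def perms_inv_app i_def I_def pact_nth len)
    have v: "v < k" "\<sigma> (Suc v) = Suc (Suc d)" "i' = bp m (J ! v)"
      using in1 d s by (auto simp: v_def perms_inv_app i'_def I_def pact_nth len)
    have uv: "u \<noteq> v" using u v by auto
    define x where "x = max u v"
    define y where "y = min u v"
    have xy: "(x,y) \<in> lower_pairs k" using u v uv by (auto simp: x_def y_def lower_pairs_def)
    have Fxy: "?F1 x y + ?F2 x y = i * i'"
      using u v uv by (cases "u < v") (auto simp: x_def y_def \<tau>_def max_def min_def)
    have rest: "even (?F1 a b + ?F2 a b)" if ab: "(a,b) \<in> lower_pairs k - {(x,y)}" for a b
    proof -
      have ne: "\<sigma> (Suc a) \<noteq> \<sigma> (Suc b)" using ab by (auto simp: inj lower_pairs_def)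
      have "\<not> (\<sigma> (Suc a) = Suc d \<and> \<sigma> (Suc b) = Suc (Suc d))" "\<not> (\<sigma> (Suc b) = Suc d \<and> \<sigma> (Suc a) = Suc (Suc d))"
      proof -
        have "a = u \<and> b = v \<Longrightarrow> False" "a = v \<and> b = u \<Longrightarrow> False"
          using ab by (auto simp: x_def y_def lower_pairs_def max_def min_def)
        moreover have "\<sigma> (Suc c) = Suc d \<longleftrightarrow> c = u" "\<sigma> (Suc c) = Suc (Suc d) \<longleftrightarrow> c = v" for c
          using u(2) v(2) inj[of "Suc c" "Suc u"] inj[of "Suc c" "Suc v"] by auto
        ultimately show "\<not> (\<sigma> (Suc a) = Suc d \<and> \<sigma> (Suc b) = Suc (Suc d))" "\<not> (\<sigma> (Suc b) = Suc d \<and> \<sigma> (Suc a) = Suc (Suc d))"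
          by blast+
      qed
      then have "\<tau> (\<sigma> (Suc a)) < \<tau> (\<sigma> (Suc b)) \<longleftrightarrow> \<sigma> (Suc a) < \<sigma> (Suc b)"
        using ne by (auto simp: \<tau>_def transpose_def)
      then show ?thesis by simp
    qed
    have "P + Q = (\<Sum>(a,b)\<in>lower_pairs k. ?F1 a b + ?F2 a b)"
      unfolding P_def Q_def pinv_alt len by (simp add: sum.distrib case_prod_unfold)
    also have "\<dots> = i * i' + (\<Sum>(a,b)\<in>lower_pairs k - {(x,y)}. ?F1 a b + ?F2 a b)"
      using Fxy by (simp only: sum.remove[OF finite_lower_pairs xy] prod.case)
    finally have eq: "P + Q + i * i' = 2 * (i * i') + (\<Sum>(a,b)\<in>lower_pairs k - {(x,y)}. ?F1 a b + ?F2 a b)" by simp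
    have ev: "even (\<Sum>(a,b)\<in>lower_pairs k - {(x,y)}. ?F1 a b + ?F2 a b)"
    proof (rule even_sum)
      fix z assume z: "z \<in> lower_pairs k - {(x,y)}"
      obtain a b where ab: "z = (a,b)" by (cases z)
      show "even (case z of (a,b) \<Rightarrow> ?F1 a b + ?F2 a b)"
        using rest[of a b] z unfolding ab prod.case .
    qed
    show ?thesis unfolding eq by (rule dvd_add[OF dvd_triv_left ev])
  qed
  have "(j' + i') * j + (j + i) * j' + j * j' + i * i' + (j + i) * (j' + i') = 2 * (2 * (j * j') + i' * j + i * j' + i * i')"
    by (simp add: algebra_simps)
  then have 5: "even ((j' + i') * j + (j + i) * j' + j * j' + i * i' + (j + i) * (j' + i'))" by (simp only: dvd_triv_left)
  have "even ((bsum m J + S1' + P') + ((bsum m J + S1 + P) + (j + i) * (j' + i')))"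
    by (rule parity_combine[OF 1 2 3 4 5])
  moreover have "koszul_sign m \<sigma> J = bsum m J + S1 + P"
    by (simp add: koszul_sign_def lower_pairs_sum len S1_def P_def I_def)
  moreover have "koszul_sign m (\<tau> \<circ> \<sigma> \<circ> \<tau>) (pact \<tau> J) = bsum m J + S1' + P'"
  proof -
    have "(\<Sum>(a,b)\<in>lower_pairs k. entry_parity m (pact \<tau> I) (pact \<tau> J) a * bp m (pact \<tau> J ! b)) = S1'"
      unfolding S1'_def by (rule sum.cong) (auto simp: lower_pairs_def nth len lenI entry_parity_def)
    then show ?thesis by (simp add: koszul_sign_def lower_pairs_sum len I' bsum_pact[OF tp len] P'_def)
  qed
  ultimately have "(-1 :: complex) ^ koszul_sign m (\<tau> \<circ> \<sigma> \<circ> \<tau>) (pact \<tau> J) = (-1) ^ (koszul_sign m \<sigma> J + (j + i) * (j' + i'))"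
    by (intro minus_one_power_cong) simp
  then show ?thesis
    unfolding koszul_term_def I' length_pact len I_def[symmetric] g by (simp add: power_add)
qed

definition conj_invariant :: "nat \<Rightarrow> nat \<Rightarrow> (nat \<Rightarrow> nat) \<Rightarrow> bool" where
  "conj_invariant m k \<tau> \<longleftrightarrow> \<tau> \<in> perms k \<and> (\<forall>\<sigma>\<in>perms k. \<forall>J. length J = k \<longrightarrow> koszul_term m (\<tau> \<circ> \<sigma> \<circ> inv \<tau>) (pact \<tau> J) = koszul_term m \<sigma> J)"

lemma conj_invariant_comp:
  assumes "conj_invariant m k \<tau>" "conj_invariant m k \<tau>'"
  shows "conj_invariant m k (\<tau> \<circ> \<tau>')"
  unfolding conj_invariant_def
proof (intro conjI ballI allI impI)
  have p: "\<tau> \<in> perms k" "\<tau>' \<in> perms k" using assms by (auto simp: conj_invariant_def)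
  then show "\<tau> \<circ> \<tau>' \<in> perms k" by (rule perms_comp)
  fix \<sigma> and J :: "nat list" assume s: "\<sigma> \<in> perms k" "length J = k"
  have "inv (\<tau> \<circ> \<tau>') = inv \<tau>' \<circ> inv \<tau>"
    using p by (intro o_inv_distrib) (auto simp: perms_iff permutes_bij)
  then have "\<tau> \<circ> \<tau>' \<circ> \<sigma> \<circ> inv (\<tau> \<circ> \<tau>') = \<tau> \<circ> (\<tau>' \<circ> \<sigma> \<circ> inv \<tau>') \<circ> inv \<tau>" by (simp add: comp_assoc)
  moreover have "pact (\<tau> \<circ> \<tau>') J = pact \<tau> (pact \<tau>' J)" by (rule pact_compose[symmetric]) (use p s in auto)
  ultimately show "koszul_term m (\<tau> \<circ> \<tau>' \<circ> \<sigma> \<circ> inv (\<tau> \<circ> \<tau>')) (pact (\<tau> \<circ> \<tau>') J) = koszul_term m \<sigma> J"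
    using assms s p perms_comp perms_inv by (simp add: conj_invariant_def)
qed

lemma conj_invariant_transpose:
  assumes "1 \<le> a" "a < b" "b \<le> k"
  shows "conj_invariant m k (transpose a b)"
  using assms
proof (induction "b - a" arbitrary: a rule: less_induct)
  case less
  have adj: "conj_invariant m k (transpose a (Suc a))"
  proof -
    have "koszul_term m (transpose a (Suc a) \<circ> \<sigma> \<circ> transpose a (Suc a)) (pact (transpose a (Suc a)) J) = koszul_term m \<sigma> J"
      if "\<sigma> \<in> perms k" "length J = k" for \<sigma> J
      using koszul_term_conj_adj[OF that, of "a - 1" m] less.prems by simp
    then show ?thesis using less.prems perms_transpose[of a k "Suc a"] by (simp add: conj_invariant_def)
  qed
  show ?case
  proof (cases "b = Suc a")
    case False
    then have "conj_invariant m k (transpose (Suc a) b)" using less.prems by (intro less.hyps) auto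
    then have "conj_invariant m k (transpose a (Suc a) \<circ> transpose (Suc a) b \<circ> transpose a (Suc a))"
      using adj conj_invariant_comp by blast
    moreover have "transpose a (Suc a) \<circ> transpose (Suc a) b \<circ> transpose a (Suc a) = transpose a b"
      using False less.prems by (auto simp: fun_eq_iff transpose_def)
    ultimately show ?thesis by simp
  qed (simp add: adj)
qed

lemma conj_invariant_id: "conj_invariant m k id"
  by (auto simp: conj_invariant_def perms_iff permutes_id)

lemma conj_invariant_perms:
  assumes "\<tau> \<in> perms k"
  shows "conj_invariant m k \<tau>"
proof -
  have "\<tau> permutes {1..k}" using assms by (simp add: perms_iff)
  then show ?thesis
  proof (rule permutes_induct)
    fix a b p assume ab: "a \<in> {1..k}" "b \<in> {1..k}" and p: "p permutes {1..k}" "conj_invariant m k p"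
    have "conj_invariant m k (transpose a b)"
      using ab conj_invariant_transpose[of a b k m] conj_invariant_transpose[of b a k m] conj_invariant_id
      by (cases a b rule: linorder_cases) (auto simp: transpose_commute)
    then show "conj_invariant m k (transpose a b \<circ> p)" using p conj_invariant_comp by blast
  qed (rule finite_atLeastAtMost, rule conj_invariant_id)
qed

lemma koszul_term_conj:
  assumes "\<tau> \<in> perms k" "\<sigma> \<in> perms k" "length J = k"
  shows "koszul_term m (\<tau> \<circ> \<sigma> \<circ> inv \<tau>) (pact \<tau> J) = koszul_term m \<sigma> J"
  using conj_invariant_perms[OF assms(1), of m] assms by (simp add: conj_invariant_def)

section \<open>The supertrace as a function of the permutation\<close>

definition str_perm :: "nat \<Rightarrow> nat \<Rightarrow> nat \<Rightarrow> (nat \<Rightarrow> nat) \<Rightarrow> sa" where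
  "str_perm m n k \<sigma> = sa_sum (koszul_term m \<sigma>) (idx m n k)"

lemma pact_inv_cancel:
  assumes "\<sigma> \<in> perms k" "length J = k"
  shows "pact \<sigma> (pact (inv \<sigma>) J) = J" "pact (inv \<sigma>) (pact \<sigma> J) = J"
  using pact_compose[OF assms(1) perms_inv[OF assms(1)] assms(2)] pact_compose[OF perms_inv[OF assms(1)] assms(1) assms(2)]
  by (simp_all add: perms_inv_o[OF assms(1)])

lemma sum_idx_pact:
  assumes "\<tau> \<in> perms k"
  shows "(\<Sum>J\<in>idx m n k. f (pact \<tau> J)) = (\<Sum>J\<in>idx m n k. f J)"
  by (rule sum.reindex_bij_witness[where i = "pact (inv \<tau>)" and j = "pact \<tau>"])
    (use assms in \<open>auto simp: pact_inv_cancel idx_length pact_idx perms_inv\<close>)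

text \<open>Conjugation only permutes the summands, by \<open>koszul_term_conj\<close>.\<close>

lemma classfn_str_perm: "classfn k (\<lambda>\<sigma>. str_perm m n k \<sigma> c)"
  unfolding classfn_def
proof (intro ballI)
  fix \<sigma> \<tau> assume st: "\<sigma> \<in> perms k" "\<tau> \<in> perms k"
  have "str_perm m n k (\<tau> \<circ> \<sigma> \<circ> inv \<tau>) c = (\<Sum>J\<in>idx m n k. koszul_term m (\<tau> \<circ> \<sigma> \<circ> inv \<tau>) (pact \<tau> J) c)"
    unfolding str_perm_def sa_sum_def by (rule sum_idx_pact[OF st(2), symmetric])
  also have "\<dots> = str_perm m n k \<sigma> c"
    unfolding str_perm_def sa_sum_def by (rule sum.cong) (auto simp: koszul_term_conj[OF st(2,1)] idx_length)
  finally show "str_perm m n k (\<tau> \<circ> \<sigma> \<circ> inv \<tau>) c = str_perm m n k \<sigma> c" .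
qed

lemma str_str_perm:
  "str m n k (tmult m n k (galg_op m k f) (Xprod m n k)) = (\<lambda>c. \<Sum>\<sigma>\<in>perms k. f \<sigma> * str_perm m n k \<sigma> c)"
proof
  fix c
  have "str m n k (tmult m n k (galg_op m k f) (Xprod m n k)) c =
     (\<Sum>I\<in>idx m n k. \<Sum>\<sigma>\<in>perms k. f \<sigma> * koszul_term m \<sigma> (pact (inv \<sigma>) I) c)"
    unfolding str_Imm sa_sum_def by (rule sum.cong) (simp_all add: Imm_koszul_term sa_sum_def sa_scal_def)
  also have "\<dots> = (\<Sum>\<sigma>\<in>perms k. \<Sum>I\<in>idx m n k. f \<sigma> * koszul_term m \<sigma> (pact (inv \<sigma>) I) c)"
    by (rule sum.swap)
  also have "\<dots> = (\<Sum>\<sigma>\<in>perms k. f \<sigma> * str_perm m n k \<sigma> c)"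
  proof (rule sum.cong[OF refl])
    fix \<sigma> assume "\<sigma> \<in> perms k"
    then show "(\<Sum>I\<in>idx m n k. f \<sigma> * koszul_term m \<sigma> (pact (inv \<sigma>) I) c) = f \<sigma> * str_perm m n k \<sigma> c"
      using sum_idx_pact[OF perms_inv, of \<sigma> k "\<lambda>J. f \<sigma> * koszul_term m \<sigma> J c" m n]
      by (simp add: str_perm_def sa_sum_def sum_distrib_left)
  qed
  finally show "str m n k (tmult m n k (galg_op m k f) (Xprod m n k)) c = (\<Sum>\<sigma>\<in>perms k. f \<sigma> * str_perm m n k \<sigma> c)" .
qed

text \<open>The immanant of a class function depends only on the multiset of indices; this reduces
  the sum over all tuples to non-decreasing ones.\<close>

lemma Imm_pact:
  assumes "classfn k f" "\<tau> \<in> perms k" "I \<in> idx m n k"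
  shows "Imm m n k f (pact \<tau> I) = Imm m n k f I"
proof
  fix c
  have len: "length I = k" using assms(3) by (rule idx_length)
  have i: "inv \<tau> \<circ> (\<tau> \<circ> g) = g" "\<tau> \<circ> (inv \<tau> \<circ> g) = g" for g :: "nat \<Rightarrow> nat"
    using perms_inv_o[OF assms(2)] by (simp_all add: comp_assoc[symmetric])
  have "Imm m n k f (pact \<tau> I) c = (\<Sum>\<sigma>\<in>perms k. f \<sigma> * koszul_term m \<sigma> (pact (inv \<sigma>) (pact \<tau> I)) c)"
    using Imm_koszul_term[OF pact_idx[OF assms(2,3)]] by (simp add: sa_sum_def sa_scal_def)
  also have "\<dots> = (\<Sum>\<sigma>\<in>perms k. f \<sigma> * koszul_term m \<sigma> (pact (inv \<sigma>) I) c)"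
  proof (rule sum.reindex_bij_witness[symmetric, where j = "\<lambda>\<sigma>. \<tau> \<circ> \<sigma> \<circ> inv \<tau>" and i = "\<lambda>\<sigma>. inv \<tau> \<circ> \<sigma> \<circ> \<tau>"])
    fix \<sigma> assume s: "\<sigma> \<in> perms k"
    show "\<tau> \<circ> \<sigma> \<circ> inv \<tau> \<in> perms k" "inv \<tau> \<circ> \<sigma> \<circ> \<tau> \<in> perms k"
      using s assms perms_comp perms_inv by auto
    show "inv \<tau> \<circ> (\<tau> \<circ> \<sigma> \<circ> inv \<tau>) \<circ> \<tau> = \<sigma>" "\<tau> \<circ> (inv \<tau> \<circ> \<sigma> \<circ> \<tau>) \<circ> inv \<tau> = \<sigma>"
      using perms_inv_o[OF assms(2)] by (simp_all add: comp_assoc i)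
    have t: "\<tau> permutes {1..k}" "\<sigma> permutes {1..k}" using s assms by (auto simp: perms_iff)
    have "inv (\<tau> \<circ> \<sigma> \<circ> inv \<tau>) = \<tau> \<circ> inv \<sigma> \<circ> inv \<tau>"
    proof -
      have b: "bij \<tau>" "bij \<sigma>" "bij (inv \<tau>)" using t by (auto intro: permutes_bij permutes_inv)
      have "inv (\<tau> \<circ> \<sigma> \<circ> inv \<tau>) = inv (inv \<tau>) \<circ> inv (\<tau> \<circ> \<sigma>)"
        by (rule o_inv_distrib[OF bij_comp[OF b(2,1)] b(3)])
      then show ?thesis by (simp only: o_inv_distrib[OF b(1,2)] inv_inv_eq[OF b(1)] comp_assoc)
    qed
    then have "pact (inv (\<tau> \<circ> \<sigma> \<circ> inv \<tau>)) (pact \<tau> I) = pact (\<tau> \<circ> inv \<sigma> \<circ> inv \<tau> \<circ> \<tau>) I"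
      using pact_compose[of "\<tau> \<circ> inv \<sigma> \<circ> inv \<tau>" k \<tau> I] s assms len perms_comp perms_inv by simp
    also have "\<dots> = pact \<tau> (pact (inv \<sigma>) I)"
      using pact_compose[OF assms(2) perms_inv[OF s] len] perms_inv_o[OF assms(2)] by (simp add: comp_assoc)
    finally show "f (\<tau> \<circ> \<sigma> \<circ> inv \<tau>) * koszul_term m (\<tau> \<circ> \<sigma> \<circ> inv \<tau>) (pact (inv (\<tau> \<circ> \<sigma> \<circ> inv \<tau>)) (pact \<tau> I)) c
        = f \<sigma> * koszul_term m \<sigma> (pact (inv \<sigma>) I) c"
      using classfnD[OF assms(1) s assms(2)] koszul_term_conj[OF assms(2) s] len by simp
  qed
  also have "\<dots> = Imm m n k f I c"
    using Imm_koszul_term[OF assms(3)] by (simp add: sa_sum_def sa_scal_def)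
  finally show "Imm m n k f (pact \<tau> I) c = Imm m n k f I c" .
qed

section \<open>Block permutations and multiplicativity of the supertrace\<close>

definition block_sum :: "nat \<Rightarrow> (nat \<Rightarrow> nat) \<Rightarrow> (nat \<Rightarrow> nat) \<Rightarrow> nat \<Rightarrow> nat" where
  "block_sum k \<sigma> \<tau> x = (if x \<le> k then \<sigma> x else \<tau> (x - k) + k)"

lemma perms_range: "\<sigma> \<in> perms k \<Longrightarrow> \<sigma> x \<le> k \<longleftrightarrow> x \<le> k" "\<sigma> \<in> perms k \<Longrightarrow> 0 < \<sigma> x \<longleftrightarrow> 0 < x"
proof -
  assume "\<sigma> \<in> perms k"
  then have p: "\<sigma> permutes {1..k}" by (simp add: perms_iff)
  show "\<sigma> x \<le> k \<longleftrightarrow> x \<le> k" "0 < \<sigma> x \<longleftrightarrow> 0 < x"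
    using permutes_in_image[OF p, of x] permutes_not_in[OF p, of x] by (cases "x \<in> {1..k}"; auto)+
qed

lemma block_sum_inverse:
  assumes "\<sigma> \<in> perms k" "\<tau> \<in> perms l"
  shows "block_sum k (inv \<sigma>) (inv \<tau>) (block_sum k \<sigma> \<tau> x) = x"
  using perms_range[OF assms(1), of x] perms_range[OF assms(2), of "x - k"] assms
  by (auto simp: block_sum_def perms_inv_app)

lemma block_sum_perms:
  assumes "\<sigma> \<in> perms k" "\<tau> \<in> perms l"
  shows "block_sum k \<sigma> \<tau> \<in> perms (k + l)"
proof -
  have "inv (inv \<sigma>) = \<sigma>" "inv (inv \<tau>) = \<tau>" using assms by (auto simp: perms_iff permutes_bij inv_inv_eq)
  then have 1: "block_sum k \<sigma> \<tau> (block_sum k (inv \<sigma>) (inv \<tau>) x) = x" for x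
    using block_sum_inverse[OF perms_inv[OF assms(1)] perms_inv[OF assms(2)]] by simp
  have "bij (block_sum k \<sigma> \<tau>)"
    by (rule o_bij[of "block_sum k (inv \<sigma>) (inv \<tau>)"]) (auto simp: fun_eq_iff 1 block_sum_inverse[OF assms])
  moreover have "block_sum k \<sigma> \<tau> x = x" if "x \<notin> {1..k+l}" for x
  proof (cases "x = 0")
    case True
    have "\<sigma> 0 = 0" using assms(1) by (auto simp: perms_iff intro: permutes_not_in)
    then show ?thesis using True by (simp add: block_sum_def)
  next
    case False
    then show ?thesis using that perms_fix[OF assms(2), of "x - k"] by (simp add: block_sum_def)
  qed
  ultimately show ?thesis unfolding perms_iff by (auto simp: permutes_def bij_iff)
qed

lemma inv_block_sum:
  assumes "\<sigma> \<in> perms k" "\<tau> \<in> perms l"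
  shows "inv (block_sum k \<sigma> \<tau>) = block_sum k (inv \<sigma>) (inv \<tau>)"
proof
  fix x
  have "block_sum k (inv \<sigma>) (inv \<tau>) (block_sum k \<sigma> \<tau> (inv (block_sum k \<sigma> \<tau>) x)) = inv (block_sum k \<sigma> \<tau>) x"
    by (rule block_sum_inverse[OF assms])
  then show "inv (block_sum k \<sigma> \<tau>) x = block_sum k (inv \<sigma>) (inv \<tau>) x"
    by (simp add: perms_inv_app(1)[OF block_sum_perms[OF assms]])
qed

lemma pact_block_sum:
  assumes "\<sigma> \<in> perms k" "\<tau> \<in> perms l" "length J = k" "length K = l"
  shows "pact (block_sum k \<sigma> \<tau>) (J @ K) = pact \<sigma> J @ pact \<tau> K"
proof (rule nth_equalityI)
  fix a assume "a < length (pact (block_sum k \<sigma> \<tau>) (J @ K))"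
  then have a: "a < k + l" using assms by simp
  show "pact (block_sum k \<sigma> \<tau>) (J @ K) ! a = (pact \<sigma> J @ pact \<tau> K) ! a"
  proof (cases "a < k")
    case True
    have "inv \<sigma> (Suc a) \<le> k" "0 < inv \<sigma> (Suc a)" using perms_range[OF perms_inv[OF assms(1)], of "Suc a"] True by auto
    then have "inv \<sigma> (Suc a) - 1 < k" by linarith
    then show ?thesis using True assms a by (simp add: pact_nth nth_append inv_block_sum[OF assms(1,2)] block_sum_def)
  next
    case False
    have "0 < inv \<tau> (Suc a - k)" using perms_range[OF perms_inv[OF assms(2)], of "Suc a - k"] False by auto
    then have "inv \<tau> (Suc a - k) + k - 1 = k + (inv \<tau> (Suc (a - k)) - 1)" using False by (simp add: Suc_diff_le)
    then show ?thesis using False assms a by (simp add: pact_nth nth_append inv_block_sum[OF assms(1,2)] block_sum_def)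
  qed
qed (simp add: assms)

lemma gen_list_append:
  assumes "length J = k" "length I = k" "length K = l" "length L = l"
  shows "gen_list (k + l) (J @ K) (I @ L) = gen_list k J I @ gen_list l K L"
  by (rule nth_equalityI) (use assms in \<open>auto simp: gen_list_def nth_append\<close>)

lemma sum_lessThan_split:
  fixes f :: "nat \<Rightarrow> nat"
  shows "(\<Sum>a<k+l. f a) = (\<Sum>a<k. f a) + (\<Sum>a<l. f (k + a))"
  by (induction l) simp_all

lemma lower_pairs_sum_split:
  fixes F :: "nat \<Rightarrow> nat \<Rightarrow> nat"
  shows "(\<Sum>a<k+l. \<Sum>b<a. F a b) = (\<Sum>a<k. \<Sum>b<a. F a b) + (\<Sum>a<l. \<Sum>b<a. F (k + a) (k + b)) + (\<Sum>a<l. \<Sum>b<k. F (k + a) b)"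
proof (induction l)
  case (Suc l)
  then show ?case using sum_lessThan_split[of "F (k + l)" k l] by simp
qed simp

lemma koszul_sign_block_sum:
  assumes "\<sigma> \<in> perms k" "\<tau> \<in> perms l" "length J = k" "length K = l"
  shows "even (koszul_sign m (block_sum k \<sigma> \<tau>) (J @ K) + (koszul_sign m \<sigma> J + koszul_sign m \<tau> K))"
proof -
  have b: "bsum m (J @ K) = bsum m J + bsum m K"
    using assms by (simp add: bsum_def sum_lessThan_split nth_append)
  let ?I = "pact \<sigma> J" and ?L = "pact \<tau> K"
  have n1: "(J @ K) ! a = J ! a" "(?I @ ?L) ! a = ?I ! a" if "a < k" for a using that assms by (simp_all add: nth_append)
  have n2: "(J @ K) ! (k + a) = K ! a" "(?I @ ?L) ! (k + a) = ?L ! a" for a using assms by (simp_all add: nth_append)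
  have p: "pinv_sign m (block_sum k \<sigma> \<tau>) (J @ K) = pinv_sign m \<sigma> J + pinv_sign m \<tau> K"
  proof -
    have lt: "block_sum k \<sigma> \<tau> (Suc b) < block_sum k \<sigma> \<tau> (Suc (k + a))" if "b < k" for a b
      using that perms_range(1)[OF assms(1), of "Suc b"] perms_range(2)[OF assms(2), of "Suc a"]
      by (simp add: block_sum_def)
    have "pinv_sign m (block_sum k \<sigma> \<tau>) (J @ K) =
       (\<Sum>a<k. \<Sum>b<a. if \<sigma> (Suc a) < \<sigma> (Suc b) then bp m (J ! b) * bp m (J ! a) else 0) +
       (\<Sum>a<l. \<Sum>b<a. if \<tau> (Suc a) < \<tau> (Suc b) then bp m (K ! b) * bp m (K ! a) else 0) + 0"
      unfolding pinv_alt lower_pairs_sum[symmetric] length_append assms(3,4) lower_pairs_sum_split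
    proof (intro arg_cong2[of _ _ _ _ "(+)"] sum.neutral ballI)
      fix a b assume "b \<in> {..<k}"
      then show "(if block_sum k \<sigma> \<tau> (Suc (k + a)) < block_sum k \<sigma> \<tau> (Suc b) then bp m ((J @ K) ! b) * bp m ((J @ K) ! (k + a)) else 0) = 0"
        using lt[of b a] by simp
    qed (auto intro!: sum.cong simp: n1 n2 block_sum_def)
    then show ?thesis by (simp add: pinv_alt lower_pairs_sum assms)
  qed
  define X where "X = (\<Sum>a<k. \<Sum>b<a. entry_parity m ?I J a * bp m (J ! b))"
  define Y where "Y = (\<Sum>a<l. \<Sum>b<a. entry_parity m ?L K a * bp m (K ! b))"
  have "(\<Sum>a<k + l. \<Sum>b<a. entry_parity m (?I @ ?L) (J @ K) a * bp m ((J @ K) ! b)) =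
      X + Y + (\<Sum>a<l. \<Sum>b<k. entry_parity m ?L K a * bp m (J ! b))"
    unfolding lower_pairs_sum_split X_def Y_def
    by (intro arg_cong2[of _ _ _ _ "(+)"] sum.cong refl) (auto simp: n1 n2 entry_parity_def)
  also have "(\<Sum>a<l. \<Sum>b<k. entry_parity m ?L K a * bp m (J ! b)) = (\<Sum>a<l. entry_parity m ?L K a) * bsum m J"
    by (simp add: sum_product bsum_def assms)
  \<comment> \<open>Permuting a block keeps its total parity, so the cross terms between the blocks
    are even.\<close>
  also have "(\<Sum>a<l. entry_parity m ?L K a) = 2 * bsum m K"
    using bsum_pact[OF assms(2,4), of m] by (simp add: entry_parity_def sum.distrib bsum_def assms)
  finally have "koszul_sign m (block_sum k \<sigma> \<tau>) (J @ K) = bsum m J + bsum m K + (X + Y + 2 * bsum m K * bsum m J) + (pinv_sign m \<sigma> J + pinv_sign m \<tau> K)"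
    by (simp add: koszul_sign_def pact_block_sum[OF assms] assms b p)
  moreover have "koszul_sign m \<sigma> J = bsum m J + X + pinv_sign m \<sigma> J" by (simp add: koszul_sign_def X_def assms)
  moreover have "koszul_sign m \<tau> K = bsum m K + Y + pinv_sign m \<tau> K" by (simp add: koszul_sign_def Y_def assms)
  ultimately have "koszul_sign m (block_sum k \<sigma> \<tau>) (J @ K) + (koszul_sign m \<sigma> J + koszul_sign m \<tau> K) =
    2 * (bsum m J + bsum m K + X + Y + bsum m K * bsum m J + pinv_sign m \<sigma> J + pinv_sign m \<tau> K)" by simp
  then show ?thesis by simp
qed

lemma koszul_term_block_sum:
  assumes "\<sigma> \<in> perms k" "\<tau> \<in> perms l" "length J = k" "length K = l"
  shows "koszul_term m (block_sum k \<sigma> \<tau>) (J @ K) = sa_mult m (koszul_term m \<sigma> J) (koszul_term m \<tau> K)"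
  using minus_one_power_cong[OF koszul_sign_block_sum[OF assms, of m]]
  by (simp add: koszul_term_def pact_block_sum[OF assms] gen_list_append assms sa_mult_scal sa_mult_gen_prod power_add)

lemma sa_mult_sum:
  "sa_mult m (sa_sum F S) (sa_sum G T) c = (\<Sum>x\<in>S. \<Sum>y\<in>T. sa_mult m (F x) (G y) c)"
proof -
  have "sa_mult m (sa_sum F S) (sa_sum G T) c = (\<Sum>a\<in>{a. a \<subseteq># c}. \<Sum>x\<in>S. \<Sum>y\<in>T. mon_sign m a (c - a) * F x a * G y (c - a))"
  proof -
    have "x * (\<Sum>s\<in>S. f s) * (\<Sum>t\<in>T. g t) = (\<Sum>s\<in>S. \<Sum>t\<in>T. x * f s * g t)" for x :: complex and f g
      by (subst mult.assoc, subst sum_product) (simp only: sum_distrib_left mult.assoc)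
    then show ?thesis by (simp only: sa_mult_def sa_sum_def)
  qed
  also have "\<dots> = (\<Sum>x\<in>S. \<Sum>a\<in>{a. a \<subseteq># c}. \<Sum>y\<in>T. mon_sign m a (c - a) * F x a * G y (c - a))"
    by (rule sum.swap)
  also have "\<dots> = (\<Sum>x\<in>S. \<Sum>y\<in>T. sa_mult m (F x) (G y) c)"
    unfolding sa_mult_def by (intro sum.cong refl sum.swap)
  finally show ?thesis .
qed

lemma sum_idx_append:
  "(\<Sum>I\<in>idx m n (k + l). f I) = (\<Sum>J\<in>idx m n k. \<Sum>K\<in>idx m n l. f (J @ K))"
proof -
  have "(\<Sum>I\<in>idx m n (k + l). f I) = (\<Sum>(J,K)\<in>idx m n k \<times> idx m n l. f (J @ K))"
  proof (rule sum.reindex_bij_witness[where i = "\<lambda>(J,K). J @ K" and j = "\<lambda>I. (take k I, drop k I)"])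
    fix I assume "I \<in> idx m n (k + l)"
    then show "(take k I, drop k I) \<in> idx m n k \<times> idx m n l"
      using set_take_subset[of k I] set_drop_subset[of k I] by (auto simp: idx_def simp del: set_take_subset)
  qed (auto simp: idx_def)
  then show ?thesis by (simp add: sum.cartesian_product)
qed

lemma str_perm_block_sum:
  assumes "\<sigma> \<in> perms k" "\<tau> \<in> perms l"
  shows "str_perm m n (k + l) (block_sum k \<sigma> \<tau>) = sa_mult m (str_perm m n k \<sigma>) (str_perm m n l \<tau>)"
proof
  fix c
  show "str_perm m n (k + l) (block_sum k \<sigma> \<tau>) c = sa_mult m (str_perm m n k \<sigma>) (str_perm m n l \<tau>) c"
    unfolding str_perm_def sa_mult_sum
    by (simp add: sa_sum_def sum_idx_append, intro sum.cong refl)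
      (simp add: koszul_term_block_sum[OF assms] idx_length)
qed

lemma str_perm_0: "str_perm m n 0 id = sa_one"
proof -
  have "idx m n 0 = {[]}" by (auto simp: idx_def)
  then show ?thesis
    by (simp add: str_perm_def sa_sum_def koszul_term_def koszul_sign_def bsum_def pinv_sign_def gen_list_def sa_one_gen_prod[symmetric])
qed

section \<open>Jacobi--Trudi determinants\<close>

text \<open>The letter \<open>l\<close> is put at the first \<open>k\<close> places. A stabiliser
  then splits into an arbitrary permutation of these places and a stabiliser of the remaining word;
  the binomial coefficient accounts for the factorials.\<close>

lemma young_trace_first_block:
  assumes f: "classfn (k + s) f" and A: "finite A" "l \<notin> A" and bl: "b l = int k"
  shows "young_trace (k + s) (insert l A) b f = (\<Sum>\<tau>\<in>perms k. \<Sum>(w,\<sigma>)\<in>stab_pairs s A b. f (block_sum k \<tau> \<sigma>)) / (fact k * fact s)"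
proof -
  let ?r = "k + s" and ?K = "{1..k}"
  \<comment> \<open>\<open>k\<close> letters \<open>l\<close> followed by the shifted word; words
    are extensional, hence \<open>undefined\<close> elsewhere.\<close>
  let ?w = "\<lambda>w x. if x \<in> {1..k} then l else if x \<in> {k+1..k+s} then w (x - k) else (undefined :: nat)"
  let ?j = "\<lambda>(\<tau>,w,\<sigma>). (?w w, block_sum k \<tau> \<sigma>)"
  have inj: "inj_on ?j (perms k \<times> stab_pairs s A b)"
  proof (rule inj_onI)
    fix t t' assume t: "t \<in> perms k \<times> stab_pairs s A b" "t' \<in> perms k \<times> stab_pairs s A b" and e: "?j t = ?j t'"
    obtain \<tau> w \<sigma> \<tau>' w' \<sigma>' where d: "t = (\<tau>,w,\<sigma>)" "t' = (\<tau>',w',\<sigma>')" by (cases t, cases t')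
    have p: "\<tau> \<in> perms k" "\<tau>' \<in> perms k" "w \<in> words s A b" "w' \<in> words s A b" "\<sigma> \<in> perms s" "\<sigma>' \<in> perms s"
      using t d by (auto simp: stab_pairs_def)
    have "?w w = ?w w' \<and> block_sum k \<tau> \<sigma> = block_sum k \<tau>' \<sigma>'" using e unfolding d prod.case prod.inject .
    then have ew: "?w w x = ?w w' x" and ed: "block_sum k \<tau> \<sigma> x = block_sum k \<tau>' \<sigma>' x" for x
      by (blast dest: fun_cong)+
    have "w = w'"
    proof (rule extensionalityI[of _ "{1..s}"])
      fix x assume "x \<in> {1..s}"
      then show "w x = w' x" using ew[of "x + k"] by auto
    qed (use p in \<open>auto simp: words_def PiE_iff\<close>)
    moreover have "\<tau> = \<tau>'"
    proof
      fix x show "\<tau> x = \<tau>' x"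
        using ed[of x] perms_fix[OF p(1), of x] perms_fix[OF p(2), of x] by (cases "x \<le> k") (auto simp: block_sum_def)
    qed
    moreover have "\<sigma> = \<sigma>'"
    proof
      fix x show "\<sigma> x = \<sigma>' x"
      proof (cases "x = 0")
        case True
        then show ?thesis using p by (auto simp: perms_iff permutes_not_in)
      next
        case False
        then show ?thesis using ed[of "x + k"] by (simp add: block_sum_def)
      qed
    qed
    ultimately show "t = t'" by (simp add: d)
  qed
  have wk: "?w w (x + k) = w x" if "x \<in> {1..s}" for w x using that by auto
  have im: "?j ` (perms k \<times> stab_pairs s A b) = stab_pairs_at ?r (insert l A) b l ?K"
  proof (intro subset_antisym subsetI)
    fix u assume "u \<in> ?j ` (perms k \<times> stab_pairs s A b)"
    then obtain \<tau> w \<sigma> where u: "u = (?w w, block_sum k \<tau> \<sigma>)" and p: "\<tau> \<in> perms k" "w \<in> words s A b" "\<sigma> \<in> perms s" "w \<circ> \<sigma> = w"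
      by (auto simp: stab_pairs_def)
    have wA: "w x \<in> A" if "x \<in> {1..s}" for x using words_in[OF p(2) that] .
    have wA': "w (x - k) \<in> A" if "k < x" "x \<le> k + s" for x
      by (rule wA, unfold atLeastAtMost_iff) (use that in linarith)
    have K: "{x \<in> {1..?r}. ?w w x = l} = ?K"
    proof (rule set_eqI)
      fix x show "x \<in> {x \<in> {1..?r}. ?w w x = l} \<longleftrightarrow> x \<in> ?K"
        using wA'[of x] A(2) by (auto split: if_splits)
    qed
    have "?w w \<in> {1..?r} \<rightarrow>\<^sub>E insert l A" using wA' by (auto simp: PiE_iff extensional_def)
    moreover have "int (card {x \<in> {1..?r}. ?w w x = i}) = b i" if "i \<in> insert l A" for i
    proof (cases "i = l")
      case True
      then show ?thesis using K bl by simp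
    next
      case False
      have "card {x \<in> {1..s}. w x = i} = card {x \<in> {1..?r}. ?w w x = i}"
        by (rule bij_betw_same_card[of "\<lambda>x. x + k"], rule bij_betw_byWitness[where f' = "\<lambda>x. x - k"])
          (use False in auto)
      then show ?thesis using words_count[OF p(2), of i] that False by simp
    qed
    ultimately have "?w w \<in> words ?r (insert l A) b" unfolding words_def by blast
    moreover have "?w w \<circ> block_sum k \<tau> \<sigma> = ?w w"
    proof
      fix x
      have ws: "w (\<sigma> y) = w y" for y using p(4) by (metis comp_apply)
      show "(?w w \<circ> block_sum k \<tau> \<sigma>) x = ?w w x"
      proof (cases "x \<le> k")
        case True
        then show ?thesis using perms_range[OF p(1), of x] by (auto simp: block_sum_def)
      next
        case False
        then show ?thesis using perms_range[OF p(3), of "x - k"] ws[of "x - k"] by (auto simp: block_sum_def)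
      qed
    qed
    ultimately show "u \<in> stab_pairs_at ?r (insert l A) b l ?K"
      unfolding stab_pairs_at_def stab_pairs_def u using K block_sum_perms[OF p(1,3)] by (simp only: mem_Collect_eq prod.case simp_thms)
  next
    fix u assume "u \<in> stab_pairs_at ?r (insert l A) b l ?K"
    then obtain v \<rho> where u: "u = (v,\<rho>)" and p: "v \<in> words ?r (insert l A) b" "\<rho> \<in> perms ?r" "v \<circ> \<rho> = v"
      and K: "{x \<in> {1..?r}. v x = l} = ?K" by (auto simp: stab_pairs_at_def stab_pairs_def)
    have vr: "v (\<rho> x) = v x" for x using p(3) by (metis comp_apply)
    have rr: "\<rho> x \<in> {1..?r} \<longleftrightarrow> x \<in> {1..?r}" for x using p(2) by (simp only: perms_iff permutes_in_image)
    have rk: "\<rho> x \<in> {1..k} \<longleftrightarrow> x \<in> {1..k}" for x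
    proof -
      have "\<rho> x \<in> {x \<in> {1..?r}. v x = l} \<longleftrightarrow> x \<in> {x \<in> {1..?r}. v x = l}" by (simp only: mem_Collect_eq vr rr)
      then show ?thesis unfolding K .
    qed
    have rinj: "\<rho> x = \<rho> y \<longleftrightarrow> x = y" for x y by (rule inj_eq) (use p(2) perms_iff permutes_inj in blast)
    have rsurj: "\<exists>x. \<rho> x = y" for y using perms_inv_app(1)[OF p(2)] by blast
    define \<tau> where "\<tau> x = (if x \<in> {1..k} then \<rho> x else x)" for x
    define \<sigma> where "\<sigma> x = (if x \<in> {1..s} then \<rho> (x + k) - k else x)" for x
    define w where "w = (\<lambda>x\<in>{1..s}. v (x + k))"
    have rs: "\<rho> (x + k) \<in> {k+1..k+s}" if "x \<in> {1..s}" for x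
      using rr[of "x + k"] rk[of "x + k"] that by auto
    have t: "\<tau> \<in> perms k"
      unfolding perms_iff
    proof (rule inj_imp_permutes)
      show "inj_on \<tau> {1..k}" by (auto simp: inj_on_def \<tau>_def rinj)
      show "\<tau> x \<in> {1..k}" if "x \<in> {1..k}" for x using that rk[of x] by (simp only: \<tau>_def if_True)
      show "\<tau> x = x" if "x \<notin> {1..k}" for x using that by (simp only: \<tau>_def if_False)
    qed simp
    have gelem: "\<sigma> \<in> perms s"
      unfolding perms_iff
    proof (rule inj_imp_permutes)
      show "inj_on \<sigma> {1..s}"
      proof (rule inj_onI)
        fix x y assume xy: "x \<in> {1..s}" "y \<in> {1..s}" "\<sigma> x = \<sigma> y"
        then have "\<rho> (x + k) = \<rho> (y + k)" using rs[of x] rs[of y] by (auto simp: \<sigma>_def)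
        then show "x = y" by (simp add: rinj)
      qed
      show "\<sigma> x \<in> {1..s}" if "x \<in> {1..s}" for x using that rs[of x] by (auto simp: \<sigma>_def)
      show "\<sigma> x = x" if "x \<notin> {1..s}" for x using that by (simp only: \<sigma>_def if_False)
    qed simp
    have d: "block_sum k \<tau> \<sigma> = \<rho>"
    proof
      fix x
      have fix0: "\<rho> x = x" if "x \<notin> {1..?r}" using that p(2) permutes_not_in[of \<rho> "{1..?r}" x] unfolding perms_iff by blast
      consider "x \<in> {1..k}" | "x = 0" | "x \<in> {k+1..k+s}" | "x > k + s" by fastforce
      then show "block_sum k \<tau> \<sigma> x = \<rho> x"
      proof cases
        case 3
        then show ?thesis using rs[of "x - k"] by (auto simp: block_sum_def \<sigma>_def)
      qed (use fix0 in \<open>auto simp: block_sum_def \<tau>_def \<sigma>_def\<close>)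
    qed
    have ww: "?w w = v"
    proof
      fix x
      have "v x = l" if "x \<in> ?K" using that K by blast
      moreover have "v x = undefined" if "x \<notin> {1..?r}" using p(1) that by (auto simp: words_def PiE_iff extensional_def)
      ultimately show "?w w x = v x" by (auto simp: w_def)
    qed
    have vl: "v x \<in> A" if "x \<in> {k+1..k+s}" for x
    proof -
      have "x \<notin> {x \<in> {1..?r}. v x = l}" unfolding K using that by simp
      then have "v x \<noteq> l" using that by auto
      then show ?thesis using words_in[OF p(1), of x] that by auto
    qed
    have "w \<in> words s A b"
    proof -
      have "w \<in> {1..s} \<rightarrow>\<^sub>E A" using vl by (auto simp: w_def)
      moreover have "int (card {x \<in> {1..s}. w x = i}) = b i" if "i \<in> A" for i
      proof -
        have il: "i \<noteq> l" using that A(2) by auto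
        have gt: "k < x" if "x \<in> {1..?r}" "v x = i" for x
        proof (rule ccontr)
          assume "\<not> k < x"
          then have "x \<in> ?K" using that by simp
          then have "v x = l" using K by blast
          then show False using that il by simp
        qed
        have "card {x \<in> {1..s}. w x = i} = card {x \<in> {1..?r}. v x = i}"
          by (rule bij_betw_same_card[of "\<lambda>x. x + k"], rule bij_betw_byWitness[where f' = "\<lambda>x. x - k"])
            (use gt in \<open>force simp: w_def\<close>)+
        then show ?thesis using words_count[OF p(1), of i] that by simp
      qed
      ultimately show ?thesis unfolding words_def by blast
    qed
    moreover have "w \<circ> \<sigma> = w"
    proof
      fix x show "(w \<circ> \<sigma>) x = w x"
      proof (cases "x \<in> {1..s}")
        case True
        have "\<sigma> x \<in> {1..s}" "\<sigma> x + k = \<rho> (x + k)" using rs[OF True] True by (auto simp: \<sigma>_def)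
        then show ?thesis using True vr[of "x + k"] by (simp add: w_def)
      next
        case False
        then have "\<sigma> x = x" by (simp only: \<sigma>_def if_False)
        then show ?thesis by simp
      qed
    qed
    ultimately have "(\<tau>,w,\<sigma>) \<in> perms k \<times> stab_pairs s A b" using t gelem by (simp add: stab_pairs_def)
    then show "u \<in> ?j ` (perms k \<times> stab_pairs s A b)"
      by (rule rev_image_eqI) (simp only: u d ww prod.case)
  qed
  have "(\<Sum>(w,\<sigma>)\<in>stab_pairs ?r (insert l A) b. f \<sigma>) = of_nat (?r choose k) * (\<Sum>(w,\<sigma>)\<in>stab_pairs_at ?r (insert l A) b l ?K. f \<sigma>)"
    by (rule sum_stab_pairs_block[OF f]) (use A bl in auto)
  also have "(\<Sum>(w,\<sigma>)\<in>stab_pairs_at ?r (insert l A) b l ?K. f \<sigma>) = (\<Sum>(\<tau>,w,\<sigma>)\<in>perms k \<times> stab_pairs s A b. f (block_sum k \<tau> \<sigma>))"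
    unfolding im[symmetric] by (subst sum.reindex[OF inj]) (simp add: case_prod_unfold)
  also have "\<dots> = (\<Sum>\<tau>\<in>perms k. \<Sum>(w,\<sigma>)\<in>stab_pairs s A b. f (block_sum k \<tau> \<sigma>))"
    by (simp add: sum.cartesian_product case_prod_unfold)
  finally have "young_trace ?r (insert l A) b f = of_nat (?r choose k) * (\<Sum>\<tau>\<in>perms k. \<Sum>(w,\<sigma>)\<in>stab_pairs s A b. f (block_sum k \<tau> \<sigma>)) / fact ?r"
    by (simp add: young_trace_def)
  moreover have "of_nat (?r choose k) = (fact ?r / (fact k * fact s) :: complex)"
    using binomial_fact[of k ?r] by simp
  ultimately show ?thesis by simp
qed

text \<open>What the two determinants share: the family is \<open>str_perm\<close> for symmetrisers,
  and its twist by the sign for antisymmetrisers.\<close>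

locale multiplicative_family =
  fixes m :: nat and Ph :: "nat \<Rightarrow> (nat \<Rightarrow> nat) \<Rightarrow> sa"
  assumes Ph_class: "classfn k (\<lambda>\<sigma>. Ph k \<sigma> c)"
    and Ph_block_sum: "\<sigma> \<in> perms k \<Longrightarrow> \<tau> \<in> perms l \<Longrightarrow> Ph (k + l) (block_sum k \<sigma> \<tau>) = sa_mult m (Ph k \<sigma>) (Ph l \<tau>)"
    and Ph_0: "Ph 0 id = sa_one"
begin

text \<open>An average over one symmetric group. The value 0 at negative arguments matches the
  absence of words with a negative content.\<close>

definition block_trace :: "int \<Rightarrow> sa" where
  "block_trace k = (if k < 0 then sa_zero else sa_scal (1 / fact (nat k)) (sa_sum (Ph (nat k)) (perms (nat k))))"

definition block_prod :: "(nat \<Rightarrow> int) \<Rightarrow> nat \<Rightarrow> nat \<Rightarrow> sa" where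
  "block_prod b i N = foldr (\<lambda>i acc. sa_mult m (block_trace (b i)) acc) [i..<N] sa_one"

lemma block_prod_zero: "j \<in> {i..<N} \<Longrightarrow> b j < 0 \<Longrightarrow> block_prod b i N = sa_zero"
proof -
  have "j \<in> set xs \<Longrightarrow> b j < 0 \<Longrightarrow> foldr (\<lambda>i acc. sa_mult m (block_trace (b i)) acc) xs sa_one = sa_zero" for xs
    by (induction xs) (auto simp: block_trace_def)
  then show "j \<in> {i..<N} \<Longrightarrow> b j < 0 \<Longrightarrow> block_prod b i N = sa_zero" by (simp add: block_prod_def)
qed

text \<open>The first letter is split off by \<open>young_trace_first_block\<close>, and
  multiplicativity turns block sums into products; the induction runs down from the empty set of
  letters.\<close>

lemma block_prod_young_trace:
  assumes "i \<le> N" "(\<Sum>j\<in>{i..<N}. b j) = int r"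
  shows "block_prod b i N c = young_trace r {i..<N} b (\<lambda>\<sigma>. Ph r \<sigma> c)"
  using assms
proof (induction i arbitrary: r c rule: inc_induct)
  case base
  then have "r = 0" by simp
  moreover have "stab_pairs 0 {} b = {(\<lambda>_. undefined, id)}"
    by (auto simp: stab_pairs_def words_def perms_0)
  ultimately show ?case by (simp add: block_prod_def young_trace_def Ph_0)
next
  case (step i)
  have ins: "{i..<N} = insert i {Suc i..<N}" using step.hyps by auto
  show ?case
  proof (cases "\<exists>j\<in>{i..<N}. b j < 0")
    case True
    then show ?thesis using block_prod_zero young_trace_neg by (auto simp: sa_zero_def)
  next
    case False
    define k where "k = nat (b i)"
    define s where "s = nat (\<Sum>j\<in>{Suc i..<N}. b j)"
    have "0 \<le> (\<Sum>j\<in>{Suc i..<N}. b j)" by (rule sum_nonneg) (use False in \<open>auto simp: not_less\<close>)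
    then have s: "(\<Sum>j\<in>{Suc i..<N}. b j) = int s" by (simp add: s_def)
    have "0 \<le> b i" using False step.hyps by force
    then have k: "b i = int k" by (simp add: k_def)
    have r: "r = k + s" using step.prems unfolding ins by (simp add: s k)
    have rest: "block_prod b (Suc i) N = sa_scal (1 / fact s) (sa_sum (\<lambda>(w,\<sigma>). Ph s \<sigma>) (stab_pairs s {Suc i..<N} b))"
      by (rule ext) (simp add: step.IH[OF s] young_trace_def sa_scal_def sa_sum_def case_prod_unfold)
    have hk: "block_trace (b i) = sa_scal (1 / fact k) (sa_sum (Ph k) (perms k))" by (simp add: block_trace_def k)
    have "block_prod b i N = sa_mult m (block_trace (b i)) (block_prod b (Suc i) N)"
      using step.hyps by (simp add: block_prod_def upt_conv_Cons)
    then have "block_prod b i N c = (1 / fact k) * (1 / fact s) * (\<Sum>\<tau>\<in>perms k. \<Sum>(w,\<sigma>)\<in>stab_pairs s {Suc i..<N} b. sa_mult m (Ph k \<tau>) (Ph s \<sigma>) c)"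
      unfolding hk rest sa_mult_scal by (simp add: sa_scal_def sa_mult_sum case_prod_unfold)
    also have "(\<Sum>\<tau>\<in>perms k. \<Sum>(w,\<sigma>)\<in>stab_pairs s {Suc i..<N} b. sa_mult m (Ph k \<tau>) (Ph s \<sigma>) c) =
       (\<Sum>\<tau>\<in>perms k. \<Sum>(w,\<sigma>)\<in>stab_pairs s {Suc i..<N} b. Ph (k + s) (block_sum k \<tau> \<sigma>) c)"
      by (intro sum.cong refl) (auto simp: stab_pairs_def Ph_block_sum)
    finally show ?thesis
      unfolding ins r by (subst young_trace_first_block[OF Ph_class]) (simp_all add: k)
  qed
qed

text \<open>The alternating sum has one more row than the determinant. That row is empty, and its
  entry is negative unless \<open>p\<close> fixes \<open>L\<close>, so only the permutations of the
  first \<open>L\<close> rows remain.\<close>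

lemma det_alt_trace:
  fixes L :: nat and a :: "nat \<Rightarrow> int"
  assumes sum: "(\<Sum>i<L. a i + int i) = int r" and aL: "a L = - int L"
  shows "sa_det m L (\<lambda>i j. block_trace (a (i - 1) + int j - 1)) c = alt_trace r (Suc L) a (\<lambda>\<sigma>. Ph r \<sigma> c)"
proof -
  let ?f = "\<lambda>\<sigma>. Ph r \<sigma> c"
  \<comment> \<open>Translates permutations of \<open>{..<L}\<close>, used in the alternating sums,
    into those of \<open>{1..L}\<close>, used in \<open>sa_det\<close>.\<close>
  let ?shift_pair = "map_permutation {..<L} Suc"
  have bij: "bij_betw Suc {..<L} {1..L}" by (rule bij_betw_byWitness[where f' = "\<lambda>x. x - 1"]) auto
  have "bij_betw ?shift_pair {p. p permutes {..<L}} {p. p permutes {1..L}}"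
  proof -
    have "?shift_pair = (\<lambda>p x. if x \<in> {1..L} then Suc (p (inv_into {..<L} Suc x)) else x)"
      using bij by (intro ext) (auto simp: map_permutation_def restrict_id_def bij_betw_def)
    then show ?thesis using bij_betw_permutations[OF bij] by (simp only:)
  qed
  then have "sa_det m L (\<lambda>i j. block_trace (a (i - 1) + int j - 1)) c =
    (\<Sum>p\<in>Perm L. of_int (sign (?shift_pair p)) * foldr (\<lambda>i acc. sa_mult m (block_trace (a (i - 1) + int (?shift_pair p i) - 1)) acc) [1..<L+1] sa_one c)"
    unfolding sa_det_def sa_sum_def sa_scal_def by (rule sum.reindex_bij_betw[symmetric])
  also have "\<dots> = (\<Sum>p\<in>Perm L. of_int (sign p) * block_prod (shifted a p) 0 L c)"
  proof (rule sum.cong[OF refl])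
    fix p assume p: "p \<in> Perm L"
    have shift_pair: "?shift_pair p (Suc i) = Suc (p i)" if "i < L" for i
      by (rule map_permutation_apply) (use that in auto)
    have "foldr (\<lambda>i acc. sa_mult m (block_trace (a (i - 1) + int (?shift_pair p i) - 1)) acc) [1..<L+1] sa_one =
       foldr (\<lambda>i acc. sa_mult m (block_trace (a i + int (?shift_pair p (Suc i)) - 1)) acc) [0..<L] sa_one"
    proof -
      have "[1..<L+1] = map Suc [0..<L]" by (simp add: map_Suc_upt del: upt_Suc)
      then show ?thesis by (simp add: foldr_map comp_def del: upt_Suc)
    qed
    also have "\<dots> = block_prod (shifted a p) 0 L"
      unfolding block_prod_def by (rule foldr_cong) (auto simp: shift_pair shifted_def)
    finally show "of_int (sign (?shift_pair p)) * foldr (\<lambda>i acc. sa_mult m (block_trace (a (i - 1) + int (?shift_pair p i) - 1)) acc) [1..<L+1] sa_one c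
      = of_int (sign p) * block_prod (shifted a p) 0 L c"
      using sign_map_permutation[of Suc "{..<L}" p] p by simp
  qed
  also have "\<dots> = (\<Sum>p\<in>Perm L. of_int (sign p) * young_trace r {..<L} (shifted a p) ?f)"
  proof (rule sum.cong[OF refl])
    fix p assume p: "p \<in> Perm L"
    have "(\<Sum>j<L. shifted a p j) = (\<Sum>j<L. a j) + (\<Sum>j<L. int (p j))" by (simp add: shifted_def sum.distrib)
    also have "(\<Sum>j<L. int (p j)) = (\<Sum>j<L. int j)" using sum.permute[of p "{..<L}" int] p by (simp add: comp_def)
    finally have "(\<Sum>j<L. shifted a p j) = int r" using sum by (simp add: sum.distrib)
    then show "of_int (sign p) * block_prod (shifted a p) 0 L c = of_int (sign p) * young_trace r {..<L} (shifted a p) ?f"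
      using block_prod_young_trace[of 0 L "shifted a p" r c] by (simp add: atLeast0LessThan)
  qed
  also have "\<dots> = (\<Sum>p\<in>Perm L. of_int (sign p) * young_trace r {..<Suc L} (shifted a p) ?f)"
  proof (rule sum.cong[OF refl])
    fix p assume p: "p \<in> Perm L"
    have "p L = L" using p by (auto intro: permutes_not_in)
    then have z: "shifted a p L = 0" using aL by (simp add: shifted_def)
    have "words r {..<Suc L} (shifted a p) = words r {..<L} (shifted a p)"
    proof (intro subset_antisym subsetI)
      fix w assume w: "w \<in> words r {..<Suc L} (shifted a p)"
      have "card {x \<in> {1..r}. w x = L} = 0" using words_count[OF w, of L] z by simp
      then have "{x \<in> {1..r}. w x = L} = {}" by simp
      then have "w x < L" if "x \<in> {1..r}" for x using words_in[OF w that] that by (auto simp: less_Suc_eq)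
      then show "w \<in> words r {..<L} (shifted a p)" using w by (auto simp: words_def PiE_iff)
    next
      fix w assume w: "w \<in> words r {..<L} (shifted a p)"
      have "{x \<in> {1..r}. w x = L} = {}" using words_in[OF w] by force
      then have "int (card {x \<in> {1..r}. w x = L}) = shifted a p L" using z by (simp only: card.empty)
      moreover have "w \<in> {1..r} \<rightarrow>\<^sub>E {..<Suc L}" using w PiE_mono[of "{1..r}" "\<lambda>_. {..<L}" "\<lambda>_. {..<Suc L}"] unfolding words_def by auto
      ultimately show "w \<in> words r {..<Suc L} (shifted a p)" using w unfolding words_def lessThan_Suc by blast
    qed
    then show "of_int (sign p) * young_trace r {..<L} (shifted a p) ?f = of_int (sign p) * young_trace r {..<Suc L} (shifted a p) ?f"
      by (simp add: young_trace_def stab_pairs_def)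
  qed
  also have "\<dots> = (\<Sum>p\<in>Perm (Suc L). of_int (sign p) * young_trace r {..<Suc L} (shifted a p) ?f)"
  proof (rule sum.mono_neutral_left)
    show "Perm L \<subseteq> Perm (Suc L)" by (auto intro: permutes_subset)
    show "\<forall>p\<in>Perm (Suc L) - Perm L. of_int (sign p) * young_trace r {..<Suc L} (shifted a p) ?f = 0"
    proof
      fix p assume p: "p \<in> Perm (Suc L) - Perm L"
      have "p L \<noteq> L"
      proof
        assume pL: "p L = L"
        have "p permutes {..<L}"
        proof (rule permutes_superset[of p "{..<Suc L}"])
          fix x assume "x \<in> {..<Suc L} - {..<L}"
          then have "x = L" by auto
          then show "p x = x" using pL by simp
        qed (use p in simp)
        then show False using p by simp
      qed
      moreover have "p L < Suc L" using p Perm_less[of p "Suc L" L] by simp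
      ultimately have "young_trace r {..<Suc L} (shifted a p) ?f = 0"
        using aL by (intro young_trace_neg[of L]) (auto simp: shifted_def)
      then show "of_int (sign p) * young_trace r {..<Suc L} (shifted a p) ?f = 0" by simp
    qed
  qed simp
  also have "\<dots> = alt_trace r (Suc L) a ?f" by (simp add: alt_trace_young_trace)
  finally show ?thesis .
qed

end

section \<open>The main theorem\<close>

lemma sign_perms_comp: "\<sigma> \<in> perms k \<Longrightarrow> \<tau> \<in> perms k \<Longrightarrow> sign (\<sigma> \<circ> \<tau>) = sign \<sigma> * sign \<tau>"
  by (rule sign_compose) (auto simp: perms_iff intro: permutes_imp_permutation[of "{1..k}"])

lemma sign_perms_inv: "\<sigma> \<in> perms k \<Longrightarrow> sign (inv \<sigma>) = sign \<sigma>"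
  by (rule sign_inverse) (auto simp: perms_iff intro: permutes_imp_permutation[of "{1..k}"])

text \<open>The second block is \<open>\<tau>\<close> transported along a translation, and
  relabelling keeps the sign.\<close>

lemma sign_block_sum:
  assumes "\<sigma> \<in> perms k" "\<tau> \<in> perms l"
  shows "sign (block_sum k \<sigma> \<tau>) = sign \<sigma> * sign \<tau>"
proof -
  let ?\<rho> = "map_permutation {1..l} (\<lambda>x. x + k) \<tau>"
  have bij: "bij_betw (\<lambda>x. x + k) {1..l} {k+1..k+l}"
    by (rule bij_betw_byWitness[where f' = "\<lambda>x. x - k"]) auto
  have r: "?\<rho> permutes {k+1..k+l}"
    using map_permutation_permutes[OF bij] assms(2) by (simp add: perms_iff)
  have rp: "?\<rho> \<in> perms (k + l)" unfolding perms_iff by (rule permutes_subset[OF r]) auto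
  have sp: "\<sigma> \<in> perms (k + l)"
    using assms(1) unfolding perms_iff by (rule permutes_subset) auto
  have "block_sum k \<sigma> \<tau> = \<sigma> \<circ> ?\<rho>"
  proof
    fix x
    consider "x \<le> k" | "k < x" "x \<le> k + l" | "k + l < x" by linarith
    then show "block_sum k \<sigma> \<tau> x = (\<sigma> \<circ> ?\<rho>) x"
    proof cases
      case 1
      then have "?\<rho> x = x" by (intro permutes_not_in[OF r]) auto
      then show ?thesis using 1 by (simp add: block_sum_def)
    next
      case 2
      have "?\<rho> (x - k + k) = \<tau> (x - k) + k"
        by (rule map_permutation_apply) (use 2 in \<open>auto simp: inj_on_def\<close>)
      moreover have "\<sigma> (\<tau> (x - k) + k) = \<tau> (x - k) + k"
        using perms_fix[OF assms(1), of "\<tau> (x - k) + k"] perms_range(2)[OF assms(2), of "x - k"] 2 by simp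
      ultimately show ?thesis using 2 by (simp add: block_sum_def)
    next
      case 3
      then have "?\<rho> x = x" by (intro permutes_not_in[OF r]) auto
      then show ?thesis using 3 perms_fix[OF assms(1), of x] perms_fix[OF assms(2), of "x - k"] by (simp add: block_sum_def)
    qed
  qed
  moreover have "sign ?\<rho> = sign \<tau>"
    by (rule sign_map_permutation) (use assms(2) in \<open>auto simp: inj_on_def perms_iff\<close>)
  ultimately show ?thesis using sign_perms_comp[OF sp rp] by simp
qed

lemma multiplicative_family_str_perm: "multiplicative_family m (str_perm m n)"
  by unfold_locales (auto simp: classfn_str_perm str_perm_block_sum str_perm_0)

lemma multiplicative_family_sgn: "multiplicative_family m (\<lambda>k \<sigma>. sa_scal (of_int (sign \<sigma>)) (str_perm m n k \<sigma>))"
proof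
  fix k c
  show "classfn k (\<lambda>\<sigma>. sa_scal (of_int (sign \<sigma>)) (str_perm m n k \<sigma>) c)"
    unfolding classfn_def
  proof (intro ballI)
    fix \<sigma> \<tau> assume st: "\<sigma> \<in> perms k" "\<tau> \<in> perms k"
    have "sign (\<tau> \<circ> \<sigma> \<circ> inv \<tau>) = sign \<sigma>"
      using sign_perms_comp[OF perms_comp[OF st(2,1)] perms_inv[OF st(2)]] sign_perms_comp[OF st(2,1)] sign_perms_inv[OF st(2)]
      by (cases \<tau> rule: sign_cases) simp_all
    then show "sa_scal (of_int (sign (\<tau> \<circ> \<sigma> \<circ> inv \<tau>))) (str_perm m n k (\<tau> \<circ> \<sigma> \<circ> inv \<tau>)) c = sa_scal (of_int (sign \<sigma>)) (str_perm m n k \<sigma>) c"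
      using classfnD[OF classfn_str_perm st, of m n c] by (simp add: sa_scal_def)
  qed
qed (simp_all add: sign_block_sum str_perm_block_sum sa_mult_scal str_perm_0)

lemma bet_block_trace: "bet m n k = multiplicative_family.block_trace (str_perm m n) k"
proof -
  interpret multiplicative_family m "str_perm m n" by (rule multiplicative_family_str_perm)
  consider "k < 0" | "k = 0" | "0 < k" by linarith
  then show ?thesis
  proof cases
    case 2
    then show ?thesis by (simp add: bet_def block_trace_def perms_0 str_perm_0 sa_sum_def)
  next
    case 3
    then show ?thesis
      unfolding block_trace_def by (auto simp: bet_def str_str_perm sym_idem_def sa_scal_def sa_sum_def fun_eq_iff sum_distrib_left intro!: sum.cong)
  qed (simp add: bet_def block_trace_def)
qed

lemma alph_block_trace: "alph m n k = multiplicative_family.block_trace (\<lambda>k \<sigma>. sa_scal (of_int (sign \<sigma>)) (str_perm m n k \<sigma>)) k"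
proof -
  interpret multiplicative_family m "\<lambda>k \<sigma>. sa_scal (of_int (sign \<sigma>)) (str_perm m n k \<sigma>)" by (rule multiplicative_family_sgn)
  consider "k < 0" | "k = 0" | "0 < k" by linarith
  then show ?thesis
  proof cases
    case 2
    then show ?thesis by (simp add: alph_def block_trace_def perms_0 str_perm_0 sa_sum_def)
  next
    case 3
    then show ?thesis
      unfolding block_trace_def by (auto simp: alph_def str_str_perm antisym_idem_def sa_scal_def sa_sum_def fun_eq_iff sum_distrib_left intro!: sum.cong)
  qed (simp add: alph_def block_trace_def)
qed

section \<open>Translation to the complex group algebra of the statement\<close>

definition complex_galg :: "nat \<Rightarrow> ga \<Rightarrow> galg" where
  "complex_galg r x = (\<lambda>\<sigma>. if \<sigma> \<in> perms r then complex_of_real (coef x (Sp \<sigma>)) else 0)"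

lemma gmult_complex_galg:
  assumes "supported r x"
  shows "gmult r (complex_galg r x) (complex_galg r y) = complex_galg r (x * y)"
proof
  fix \<tau>
  show "gmult r (complex_galg r x) (complex_galg r y) \<tau> = complex_galg r (x * y) \<tau>"
  proof (cases "\<tau> \<in> perms r")
    case True
    have "gmult r (complex_galg r x) (complex_galg r y) \<tau> = (\<Sum>s\<in>sym_perms r. complex_galg r x (ap s) * complex_galg r y (inv (ap s) \<circ> \<tau>))"
      using True by (simp add: gmult_def) (rule sum_sym_perms[symmetric])
    also have "\<dots> = (\<Sum>s\<in>sym_perms r. of_real (coef x s * coef y (- s + Sp \<tau>)))"
    proof (rule sum.cong[OF refl])
      fix s assume s: "s \<in> sym_perms r"
      have "ap (- s + Sp \<tau>) = inv (ap s) \<circ> \<tau>" using True by (simp add: ap_plus ap_uminus ap_Sp)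
      then have "Sp (inv (ap s) \<circ> \<tau>) = - s + Sp \<tau>" by (metis Sp_ap)
      moreover have "inv (ap s) \<circ> \<tau> \<in> perms r" using s True by (simp add: sym_perms_def perms_comp perms_inv)
      ultimately show "complex_galg r x (ap s) * complex_galg r y (inv (ap s) \<circ> \<tau>) = of_real (coef x s * coef y (- s + Sp \<tau>))"
        using s by (simp add: complex_galg_def sym_perms_def Sp_ap)
    qed
    also have "\<dots> = of_real (coef (x * y) (Sp \<tau>))"
      using assms by (subst coef_mult[of "sym_perms r" x]) (auto simp: supported_def)
    finally show ?thesis using True by (simp add: complex_galg_def)
  qed (simp add: gmult_def complex_galg_def)
qed

lemma jm_complex_galg: "k \<le> r \<Longrightarrow> jm k = complex_galg r (jm_elem k)"
proof
  fix \<tau> assume k: "k \<le> r"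
  show "jm k \<tau> = complex_galg r (jm_elem k) \<tau>"
  proof (cases "\<tau> \<in> perms r")
    case True
    have eq: "transpose i k = \<tau> \<longleftrightarrow> transp_elem i k = Sp \<tau>" if "i \<in> {1..<k}" for i
      using that True ap_transp_elem[of i k] by (auto simp: transp_elem_def ap_Sp dest: arg_cong[of _ _ ap])
    have "jm k \<tau> = (\<Sum>i\<in>{1..<k}. if transp_elem i k = Sp \<tau> then 1 else 0)"
      unfolding jm_def
    proof (rule sum.cong[OF refl])
      fix i assume "i \<in> {1..<k}"
      from eq[OF this] show "(if \<tau> = transpose i k then 1 else 0) = (if transp_elem i k = Sp \<tau> then 1 else (0 :: complex))"
        by (cases "\<tau> = transpose i k") auto
    qed
    also have "\<dots> = complex_galg r (jm_elem k) \<tau>" using True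
      by (simp add: complex_galg_def jm_elem_def lookup_sum lookup_single when_def if_distrib cong: if_cong)
    finally show ?thesis .
  next
    case False
    have ne: "transpose i k \<noteq> \<tau>" if "i \<in> {1..<k}" for i
      using that False k perms_transpose[of i r k] by auto
    have "jm k \<tau> = 0" unfolding jm_def
    proof (rule sum.neutral, rule ballI)
      fix i assume "i \<in> {1..<k}"
      from ne[OF this] show "(if \<tau> = transpose i k then 1 else 0) = (0 :: complex)" by auto
    qed
    then show ?thesis using False by (simp add: complex_galg_def)
  qed
qed

lemma complex_galg_scalar: "complex_galg r (scalar c * x) = (\<lambda>\<tau>. of_real c * complex_galg r x \<tau>)"
  by (auto simp: complex_galg_def)

lemma gdelta_complex_galg:
  assumes "\<sigma> \<in> perms r"
  shows "gdelta \<sigma> = complex_galg r (gelem (Sp \<sigma>) 1)"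
proof
  fix \<tau>
  have "Sp \<sigma> = Sp \<tau> \<longleftrightarrow> \<tau> = \<sigma>" if "\<tau> \<in> perms r" using that assms ap_Sp by metis
  then show "gdelta \<sigma> \<tau> = complex_galg r (gelem (Sp \<sigma>) 1) \<tau>"
    using assms by (auto simp: gdelta_def complex_galg_def lookup_single when_def)
qed

lemma gmult_linear_right: "gmult r f (\<lambda>\<sigma>. g \<sigma> + c * h \<sigma>) = (\<lambda>\<tau>. gmult r f g \<tau> + c * gmult r f h \<tau>)"
  by (auto simp: gmult_def sum.distrib sum_distrib_left distrib_left mult_ac)

lemma gmult_linear_left: "gmult r (\<lambda>\<sigma>. g \<sigma> + c * h \<sigma>) f = (\<lambda>\<tau>. gmult r g f \<tau> + c * gmult r h f \<tau>)"
  by (auto simp: gmult_def sum.distrib sum_distrib_left distrib_left distrib_right mult_ac)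

text \<open>The eigenvalue is an integer, so a complex eigenvector equation separates into real and
  imaginary parts.\<close>

lemma complex_galg_complex_eigen:
  assumes "supported r x" "supported r y" "supported r u" "supported r v"
    and "(\<lambda>\<tau>. complex_galg r x \<tau> + \<i> * complex_galg r y \<tau>) = (\<lambda>\<tau>. of_int c * (complex_galg r u \<tau> + \<i> * complex_galg r v \<tau>))"
  shows "x = scalar (of_int c) * u" "y = scalar (of_int c) * v"
proof -
  have *: "coef x s = of_int c * coef u s \<and> coef y s = of_int c * coef v s" for s
  proof (cases "s \<in> sym_perms r")
    case True
    then show ?thesis using fun_cong[OF assms(5), of "ap s"]
      by (simp add: complex_galg_def sym_perms_def Sp_ap complex_eq_iff)
  next
    case False
    then show ?thesis using assms by (simp add: supported_coef)
  qed
  have "coef x s = coef (scalar (of_int c) * u) s" "coef y s = coef (scalar (of_int c) * v) s" for s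
    using * by (simp_all only: scalar_coef)
  then show "x = scalar (of_int c) * u" "y = scalar (of_int c) * v" by (auto intro: poly_mapping_eqI)
qed

context syt
begin

lemma jm_eigen:
  assumes "k \<in> {1..r}"
  shows "gmult r (jm k) (complex_galg r (E r)) = (\<lambda>\<tau>. of_int (content T k) * complex_galg r (E r) \<tau>)"
    "gmult r (complex_galg r (E r)) (jm k) = (\<lambda>\<tau>. of_int (content T k) * complex_galg r (E r) \<tau>)"
proof -
  have k: "k \<le> r" using assms by simp
  show "gmult r (jm k) (complex_galg r (E r)) = (\<lambda>\<tau>. of_int (content T k) * complex_galg r (E r) \<tau>)"
    unfolding jm_complex_galg[OF k] gmult_complex_galg[OF supported_jm_elem[OF k]] jm_elem_E[OF assms] complex_galg_scalar row_content_content[OF assms] by simp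
  show "gmult r (complex_galg r (E r)) (jm k) = (\<lambda>\<tau>. of_int (content T k) * complex_galg r (E r) \<tau>)"
    unfolding jm_complex_galg[OF k] gmult_complex_galg[OF supported_E] E_jm_elem[OF assms] complex_galg_scalar row_content_content[OF assms] by simp
qed

lemma complex_galg_E_id: "complex_galg r (E r) id \<noteq> 0"
proof -
  have "Sp id = 0" by (simp add: zero_sperm_def)
  then show ?thesis using E_norm_nonzero by (simp add: complex_galg_def perms_iff permutes_id)
qed

text \<open>The real and the imaginary part of any candidate are multiples of \<open>E r\<close> by
  \<open>unique\<close>; idempotency and being nonzero then force the complex factor to be
  1.\<close>

lemma seminormal_complex_galg: "seminormal r T = complex_galg r (E r)"
  unfolding seminormal_def
proof (rule the_equality)
  show "gmult r (complex_galg r (E r)) (complex_galg r (E r)) = complex_galg r (E r) \<and> complex_galg r (E r) \<noteq> (\<lambda>_. 0) \<and>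
      (\<forall>k\<in>{1..r}. gmult r (jm k) (complex_galg r (E r)) = (\<lambda>\<tau>. of_int (content T k) * complex_galg r (E r) \<tau>) \<and>
                   gmult r (complex_galg r (E r)) (jm k) = (\<lambda>\<tau>. of_int (content T k) * complex_galg r (E r) \<tau>))"
    using complex_galg_E_id jm_eigen by (auto simp: gmult_complex_galg supported_E idem_E dest: fun_cong[of _ _ id])
next
  fix e :: galg
  assume "gmult r e e = e \<and> e \<noteq> (\<lambda>_. 0) \<and>
      (\<forall>k\<in>{1..r}. gmult r (jm k) e = (\<lambda>\<tau>. of_int (content T k) * e \<tau>) \<and>
                   gmult r e (jm k) = (\<lambda>\<tau>. of_int (content T k) * e \<tau>))"
  then have ee: "gmult r e e = e" and e0: "e \<noteq> (\<lambda>_. 0)"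
    and eL: "\<And>k. k \<in> {1..r} \<Longrightarrow> gmult r (jm k) e = (\<lambda>\<tau>. of_int (content T k) * e \<tau>)"
    and eR: "\<And>k. k \<in> {1..r} \<Longrightarrow> gmult r e (jm k) = (\<lambda>\<tau>. of_int (content T k) * e \<tau>)"
    by auto
  have supp: "e \<tau> = 0" if "\<tau> \<notin> perms r" for \<tau>
    using fun_cong[OF ee, of \<tau>] that by (simp add: gmult_def)
  define x where "x = (\<Sum>s\<in>sym_perms r. gelem s (Re (e (ap s))))"
  define y where "y = (\<Sum>s\<in>sym_perms r. gelem s (Im (e (ap s))))"
  have A: "supported r x" "supported r y" unfolding x_def y_def by (auto intro!: supported_sum supported_gelem)
  have cf: "coef x s = Re (e (ap s))" "coef y s = Im (e (ap s))" if "s \<in> sym_perms r" for s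
    using that by (simp_all add: x_def y_def lookup_sum lookup_single when_def)
  have e: "e = (\<lambda>\<tau>. complex_galg r x \<tau> + \<i> * complex_galg r y \<tau>)"
  proof
    fix \<tau> show "e \<tau> = complex_galg r x \<tau> + \<i> * complex_galg r y \<tau>"
      using cf[of "Sp \<tau>"] supp[of \<tau>] complex_eq[of "e \<tau>"] by (cases "\<tau> \<in> perms r") (auto simp: complex_galg_def sym_perms_def ap_Sp)
  qed
  have L: "jm_elem k * x = scalar (row_content rho k) * x \<and> jm_elem k * y = scalar (row_content rho k) * y" if k: "k \<in> {1..r}" for k
  proof -
    have kr: "k \<le> r" using k by simp
    have "(\<lambda>\<tau>. complex_galg r (jm_elem k * x) \<tau> + \<i> * complex_galg r (jm_elem k * y) \<tau>) = (\<lambda>\<tau>. of_int (content T k) * (complex_galg r x \<tau> + \<i> * complex_galg r y \<tau>))"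
      using eL[OF k] unfolding e gmult_linear_right jm_complex_galg[OF kr] gmult_complex_galg[OF supported_jm_elem[OF kr]] .
    then show ?thesis unfolding row_content_content[OF k]
      using complex_galg_complex_eigen[of r "jm_elem k * x" "jm_elem k * y" x y "content T k"] A supported_mult[OF supported_jm_elem[OF kr]] by blast
  qed
  have R: "x * jm_elem k = scalar (row_content rho k) * x \<and> y * jm_elem k = scalar (row_content rho k) * y" if k: "k \<in> {1..r}" for k
  proof -
    have kr: "k \<le> r" using k by simp
    have "(\<lambda>\<tau>. complex_galg r (x * jm_elem k) \<tau> + \<i> * complex_galg r (y * jm_elem k) \<tau>) = (\<lambda>\<tau>. of_int (content T k) * (complex_galg r x \<tau> + \<i> * complex_galg r y \<tau>))"
      using eR[OF k] unfolding e gmult_linear_left jm_complex_galg[OF kr] gmult_complex_galg[OF A(1)] gmult_complex_galg[OF A(2)] .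
    then show ?thesis unfolding row_content_content[OF k]
      using complex_galg_complex_eigen[of r "x * jm_elem k" "y * jm_elem k" x y "content T k"] A supported_mult[OF _ supported_jm_elem[OF kr]] by blast
  qed
  obtain a b where "x = scalar a * E r" "y = scalar b * E r"
    using unique[OF A(1)] unique[OF A(2)] L R by metis
  then have ez: "e = (\<lambda>\<tau>. Complex a b * complex_galg r (E r) \<tau>)"
    unfolding e by (intro ext) (simp add: complex_galg_scalar Complex_eq algebra_simps)
  define z where "z = Complex a b"
  have "gmult r e e = (\<lambda>\<tau>. z * (z * complex_galg r (E r) \<tau>))"
  proof -
    have "gmult r e e = (\<lambda>\<tau>. z * (z * gmult r (complex_galg r (E r)) (complex_galg r (E r)) \<tau>))"
      unfolding ez z_def[symmetric] by (auto simp: gmult_def sum_distrib_left mult_ac)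
    then show ?thesis by (simp add: gmult_complex_galg supported_E idem_E)
  qed
  then have "z * (z * complex_galg r (E r) id) = z * complex_galg r (E r) id" using ee ez fun_cong[of _ _ id] by (metis z_def)
  then have "z * z = z" using complex_galg_E_id by (simp add: mult.assoc[symmetric])
  moreover have "z \<noteq> 0" using e0 ez by (auto simp: z_def)
  ultimately have "z = 1" by simp
  then show "e = complex_galg r (E r)" unfolding ez z_def[symmetric] by simp
qed

text \<open>The coefficient of \<open>\<tau>\<close> in \<open>\<sigma>\<close> times
  \<open>\<tau>\<close> times \<open>E r\<close> is a summand of
  \<open>sum_conjugates\<close>.\<close>

lemma char_E:
  assumes "\<sigma> \<in> perms r"
  shows "(\<Sum>\<tau>\<in>perms r. gmult r (gmult r (gdelta \<sigma>) (gdelta \<tau>)) (complex_galg r (E r)) \<tau>) = of_int (alt_char r N (row_ends rho r) \<sigma>)"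
proof -
  let ?u = "Sp \<sigma>"
  have u: "?u \<in> sym_perms r" using assms by (simp add: sym_perms_def ap_Sp)
  have "(\<Sum>\<tau>\<in>perms r. gmult r (gmult r (gdelta \<sigma>) (gdelta \<tau>)) (complex_galg r (E r)) \<tau>) =
     (\<Sum>s\<in>sym_perms r. complex_of_real (coef (E r) (- s + (- ?u + s))))"
    unfolding sum_sym_perms[symmetric]
  proof (rule sum.cong[OF refl])
    fix s assume s: "s \<in> sym_perms r"
    then have p: "ap s \<in> perms r" by (simp add: sym_perms_def)
    have g: "gmult r (gdelta \<sigma>) (gdelta (ap s)) = complex_galg r (gelem (?u + s) 1)"
      unfolding gdelta_complex_galg[OF assms] gdelta_complex_galg[OF p] gmult_complex_galg[OF supported_gelem[OF u]] by (simp add: mult_single Sp_ap)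
    have "gmult r (gmult r (gdelta \<sigma>) (gdelta (ap s))) (complex_galg r (E r)) (ap s) = of_real (coef (gelem (?u + s) 1 * E r) s)"
      unfolding g gmult_complex_galg[OF supported_gelem[OF sym_perms_plus[OF u s]]] using p by (simp add: complex_galg_def Sp_ap)
    also have "\<dots> = of_real (coef (E r) (- s + (- ?u + s)))"
      by (simp only: coef_gelem_mult minus_add mult_1_left add.assoc)
    finally show "gmult r (gmult r (gdelta \<sigma>) (gdelta (ap s))) (complex_galg r (E r)) (ap s) = of_real (coef (E r) (- s + (- ?u + s)))" .
  qed
  also have "\<dots> = of_int (alt_char r N (row_ends rho r) \<sigma>)"
    using sum_conjugates[OF u] assms by (simp add: ap_Sp)
  finally show ?thesis .
qed

lemma rho_length: "x \<in> {1..r} \<Longrightarrow> rho x < length lam"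
  using T_diagram[of x] by (cases "T x") (auto simp: rho_def diagram_def)

lemma sum_row_ends: "(\<Sum>i<length lam. row_ends rho r i + int i) = int r"
proof -
  have "(\<Sum>i<length lam. card {x \<in> {1..r}. rho x = i}) = card {1..r}"
    unfolding card_eq_sum by (rule sum.group) (use rho_length in auto)
  then have "(\<Sum>i<length lam. int (card {x \<in> {1..r}. rho x = i})) = int r" by (simp flip: of_nat_sum)
  then show ?thesis by (simp add: row_ends_card)
qed

lemma class_ext_complex_galg: "class_ext r f (E r) = (\<Sum>\<sigma>\<in>perms r. complex_galg r (E r) \<sigma> * f \<sigma>)"
  unfolding class_ext_def by (subst sum_sym_perms[symmetric]) (auto simp: complex_galg_def sym_perms_def Sp_ap intro!: sum.cong)

end

section \<open>The sign character and transposed tableaux\<close>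

definition sgn_twist :: "nat \<Rightarrow> ga \<Rightarrow> ga" where
  "sgn_twist r x = (\<Sum>s\<in>sym_perms r. gelem s (of_int (sign (ap s)) * coef x s))"

lemma coef_sgn_twist: "coef (sgn_twist r x) s = (if s \<in> sym_perms r then of_int (sign (ap s)) * coef x s else 0)"
  by (simp add: sgn_twist_def lookup_sum lookup_single when_def)

lemma supported_sgn_twist: "supported r (sgn_twist r x)"
  by (simp add: supported_coef coef_sgn_twist)

lemma sign_sym_perms_plus: "s \<in> sym_perms r \<Longrightarrow> t \<in> sym_perms r \<Longrightarrow> sign (ap (s + t)) = sign (ap s) * sign (ap t)"
  by (simp add: ap_plus sym_perms_def sign_perms_comp)

lemma sgn_twist_mult:
  assumes "supported r x" "supported r y"
  shows "sgn_twist r (x * y) = sgn_twist r x * sgn_twist r y"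
proof (rule poly_mapping_eqI)
  fix t
  have R: "coef (sgn_twist r x * sgn_twist r y) t = (\<Sum>s\<in>sym_perms r. coef (sgn_twist r x) s * coef (sgn_twist r y) (- s + t))"
    by (rule coef_mult) (use supported_sgn_twist in \<open>auto simp: supported_def\<close>)
  show "coef (sgn_twist r (x * y)) t = coef (sgn_twist r x * sgn_twist r y) t"
  proof (cases "t \<in> sym_perms r")
    case True
    have "coef (sgn_twist r (x * y)) t = (\<Sum>s\<in>sym_perms r. of_int (sign (ap t)) * (coef x s * coef y (- s + t)))"
      using True assms(1) by (simp add: coef_sgn_twist coef_mult[of "sym_perms r" x] supported_def sum_distrib_left)
    also have "\<dots> = (\<Sum>s\<in>sym_perms r. coef (sgn_twist r x) s * coef (sgn_twist r y) (- s + t))"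
    proof (rule sum.cong[OF refl])
      fix s assume s: "s \<in> sym_perms r"
      have st: "- s + t \<in> sym_perms r" using s True by (intro sym_perms_plus sym_perms_uminus)
      have "s + (- s + t) = t" by (simp add: add.assoc[symmetric])
      then have "sign (ap t) = sign (ap s) * sign (ap (- s + t))" using sign_sym_perms_plus[OF s st] by simp
      then show "of_int (sign (ap t)) * (coef x s * coef y (- s + t)) = coef (sgn_twist r x) s * coef (sgn_twist r y) (- s + t)"
        using s st by (simp add: coef_sgn_twist)
    qed
    finally show ?thesis unfolding R .
  next
    case False
    then show ?thesis using supported_mult[OF supported_sgn_twist supported_sgn_twist, of r x y] by (simp add: coef_sgn_twist supported_coef)
  qed
qed

lemma sgn_twist_scalar: "sgn_twist r (scalar c * x) = scalar c * sgn_twist r x"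
  by (rule poly_mapping_eqI) (simp add: coef_sgn_twist)

text \<open>Transpositions are odd; this mirrors the change of sign of all contents when a tableau
  is transposed.\<close>

lemma sgn_twist_jm_elem: "k \<le> r \<Longrightarrow> sgn_twist r (jm_elem k) = - jm_elem k"
proof (rule poly_mapping_eqI)
  fix s assume k: "k \<le> r"
  show "coef (sgn_twist r (jm_elem k)) s = coef (- jm_elem k) s"
  proof (cases "coef (jm_elem k) s = 0")
    case False
    then obtain i where i: "i \<in> {1..<k}" "transp_elem i k = s"
      by (auto simp: jm_elem_def lookup_sum lookup_single when_def split: if_splits elim!: sum.not_neutral_contains_not_neutral)
    then have "sign (ap s) = -1" by (auto simp: ap_transp_elem sign_swap_id)
    moreover have "s \<in> sym_perms r" using i k transp_elem_sym_perms[of i r k] by auto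
    ultimately show ?thesis by (simp add: coef_sgn_twist)
  qed (simp add: coef_sgn_twist)
qed

lemma class_ext_sgn_twist: "class_ext r (\<lambda>\<sigma>. of_int (sign \<sigma>) * f \<sigma>) x = class_ext r f (sgn_twist r x)"
  unfolding class_ext_def by (rule sum.cong) (auto simp: coef_sgn_twist)

text \<open>The twisted idempotent of the transposed tableau has the contents of \<open>T\<close>,
  so by uniqueness it is a multiple of the idempotent of \<open>T\<close>. Both are nonzero
  idempotents, hence the factor is 1.\<close>

lemma sgn_twist_E:
  assumes "syt r lam T N" "syt r lam' (prod.swap \<circ> T) N'"
  shows "sgn_twist r (seminormal_elem N' (syt.rho (prod.swap \<circ> T)) r) = seminormal_elem N (syt.rho T) r"
proof -
  interpret A: syt r lam T N by (rule assms)
  interpret B: syt r lam' "prod.swap \<circ> T" N' by (rule assms)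
  let ?e = "sgn_twist r (B.E r)"
  have c: "row_content B.rho j = - row_content A.rho j" if "j \<in> {1..r}" for j
    unfolding A.row_content_content[OF that] B.row_content_content[OF that] by (simp add: content_def)
  have L: "jm_elem j * ?e = scalar (row_content A.rho j) * ?e" if j: "j \<in> {1..r}" for j
  proof -
    have jr: "j \<le> r" using j by simp
    have "- (jm_elem j * ?e) = sgn_twist r (jm_elem j * B.E r)" by (simp add: sgn_twist_mult supported_jm_elem jr B.supported_E sgn_twist_jm_elem)
    also have "\<dots> = - (scalar (row_content A.rho j) * ?e)" unfolding B.jm_elem_E[OF j] sgn_twist_scalar c[OF j] by (simp add: single_uminus)
    finally show ?thesis by simp
  qed
  have R: "?e * jm_elem j = scalar (row_content A.rho j) * ?e" if j: "j \<in> {1..r}" for j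
  proof -
    have jr: "j \<le> r" using j by simp
    have "- (?e * jm_elem j) = sgn_twist r (B.E r * jm_elem j)" by (simp add: sgn_twist_mult supported_jm_elem jr B.supported_E sgn_twist_jm_elem)
    also have "\<dots> = - (scalar (row_content A.rho j) * ?e)" unfolding B.E_jm_elem[OF j] sgn_twist_scalar c[OF j] by (simp add: single_uminus)
    finally show ?thesis by simp
  qed
  obtain d where d: "?e = scalar d * A.E r" using A.unique[OF supported_sgn_twist L R] by blast
  have "?e * ?e = ?e" using sgn_twist_mult[OF B.supported_E B.supported_E] by (simp add: B.idem_E)
  then have "scalar (d * d) * A.E r = scalar d * A.E r"
    unfolding d by (metis A.idem_E scalar_left scalar_mult mult.assoc)
  then have "coef (scalar (d * d) * A.E r) 0 = coef (scalar d * A.E r) 0" by simp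
  then have "d * d = d" using A.E_norm_nonzero by simp
  moreover have "d \<noteq> 0"
  proof
    assume "d = 0"
    then have "coef ?e 0 = 0" using d by simp
    then show False using B.E_norm_nonzero by (simp add: coef_sgn_twist sym_perms_zero ap_zero)
  qed
  ultimately show ?thesis using d by simp
qed

text \<open>Orbit counting: a sorted tuple \<open>S\<close> has \<open>fact r / multfact S\<close>
  rearrangements, on all of which \<open>G\<close> takes the same value.\<close>

lemma sum_sorted_representatives:
  fixes G :: "nat list \<Rightarrow> complex"
  assumes G: "\<And>I \<tau>. I \<in> idx m n r \<Longrightarrow> \<tau> \<in> perms r \<Longrightarrow> G (pact \<tau> I) = G I"
  shows "(\<Sum>I\<in>{I \<in> idx m n r. sorted I}. 1 / of_nat (multfact I) * G I) = (\<Sum>I\<in>idx m n r. G I) / fact r"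
proof -
  let ?S = "{I \<in> idx m n r. sorted I}"
  have fin: "finite ?S" by (rule finite_subset[OF _ finite_idx]) auto
  have "(\<Sum>I\<in>idx m n r. G I) = (\<Sum>S\<in>?S. \<Sum>I\<in>{I \<in> idx m n r. sort I = S}. G I)"
    by (rule sum.group[symmetric, OF finite_idx fin]) (auto simp: idx_def)
  also have "\<dots> = (\<Sum>S\<in>?S. fact r / of_nat (multfact S) * G S)"
  proof (rule sum.cong[OF refl])
    fix S assume S: "S \<in> ?S"
    have len: "length S = r" using S by (auto simp: idx_def)
    have eq: "{I \<in> idx m n r. sort I = S} = permutations_of_multiset (mset S)"
    proof (intro subset_antisym subsetI)
      fix I assume "I \<in> {I \<in> idx m n r. sort I = S}"
      then show "I \<in> permutations_of_multiset (mset S)" by (auto simp: permutations_of_multiset_def)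
    next
      fix I assume "I \<in> permutations_of_multiset (mset S)"
      then have I: "mset I = mset S" by (simp add: permutations_of_multiset_def)
      then have "sort I = S" using S by (metis (mono_tags, lifting) mem_Collect_eq properties_for_sort)
      moreover have "I \<in> idx m n r"
        using S mset_eq_setD[OF I] mset_eq_length[OF I] by (simp add: idx_def)
      ultimately show "I \<in> {I \<in> idx m n r. sort I = S}" by simp
    qed
    have GI: "G I = G S" if "I \<in> permutations_of_multiset (mset S)" for I
    proof -
      have "mset I = mset S" using that by (simp add: permutations_of_multiset_def)
      then obtain p where p: "p permutes {..<length S}" "permute_list p S = I" by (rule mset_eq_permutation)
      let ?q = "map_permutation {..<r} Suc p"
      have bij: "bij_betw Suc {..<r} {1..r}" by (rule bij_betw_byWitness[where f' = "\<lambda>x. x - 1"]) auto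
      have q: "?q \<in> perms r" unfolding perms_iff using map_permutation_permutes[OF bij] p(1) len by simp
      \<comment> \<open>\<open>pact\<close> reads a tuple through the inverse permutation,
        \<open>permute_list\<close> through the permutation itself.\<close>
      have "pact (inv ?q) S = I"
      proof (rule nth_equalityI)
        show "length (pact (inv ?q) S) = length I" using p by auto
        fix a assume "a < length (pact (inv ?q) S)"
        then have a: "a < r" by (simp add: len)
        have "?q (Suc a) = Suc (p a)" by (rule map_permutation_apply) (use a in auto)
        moreover have "inv (inv ?q) = ?q" using q by (simp add: perms_iff permutes_bij inv_inv_eq)
        ultimately have "pact (inv ?q) S ! a = S ! p a" using a len by (simp add: pact_nth)
        also have "\<dots> = I ! a" using p a len by (auto simp: permute_list_def)
        finally show "pact (inv ?q) S ! a = I ! a" .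
      qed
      then show ?thesis using G[of S "inv ?q"] S perms_inv[OF q] by auto
    qed
    have mf: "(\<Prod>x\<in>set_mset (mset S). fact (count (mset S) x)) = multfact S"
      by (simp add: multfact_def count_mset)
    have "card (permutations_of_multiset (mset S)) * multfact S = fact r"
      using card_permutations_of_multiset_aux[of "mset S"] mf len by simp
    then have "complex_of_nat (card (permutations_of_multiset (mset S))) * of_nat (multfact S) = fact r"
      by (metis of_nat_fact of_nat_mult)
    moreover have "multfact S \<noteq> 0" by (simp add: multfact_def)
    ultimately have "complex_of_nat (card (permutations_of_multiset (mset S))) = fact r / of_nat (multfact S)"
      by (simp add: eq_divide_eq)
    then show "(\<Sum>I\<in>{I \<in> idx m n r. sort I = S}. G I) = fact r / of_nat (multfact S) * G S"
      unfolding eq using GI by simp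
  qed
  finally show ?thesis by (simp add: sum_divide_distrib)
qed

lemma sa_det_cong:
  assumes "\<And>i j. 1 \<le> i \<Longrightarrow> i \<le> L \<Longrightarrow> M i j = M' i j"
  shows "sa_det m L M = sa_det m L M'"
proof -
  have "foldr (\<lambda>i acc. sa_mult m (M i (p i)) acc) [1..<L+1] sa_one = foldr (\<lambda>i acc. sa_mult m (M' i (p i)) acc) [1..<L+1] sa_one" for p
    by (rule foldr_cong) (use assms in auto)
  then show ?thesis by (simp add: sa_det_def)
qed

theorem theorem3p6:
  fixes m n r :: nat and lam :: "nat list" and T :: "nat \<Rightarrow> nat \<times> nat"
  assumes "1 \<le> r" and "is_partition r lam" and "is_syt r lam T"
  shows "sa_det m (part lam 1) (\<lambda>i j. alph m n (int (conjp lam i) - int i + int j))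
           = sa_det m (conjp lam 1) (\<lambda>i j. bet m n (int (part lam i) - int i + int j))
       \<and> sa_det m (conjp lam 1) (\<lambda>i j. bet m n (int (part lam i) - int i + int j))
           = str m n r (tmult m n r (galg_op m r (seminormal r T)) (Xprod m n r))
       \<and> str m n r (tmult m n r (galg_op m r (seminormal r T)) (Xprod m n r))
           = sa_sum (\<lambda>I. sa_scal (1 / of_nat (multfact I)) (Imm m n r (irr_char r lam) I))
                    {I \<in> idx m n r. sorted I}"
proof -
  have sorted: "sorted (rev lam)" using assms(2) by (simp add: is_partition_def)
  let ?L = "length lam" and ?L' = "length (conj_list lam)"
  have sA: "syt r lam T (Suc ?L)" by unfold_locales (use sorted assms(3) in auto)
  have sB: "syt r (conj_list lam) (prod.swap \<circ> T) (Suc ?L')"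
    by unfold_locales (use sorted_conj_list is_syt_conj[OF sorted assms(3)] in auto)
  interpret A: syt r lam T "Suc ?L" by (rule sA)
  interpret B: syt r "conj_list lam" "prod.swap \<circ> T" "Suc ?L'" by (rule sB)
  have str: "str m n r (tmult m n r (galg_op m r (seminormal r T)) (Xprod m n r)) c = class_ext r (\<lambda>\<sigma>. str_perm m n r \<sigma> c) (A.E r)" for c
    by (simp add: str_str_perm A.seminormal_complex_galg A.class_ext_complex_galg)
  have extA: "class_ext r (\<lambda>\<sigma>. str_perm m n r \<sigma> c) (A.E r) = alt_trace r (Suc ?L) (row_ends A.rho r) (\<lambda>\<sigma>. str_perm m n r \<sigma> c)" for c
    by (rule A.class_ext_E[OF classfn_str_perm])
  have detB: "sa_det m (conjp lam 1) (\<lambda>i j. bet m n (int (part lam i) - int i + int j)) c =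
      alt_trace r (Suc ?L) (row_ends A.rho r) (\<lambda>\<sigma>. str_perm m n r \<sigma> c)" for c
  proof -
    interpret multiplicative_family m "str_perm m n" by (rule multiplicative_family_str_perm)
    have "sa_det m (conjp lam 1) (\<lambda>i j. bet m n (int (part lam i) - int i + int j)) =
       sa_det m ?L (\<lambda>i j. block_trace (row_ends A.rho r (i - 1) + int j - 1))"
      unfolding conjp_1[OF assms(2)] bet_block_trace
      by (rule sa_det_cong, rule arg_cong[of _ _ block_trace]) (simp add: A.row_ends_final of_nat_diff)
    moreover have "row_ends A.rho r ?L = - int ?L" by (simp add: A.row_ends_final part_def)
    ultimately show ?thesis using det_alt_trace[OF A.sum_row_ends, of c] by (simp only:)
  qed
  have detA: "sa_det m (part lam 1) (\<lambda>i j. alph m n (int (conjp lam i) - int i + int j)) c =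
      class_ext r (\<lambda>\<sigma>. str_perm m n r \<sigma> c) (A.E r)" for c
  proof -
    let ?Ph = "\<lambda>k \<sigma>. sa_scal (of_int (sign \<sigma>)) (str_perm m n k \<sigma>)"
    interpret multiplicative_family m ?Ph by (rule multiplicative_family_sgn)
    have "sa_det m (part lam 1) (\<lambda>i j. alph m n (int (conjp lam i) - int i + int j)) =
       sa_det m ?L' (\<lambda>i j. block_trace (row_ends B.rho r (i - 1) + int j - 1))"
      unfolding alph_block_trace length_conj_list
      by (rule sa_det_cong, rule arg_cong[of _ _ block_trace]) (simp add: B.row_ends_final part_conj of_nat_diff)
    moreover have "row_ends B.rho r ?L' = - int ?L'"
      by (simp add: B.row_ends_final part_def[of "conj_list lam"] del: length_conj_list)
    ultimately have "sa_det m (part lam 1) (\<lambda>i j. alph m n (int (conjp lam i) - int i + int j)) c = alt_trace r (Suc ?L') (row_ends B.rho r) (\<lambda>\<sigma>. ?Ph r \<sigma> c)"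
      using det_alt_trace[OF B.sum_row_ends, of c] by (simp only:)
    also have "\<dots> = class_ext r (\<lambda>\<sigma>. ?Ph r \<sigma> c) (B.E r)" by (rule B.class_ext_E[OF Ph_class, symmetric])
    \<comment> \<open>The sign moves from the class function to the idempotent, where it replaces
      the transposed tableau by \<open>T\<close>.\<close>
    also have "\<dots> = class_ext r (\<lambda>\<sigma>. str_perm m n r \<sigma> c) (A.E r)"
      unfolding sa_scal_def class_ext_sgn_twist sgn_twist_E[OF sA sB] ..
    finally show ?thesis .
  qed
  have imm: "sa_sum (\<lambda>I. sa_scal (1 / of_nat (multfact I)) (Imm m n r (irr_char r lam) I)) {I \<in> idx m n r. sorted I} c =
      alt_trace r (Suc ?L) (row_ends A.rho r) (\<lambda>\<sigma>. str_perm m n r \<sigma> c)" for c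
  proof -
    \<comment> \<open>\<open>irr_char\<close> chooses a tableau of its own; it has the same final
      row ends as \<open>T\<close> and hence the same \<open>alt_char\<close>.\<close>
    define T0 where "T0 = (SOME T. is_syt r lam T)"
    have T0: "is_syt r lam T0" unfolding T0_def by (rule someI[of "is_syt r lam" T]) (rule assms(3))
    interpret C: syt r lam T0 "Suc ?L" by unfold_locales (use sorted T0 in auto)
    have "row_ends C.rho r = row_ends A.rho r" by (rule ext) (simp add: A.row_ends_final C.row_ends_final)
    then have chi: "irr_char r lam \<sigma> = of_int (alt_char r (Suc ?L) (row_ends A.rho r) \<sigma>)" if "\<sigma> \<in> perms r" for \<sigma>
      using C.char_E[OF that] by (simp add: irr_char_def T0_def[symmetric] C.seminormal_complex_galg)
    have cl: "classfn r (irr_char r lam)"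
      unfolding classfn_def
    proof (intro ballI)
      fix \<sigma> \<tau> assume st: "\<sigma> \<in> perms r" "\<tau> \<in> perms r"
      then have "\<tau> \<circ> \<sigma> \<circ> inv \<tau> \<in> perms r" by (intro perms_comp perms_inv)
      then show "irr_char r lam (\<tau> \<circ> \<sigma> \<circ> inv \<tau>) = irr_char r lam \<sigma>"
        using chi st classfnD[OF classfn_alt_char st] by simp
    qed
    have "sa_sum (\<lambda>I. sa_scal (1 / of_nat (multfact I)) (Imm m n r (irr_char r lam) I)) {I \<in> idx m n r. sorted I} c =
       (\<Sum>I\<in>idx m n r. Imm m n r (irr_char r lam) I c) / fact r"
      unfolding sa_sum_def sa_scal_def
      by (rule sum_sorted_representatives) (simp add: Imm_pact[OF cl])
    also have "(\<Sum>I\<in>idx m n r. Imm m n r (irr_char r lam) I c) = (\<Sum>\<sigma>\<in>perms r. irr_char r lam \<sigma> * str_perm m n r \<sigma> c)"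
      using fun_cong[OF str_str_perm[of m n r "irr_char r lam"], of c] unfolding str_Imm sa_sum_def .
    finally show ?thesis by (simp add: alt_trace_def chi)
  qed
  show ?thesis using str extA detA detB imm by (intro conjI ext) simp_all
qed

end
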